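(* Let $q\ge 2$, let $M=(M(i,j))_{1\le i,j\le q}$ be a stochastic matrix with all entries strictly positive (not assumed reversible), and let $\alpha$ be its unique invariant probability vector. Let $\mathbb{Q}$ be the law of a Galton-Watson tree $T$ with i.i.d. offspring numbers whose distribution is concentrated on $\{1,2,\dots\}$ and has finite mean, denoted $\mathbb{Q}(d)$. Let $c(M)=\sup_{p}\frac{L(pM^{\mathrm{rev}})}{L(p)}$ be the constant defined in the context. If $\mathbb{Q}(d)\,c(M)<1$, then for $\mathbb{Q}$-almost every tree $T$ the tree-indexed Markov chain $\mathbb{P}$ on $\{1,\dots,q\}^T$ with transition matrix $M$ in equilibrium is an extremal Gibbs measure (an extreme point of the convex set of Gibbs measures). Equivalently, for $\mathbb{Q}$-almost every $T$ there is no reconstruction.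
   Context: Trees: $T$ is an infinite rooted tree without leaves in which every vertex has finitely many children; $0$ is the root, $v\to w$ means $w$ is a child of $v$, $|v|$ is the distance of $v$ to the root, and $T^N$ is the subtree of vertices with $|v|\le N$. A Galton-Watson tree with offspring distribution concentrated on $\{1,2,\dots\}$ with finite mean is such a tree almost surely. Tree-indexed Markov chain in equilibrium: $\mathbb{P}$ is the probability measure on $\{1,\dots,q\}^T$ whose marginals on $\{1,\dots,q\}^{T^N}$ are $\mathbb{P}_{T^N}(\sigma_{T^N})=\alpha(\sigma(0))\prod_{v\to w}M(\sigma(v),\sigma(w))$, the product being over all pairs $v,w\in T^N$ with $v\to w$. Here $\alpha$ satisfies $\sum_i\alpha(i)M(i,j)=\alpha(j)$; all $\alpha(i)>0$. Gibbs measures: a probability measure $\mu$ on $\{1,\dots,q\}^T$ is a Gibbs measure if it has the same finite-volume conditional probabilities as $\mathbb{P}$, i.e. for every finite $V\subset T$ and all sufficiently large $N$, $\mu(\sigma_V\mid\sigma_{V^c})=\mathbb{P}_{T^N}(\sigma_V\mid\sigma_{\partial V})$ $\mu$-almost surely, where $\partial V$ is the set of vertices outside $V$ adjacent to a vertex of $V$. The Gibbs measures form a convex set containing $\mathbb{P}$. No reconstruction: for every $s\in\{1,\dots,q\}$ and $\varepsilon>0$, $\lim_{N\to\infty}\mathbb{P}\big(\xi:\ |\mathbb{P}(\sigma(0)=s\mid \sigma(w)=\xi(w)\ \forall w \text{ with } |w|=N)-\alpha(s)|\ge\varepsilon\big)=0$. The constant $c(M)$: $P$ is the simplex of probability vectors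 of length $q$; $S(p|\alpha)=\sum_i p(i)\log\frac{p(i)}{\alpha(i)}$ is relative entropy; $L(p)=S(p|\alpha)+S(\alpha|p)=\sum_{i=1}^q(p(i)-\alpha(i))\log\frac{p(i)}{\alpha(i)}\in[0,\infty]$, with $L(p)=+\infty$ if some $p(i)=0$. The reversed chain has transition matrix $M^{\mathrm{rev}}(i,j)=\frac{\alpha(j)M(j,i)}{\alpha(i)}$, and $(pM^{\mathrm{rev}})(j)=\sum_i p(i)M^{\mathrm{rev}}(i,j)$. Then $c(M)=\sup_{p\in P,\,p\ne\alpha}\frac{L(pM^{\mathrm{rev}})}{L(p)}$, where the ratio is read as $0$ when $L(p)=+\infty$ (the numerator is always finite because $pM^{\mathrm{rev}}$ has positive entries). *)

theory Defs
  imports "HOL-Probability.Probability"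
begin

section \<open>Trees\<close>

text \<open>Rooted trees in Ulam--Harris coding: a vertex is the list of child indices on the path from
  the root, so the root is the empty list, the distance to the root is the length, and the children
  of \<open>v\<close> are among the lists \<open>v @ [i]\<close>.\<close>

type_synonym vertex = "nat list"

definition child :: "vertex \<Rightarrow> vertex \<Rightarrow> bool" where
  "child v w \<longleftrightarrow> (\<exists>i. w = v @ [i])"

definition trunc :: "vertex set \<Rightarrow> nat \<Rightarrow> vertex set" where
  "trunc T N = {v \<in> T. length v \<le> N}"

definition boundary :: "vertex set \<Rightarrow> vertex set \<Rightarrow> vertex set" where
  "boundary T V = {w \<in> T - V. \<exists>v\<in>V. child v w \<or> child w v}"

text \<open>The tree in which every vertex \<open>v\<close> has exactly \<open>X v\<close> children.\<close>

inductive_set tree_of :: "(vertex \<Rightarrow> nat) \<Rightarrow> vertex set" for X :: "vertex \<Rightarrow> nat" where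
  root: "[] \<in> tree_of X"
| step: "v \<in> tree_of X \<Longrightarrow> i < X v \<Longrightarrow> v @ [i] \<in> tree_of X"

definition tree_space :: "vertex set measure" where
  "tree_space = sigma UNIV (range (\<lambda>v. {T. v \<in> T}))"

definition galton_watson :: "nat pmf \<Rightarrow> vertex set measure" where
  "galton_watson D = distr (\<Pi>\<^sub>M v\<in>UNIV. measure_pmf D) tree_space tree_of"

text \<open>Since \<open>distr\<close> along a non-measurable map is degenerate, we record measurability.\<close>

lemma snoc_in_tree_of_iff: "v @ [i] \<in> tree_of X \<longleftrightarrow> v \<in> tree_of X \<and> i < X v"
  by (auto intro: tree_of.step elim: tree_of.cases)

lemma tree_of_measurable:
  "tree_of \<in> measurable (\<Pi>\<^sub>M v\<in>UNIV. measure_pmf D) tree_space"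
proof -
  let ?P = "\<Pi>\<^sub>M v\<in>(UNIV :: vertex set). measure_pmf D"
  have mem: "{X \<in> space ?P. v \<in> tree_of X} \<in> sets ?P" for v
  proof (induction v rule: rev_induct)
    case Nil
    then show ?case by (simp add: tree_of.root)
  next
    case (snoc i v)
    have "(\<lambda>X. X v) \<in> measurable ?P (measure_pmf D)"
      by (rule measurable_component_singleton) simp
    then have "(\<lambda>X. X v) -` {i<..} \<inter> space ?P \<in> sets ?P"
      by (rule measurable_sets) simp
    moreover have "{X \<in> space ?P. v @ [i] \<in> tree_of X} =
        {X \<in> space ?P. v \<in> tree_of X} \<inter> ((\<lambda>X. X v) -` {i<..} \<inter> space ?P)"
      by (auto simp: snoc_in_tree_of_iff)
    ultimately show ?case using snoc by simp
  qed
  show ?thesis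
    unfolding tree_space_def
  proof (rule measurable_measure_of)
    fix A assume "A \<in> range (\<lambda>v::vertex. {T. v \<in> T})"
    then obtain v where A: "A = {T. v \<in> T}" by blast
    have "tree_of -` A \<inter> space ?P = {X \<in> space ?P. v \<in> tree_of X}"
      unfolding A by blast
    then show "tree_of -` A \<inter> space ?P \<in> sets ?P" using mem by simp
  qed auto
qed

lemma prob_space_galton_watson: "prob_space (galton_watson D)"
  unfolding galton_watson_def
  by (intro prob_space.prob_space_distr prob_space_PiM prob_space_measure_pmf tree_of_measurable)

section \<open>The tree-indexed Markov chain\<close>

text \<open>The state space \<open>{1,\<dots>,q}\<close> is a finite type \<open>'q\<close>. Configurations on \<open>T\<close> are extensional functions
  on \<open>T\<close>, with the product \<open>\<sigma>\<close>-algebra.\<close>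

definition prob_simplex :: "(real ^ 'q::finite) set" where
  "prob_simplex = {p. (\<forall>i. 0 \<le> p $ i) \<and> (\<Sum>i\<in>UNIV. p $ i) = 1}"

definition config_space :: "vertex set \<Rightarrow> (vertex \<Rightarrow> 'q::finite) measure" where
  "config_space T = (\<Pi>\<^sub>M v\<in>T. count_space UNIV)"

definition finite_law ::
  "vertex set \<Rightarrow> real ^ 'q \<Rightarrow> real ^ 'q ^ 'q \<Rightarrow> nat \<Rightarrow> (vertex \<Rightarrow> 'q::finite) measure" where
  "finite_law T \<alpha> M N = point_measure (trunc T N \<rightarrow>\<^sub>E UNIV)
     (\<lambda>\<sigma>. ennreal (\<alpha> $ \<sigma> [] *
        (\<Prod>(v, w) \<in> {(v, w). v \<in> trunc T N \<and> w \<in> trunc T N \<and> child v w}. M $ \<sigma> v $ \<sigma> w)))"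

definition is_tree_chain ::
  "vertex set \<Rightarrow> real ^ 'q \<Rightarrow> real ^ 'q ^ 'q \<Rightarrow> (vertex \<Rightarrow> 'q::finite) measure \<Rightarrow> bool" where
  "is_tree_chain T \<alpha> M P \<longleftrightarrow> prob_space P \<and> sets P = sets (config_space T) \<and>
     (\<forall>N. distr P (count_space (trunc T N \<rightarrow>\<^sub>E UNIV)) (\<lambda>\<sigma>. restrict \<sigma> (trunc T N)) = finite_law T \<alpha> M N)"

definition tree_chain ::
  "vertex set \<Rightarrow> real ^ 'q \<Rightarrow> real ^ 'q ^ 'q \<Rightarrow> (vertex \<Rightarrow> 'q::finite) measure" where
  "tree_chain T \<alpha> M = (THE P. is_tree_chain T \<alpha> M P)"

section \<open>Gibbs measures, extremality, reconstruction\<close>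

text \<open>The sub-\<open>\<sigma>\<close>-algebra of \<open>\<mu>\<close> generated by the spins at the vertices in \<open>W\<close>.\<close>

definition spin_algebra ::
  "vertex set \<Rightarrow> (vertex \<Rightarrow> 'q::finite) measure \<Rightarrow> (vertex \<Rightarrow> 'q) measure" where
  "spin_algebra W \<mu> = vimage_algebra (space \<mu>) (\<lambda>\<sigma>. restrict \<sigma> W) (config_space W)"

definition gibbs ::
  "vertex set \<Rightarrow> real ^ 'q \<Rightarrow> real ^ 'q ^ 'q \<Rightarrow> (vertex \<Rightarrow> 'q::finite) measure \<Rightarrow> bool" where
  "gibbs T \<alpha> M \<mu> \<longleftrightarrow> prob_space \<mu> \<and> sets \<mu> = sets (config_space T) \<and>
     (\<forall>V. finite V \<and> V \<subseteq> T \<longrightarrow> (\<forall>\<^sub>F N in sequentially. \<forall>\<eta>. AE \<xi> in \<mu>.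
        real_cond_exp \<mu> (spin_algebra (T - V) \<mu>) (indicator {\<sigma> \<in> space \<mu>. \<forall>v\<in>V. \<sigma> v = \<eta> v}) \<xi> =
        \<P>(\<sigma> in finite_law T \<alpha> M N. (\<forall>v\<in>V. \<sigma> v = \<eta> v) \<bar> (\<forall>w\<in>boundary T V. \<sigma> w = \<xi> w))))"

text \<open>Extreme points of the Gibbs measures. Measures do not form a vector space, so this spells out
  the definition of \<open>extreme_point_of\<close>: no representation as a proper convex combination of two
  different members.\<close>

definition extremal_gibbs ::
  "vertex set \<Rightarrow> real ^ 'q \<Rightarrow> real ^ 'q ^ 'q \<Rightarrow> (vertex \<Rightarrow> 'q::finite) measure \<Rightarrow> bool" where
  "extremal_gibbs T \<alpha> M \<mu> \<longleftrightarrow> gibbs T \<alpha> M \<mu> \<and>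
     (\<forall>\<mu>1 \<mu>2 t. gibbs T \<alpha> M \<mu>1 \<and> gibbs T \<alpha> M \<mu>2 \<and> 0 < t \<and> t < (1::real) \<and>
        (\<forall>A \<in> sets (config_space T). measure \<mu> A = (1 - t) * measure \<mu>1 A + t * measure \<mu>2 A)
        \<longrightarrow> \<mu>1 = \<mu>2)"

definition no_reconstruction ::
  "vertex set \<Rightarrow> real ^ 'q \<Rightarrow> (vertex \<Rightarrow> 'q::finite) measure \<Rightarrow> bool" where
  "no_reconstruction T \<alpha> P \<longleftrightarrow> (\<forall>s. \<forall>\<epsilon>>0.
     (\<lambda>N. \<P>(\<xi> in P. \<bar>\<P>(\<sigma> in P. \<sigma> [] = s \<bar> (\<forall>w\<in>T. length w = N \<longrightarrow> \<sigma> w = \<xi> w)) - \<alpha> $ s\<bar> \<ge> \<epsilon>))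
       \<longlonglongrightarrow> 0)"

section \<open>The constant \<open>c(M)\<close>\<close>

text \<open>Relative entropy with values in the extended reals; the convention \<open>0 log 0 = 0\<close> is
  automatic.\<close>

definition rel_entropy :: "real ^ 'q::finite \<Rightarrow> real ^ 'q \<Rightarrow> ereal" where
  "rel_entropy p a = (if \<exists>i. a $ i = 0 \<and> p $ i \<noteq> 0 then \<infinity>
     else ereal (\<Sum>i\<in>UNIV. p $ i * ln (p $ i / a $ i)))"

definition sym_entropy :: "real ^ 'q::finite \<Rightarrow> real ^ 'q \<Rightarrow> ereal" where
  "sym_entropy \<alpha> p = rel_entropy p \<alpha> + rel_entropy \<alpha> p"

definition reversed :: "real ^ 'q \<Rightarrow> real ^ 'q ^ 'q \<Rightarrow> real ^ 'q ^ ('q::finite)" where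
  "reversed \<alpha> M = (\<chi> i j. \<alpha> $ j * M $ j $ i / \<alpha> $ i)"

definition contraction :: "real ^ 'q \<Rightarrow> real ^ 'q ^ ('q::finite) \<Rightarrow> ereal" where
  "contraction \<alpha> M = (SUP p \<in> prob_simplex - {\<alpha>}.
     if sym_entropy \<alpha> p = \<infinity> then 0 else sym_entropy \<alpha> (p v* reversed \<alpha> M) / sym_entropy \<alpha> p)"

end

theory Submission
  imports Defs
begin

text \<open>
  Let \<open>\<pi>\<^sub>v\<close> be the law of the spin at \<open>v\<close> given the spins \<open>k\<close> generations below \<open>v\<close>. Its
  log-likelihood is, up to a constant, the sum of the log-likelihoods sent up by the children \<open>w\<close> of
  \<open>v\<close>, and since \<open>L\<close> pairs a log-likelihood ratio with a difference of laws, the expectation of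
  \<open>L(\<pi>\<^sub>v)\<close> under the chain is exactly the sum over \<open>w\<close> of the expectations of
  \<open>L(\<pi>\<^sub>w M\<^sup>r\<^sup>e\<^sup>v)\<close>. Hence it is at most of order \<open>c\<^sup>k\<close> times the number of descendants
  of \<open>v\<close> in generation \<open>k\<close>, for some \<open>c \<ge> c(M)\<close> with \<open>c Q(d) < 1\<close>. For almost every
  Galton-Watson tree these bounds are summable in \<open>k\<close> by first moments, so that \<open>\<pi>\<^sub>v\<close> tends to
  \<open>\<alpha>\<close> almost surely for every \<open>v\<close>. The conditional probability of a local event given generation
  \<open>N\<close> then converges almost surely to its probability under the chain; integrating this against any
  Gibbs measure that is absolutely continuous with respect to the chain identifies the two, which
  is extremality.
\<close>

section \<open>Local functions of a configuration\<close>

text \<open>The reversed chain enters through Bayes' rule: a summand of the entropy recursion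
  involves the spin of one parent together with one subtree, and the law of the parent's spin given
  an observation in the subtree of \<open>w\<close> is one reversed step applied to the law at
  \<open>w\<close>. The recursion is an equality on every tree, so the tree enters only through its
  generation sizes.

  The obstacle is generation zero. A spin given itself has a point mass as its law, where
  \<open>L\<close> is infinite and contraction says nothing. One multiplication by \<open>M\<close>
  makes all likelihoods positive, so the recursion starts one generation higher, from a constant
  made of the numbers \<bar>ln M(i,j)\<bar>; this is the reason for \<open>Suc k\<close> in the
  entropy estimates.

  Given one generation, every pattern has positive probability, so conditional probabilities are
  finite quotients defined at every configuration. They are not merely versions up to null sets of
  the chain, and can be integrated against other Gibbs measures.

  The two conclusions are derived separately: non-reconstruction from decay of the mean at the root,
  extremality from almost sure decay at all vertices.\<close>

definition depends_on :: "'a set \<Rightarrow> (('a \<Rightarrow> 'b) \<Rightarrow> 'c) \<Rightarrow> bool" where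
  "depends_on W f \<longleftrightarrow> (\<forall>\<sigma> \<sigma>'. (\<forall>v\<in>W. \<sigma> v = \<sigma>' v) \<longrightarrow> f \<sigma> = f \<sigma>')"

lemma depends_onI: "(\<And>\<sigma> \<sigma>'. (\<And>v. v \<in> W \<Longrightarrow> \<sigma> v = \<sigma>' v) \<Longrightarrow> f \<sigma> = f \<sigma>') \<Longrightarrow> depends_on W f"
  unfolding depends_on_def by blast

lemma depends_onD: "depends_on W f \<Longrightarrow> (\<And>v. v \<in> W \<Longrightarrow> \<sigma> v = \<sigma>' v) \<Longrightarrow> f \<sigma> = f \<sigma>'"
  unfolding depends_on_def by blast

lemma depends_on_mono: "depends_on W f \<Longrightarrow> W \<subseteq> W' \<Longrightarrow> depends_on W' f"
  unfolding depends_on_def by blast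

lemma depends_on_restrict: "depends_on W f \<Longrightarrow> f (restrict \<sigma> W) = f \<sigma>"
  using depends_onD[of W f "restrict \<sigma> W" \<sigma>] by simp

lemma depends_on_compose: "depends_on W f \<Longrightarrow> depends_on W (\<lambda>\<sigma>. h (f \<sigma>))"
  unfolding depends_on_def by metis

lemma depends_on_compose2:
  "depends_on W f \<Longrightarrow> depends_on W g \<Longrightarrow> depends_on W (\<lambda>\<sigma>. h (f \<sigma>) (g \<sigma>))"
  unfolding depends_on_def by metis

lemma depends_on_const: "depends_on W (\<lambda>_. c)"
  by (simp add: depends_on_def)

lemma depends_on_coord: "v \<in> W \<Longrightarrow> depends_on W (\<lambda>\<sigma>. h (\<sigma> v))"
  unfolding depends_on_def by simp

lemma depends_on_prod:
  fixes f :: "'a \<Rightarrow> ('b \<Rightarrow> 'd) \<Rightarrow> 'c::comm_monoid_mult"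
  shows "(\<And>i. i \<in> I \<Longrightarrow> depends_on W (f i)) \<Longrightarrow> depends_on W (\<lambda>\<sigma>. \<Prod>i\<in>I. f i \<sigma>)"
  by (rule depends_onI, rule prod.cong) (auto simp: depends_on_def)

lemma depends_on_sum:
  fixes f :: "'a \<Rightarrow> ('b \<Rightarrow> 'd) \<Rightarrow> 'c::comm_monoid_add"
  shows "(\<And>i. i \<in> I \<Longrightarrow> depends_on W (f i)) \<Longrightarrow> depends_on W (\<lambda>\<sigma>. \<Sum>i\<in>I. f i \<sigma>)"
  by (rule depends_onI, rule sum.cong) (auto simp: depends_on_def)

lemma depends_on_Ball: "J \<subseteq> W \<Longrightarrow> depends_on W (\<lambda>\<sigma>. \<forall>v\<in>J. \<sigma> v = \<eta> v)"
  unfolding depends_on_def by (auto 4 3)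

lemma finite_range_depends_on:
  fixes f :: "('a \<Rightarrow> 'q::finite) \<Rightarrow> 'c"
  assumes "finite W" "depends_on W f"
  shows "finite (range f)"
proof (rule finite_subset)
  show "range f \<subseteq> f ` (W \<rightarrow>\<^sub>E UNIV)"
  proof
    fix x assume "x \<in> range f"
    then obtain \<sigma> where "x = f \<sigma>" by blast
    then have "x = f (restrict \<sigma> W)" by (simp add: depends_on_restrict[OF assms(2)])
    then show "x \<in> f ` (W \<rightarrow>\<^sub>E UNIV)" by (rule image_eqI[where x = "restrict \<sigma> W"]) simp
  qed
  show "finite (f ` (W \<rightarrow>\<^sub>E UNIV))"
    using assms(1) by (intro finite_imageI finite_PiE) auto
qed

text \<open>Fubini for patterns. It peels the last generation off a ball in
  \<open>integral_level_Suc\<close> and separates a volume from its exterior in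
  \<open>integral_gibbs_kernel\<close>.\<close>

lemma sum_PiE_Un:
  assumes "A \<inter> B = {}"
  shows "(\<Sum>h\<in>PiE (A \<union> B) F. f h) = (\<Sum>g\<in>PiE A F. \<Sum>h\<in>PiE B F. f (merge A B (g, h)))"
proof -
  have "(\<Sum>p\<in>PiE A F \<times> PiE B F. f (merge A B p)) = (\<Sum>h\<in>PiE (A \<union> B) F. f h)"
  proof (rule sum.reindex_bij_witness[where i = "\<lambda>h. (restrict h A, restrict h B)" and j = "merge A B"])
    fix p assume "p \<in> PiE A F \<times> PiE B F"
    then show "(restrict (merge A B p) A, restrict (merge A B p) B) = p" "merge A B p \<in> PiE (A \<union> B) F"
      using assms by (auto simp: merge_def PiE_iff extensional_def fun_eq_iff restrict_def split: prod.splits)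
  next
    fix h assume h: "h \<in> PiE (A \<union> B) F"
    show "merge A B (restrict h A, restrict h B) = h"
      using h by (auto simp: merge_def PiE_iff extensional_def fun_eq_iff)
    show "(restrict h A, restrict h B) \<in> PiE A F \<times> PiE B F"
      using h by auto
  qed auto
  then show ?thesis by (simp add: sum.cartesian_product split_beta')
qed

lemma space_config_space: "space (config_space T) = (T \<rightarrow>\<^sub>E UNIV)"
  by (simp add: config_space_def space_PiM)

lemma config_space_finite:
  "finite W \<Longrightarrow> config_space W = (count_space (W \<rightarrow>\<^sub>E UNIV) :: (vertex \<Rightarrow> 'q::finite) measure)"
  unfolding config_space_def by (rule count_space_PiM_finite) (auto simp: countable_finite)

lemma measurable_restrict_config:
  "W \<subseteq> T \<Longrightarrow> (\<lambda>\<sigma>. restrict \<sigma> W) \<in> measurable (config_space T) (config_space W)"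
  unfolding config_space_def by (rule measurable_restrict_subset)

lemma measurable_local:
  fixes f :: "(vertex \<Rightarrow> 'q::finite) \<Rightarrow> 'c"
  assumes "finite W" "W \<subseteq> T" "depends_on W f" "range f \<subseteq> space N"
    and P: "sets P = sets (config_space T)"
  shows "f \<in> measurable P N"
proof -
  have "(\<lambda>\<sigma>. f (restrict \<sigma> W)) \<in> measurable (config_space T) N"
    using assms
    by (intro measurable_compose[OF measurable_restrict_config[of W]])
       (auto simp: config_space_finite)
  then show ?thesis
    by (simp add: depends_on_restrict[OF assms(3)] measurable_cong_sets[OF P refl])
qed

lemma sets_local:
  fixes Q :: "(vertex \<Rightarrow> 'q::finite) \<Rightarrow> bool"
  assumes "finite W" "W \<subseteq> T" "depends_on W Q" and P: "sets P = sets (config_space T)"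
  shows "{\<sigma> \<in> space P. Q \<sigma>} \<in> sets P"
proof -
  have [measurable]: "Q \<in> measurable P (count_space UNIV)"
    by (rule measurable_local[OF assms(1-3) _ P]) simp
  show ?thesis by measurable
qed

lemma measure_eq_integral_local:
  fixes Q :: "(vertex \<Rightarrow> 'q::finite) \<Rightarrow> bool"
  assumes "finite W" "W \<subseteq> T" "depends_on W Q" and P: "sets P = sets (config_space T)"
  shows "\<P>(\<sigma> in P. Q \<sigma>) = (\<integral>\<sigma>. of_bool (Q \<sigma>) \<partial>P)"
proof -
  have "(\<integral>\<sigma>. of_bool (Q \<sigma>) \<partial>P) = (\<integral>\<sigma>. indicat_real {\<sigma> \<in> space P. Q \<sigma>} \<sigma> \<partial>P)"
    by (intro Bochner_Integration.integral_cong) (auto simp: indicator_def)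
  also have "\<dots> = \<P>(\<sigma> in P. Q \<sigma>)"
    using sets_local[OF assms] by simp
  finally show ?thesis by simp
qed

lemma integrable_local:
  fixes f :: "(vertex \<Rightarrow> 'q::finite) \<Rightarrow> real"
  assumes "finite W" "W \<subseteq> T" "depends_on W f"
    and P: "sets P = sets (config_space T)" and fin: "finite_measure P"
  shows "integrable P f"
proof -
  interpret finite_measure P by fact
  have "finite ((\<lambda>\<sigma>. norm (f \<sigma>)) ` UNIV)"
    by (rule finite_range_depends_on[OF assms(1) depends_on_compose[OF assms(3)]])
  then have "\<And>\<sigma>. norm (f \<sigma>) \<le> Max (range (\<lambda>\<sigma>. norm (f \<sigma>)))"
    by (intro Max_ge) auto
  moreover have "f \<in> borel_measurable P"
    by (rule measurable_local[OF assms(1-3) _ P]) simp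
  ultimately show ?thesis
    by (intro integrable_const_bound) auto
qed

text \<open>The spin set is finite, so every box over a finite \<open>J\<close> is a finite disjoint
  union of exact patterns, and boxes determine the measure. Total masses other than 1 are allowed
  because \<open>set_integral_gibbs_kernel\<close> applies this to weighted images of the
  chain.\<close>

lemma config_measure_eqI:
  fixes \<mu> \<nu> :: "(vertex \<Rightarrow> 'q::finite) measure"
  assumes fin: "finite_measure \<mu>"
    and \<mu>: "sets \<mu> = sets (config_space W)" and \<nu>: "sets \<nu> = sets (config_space W)"
    and eq: "\<And>J \<eta>. finite J \<Longrightarrow> J \<subseteq> W \<Longrightarrow>
      emeasure \<mu> {\<sigma> \<in> space \<mu>. \<forall>v\<in>J. \<sigma> v = \<eta> v} = emeasure \<nu> {\<sigma> \<in> space \<nu>. \<forall>v\<in>J. \<sigma> v = \<eta> v}"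
  shows "\<mu> = \<nu>"
proof (rule measure_eqI_PiM_infinite[OF \<mu>[unfolded config_space_def] \<nu>[unfolded config_space_def]])
  fix A :: "vertex \<Rightarrow> 'q set" and J assume J: "finite J" "J \<subseteq> W"
  have sp: "space \<mu> = (W \<rightarrow>\<^sub>E UNIV)" "space \<nu> = (W \<rightarrow>\<^sub>E UNIV)"
    using sets_eq_imp_space_eq[OF \<mu>] sets_eq_imp_space_eq[OF \<nu>] by (simp_all add: space_config_space)
  have split: "emeasure \<kappa> (prod_emb W (\<lambda>_. count_space UNIV) J (Pi\<^sub>E J A)) =
      (\<Sum>\<eta>\<in>Pi\<^sub>E J A. emeasure \<kappa> {\<sigma> \<in> space \<kappa>. \<forall>v\<in>J. \<sigma> v = \<eta> v})"
    if \<kappa>: "sets \<kappa> = sets (config_space W)" "space \<kappa> = (W \<rightarrow>\<^sub>E UNIV)" for \<kappa>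
  proof -
    have "prod_emb W (\<lambda>_. count_space UNIV) J (Pi\<^sub>E J A) =
        (\<Union>\<eta>\<in>Pi\<^sub>E J A. {\<sigma> \<in> space \<kappa>. \<forall>v\<in>J. \<sigma> v = \<eta> v})"
    proof (intro equalityI subsetI)
      fix \<sigma> assume "\<sigma> \<in> prod_emb W (\<lambda>_. count_space UNIV) J (Pi\<^sub>E J A)"
      then show "\<sigma> \<in> (\<Union>\<eta>\<in>Pi\<^sub>E J A. {\<sigma> \<in> space \<kappa>. \<forall>v\<in>J. \<sigma> v = \<eta> v})"
        by (intro UN_I[of "restrict \<sigma> J"]) (auto simp: prod_emb_def \<kappa>(2))
    next
      fix \<sigma> assume "\<sigma> \<in> (\<Union>\<eta>\<in>Pi\<^sub>E J A. {\<sigma> \<in> space \<kappa>. \<forall>v\<in>J. \<sigma> v = \<eta> v})"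
      then obtain \<eta> where "\<eta> \<in> Pi\<^sub>E J A" "\<sigma> \<in> (W \<rightarrow>\<^sub>E UNIV)" "\<forall>v\<in>J. \<sigma> v = \<eta> v"
        by (auto simp: \<kappa>(2))
      moreover from this have "restrict \<sigma> J = \<eta>"
        by (auto simp: fun_eq_iff PiE_iff extensional_def)
      ultimately show "\<sigma> \<in> prod_emb W (\<lambda>_. count_space UNIV) J (Pi\<^sub>E J A)"
        by (auto simp: prod_emb_def)
    qed
    moreover have "(\<Sum>\<eta>\<in>Pi\<^sub>E J A. emeasure \<kappa> {\<sigma> \<in> space \<kappa>. \<forall>v\<in>J. \<sigma> v = \<eta> v}) =
        emeasure \<kappa> (\<Union>\<eta>\<in>Pi\<^sub>E J A. {\<sigma> \<in> space \<kappa>. \<forall>v\<in>J. \<sigma> v = \<eta> v})"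
    proof (rule sum_emeasure)
      show "(\<lambda>\<eta>. {\<sigma> \<in> space \<kappa>. \<forall>v\<in>J. \<sigma> v = \<eta> v}) ` Pi\<^sub>E J A \<subseteq> sets \<kappa>"
        using sets_local[OF J depends_on_Ball \<kappa>(1)] by auto
      show "disjoint_family_on (\<lambda>\<eta>. {\<sigma> \<in> space \<kappa>. \<forall>v\<in>J. \<sigma> v = \<eta> v}) (Pi\<^sub>E J A)"
        by (auto simp: disjoint_family_on_def) (metis PiE_ext)
      show "finite (Pi\<^sub>E J A)"
        using J by (intro finite_PiE) auto
    qed
    ultimately show ?thesis by simp
  qed
  show "\<mu> (prod_emb W (\<lambda>_. count_space UNIV) J (Pi\<^sub>E J A)) =
      \<nu> (prod_emb W (\<lambda>_. count_space UNIV) J (Pi\<^sub>E J A))"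
    unfolding split[OF \<mu> sp(1)] split[OF \<nu> sp(2)] using eq[OF J] by simp
qed (rule fin)

section \<open>Rooted trees and the Markov chain\<close>

locale rooted_tree =
  fixes T :: "vertex set"
  assumes root_in: "[] \<in> T"
    and parent_in: "v @ [i] \<in> T \<Longrightarrow> v \<in> T"
    and finite_branching: "finite {i. v @ [i] \<in> T}"
begin

definition level :: "nat \<Rightarrow> vertex set" where
  "level n = {v \<in> T. length v = n}"

definition children :: "vertex \<Rightarrow> vertex set" where
  "children v = {w \<in> T. child v w}"

definition desc :: "vertex \<Rightarrow> nat \<Rightarrow> vertex set" where
  "desc v k = {w \<in> T. length w = length v + k \<and> take (length v) w = v}"

lemma butlast_in: "w \<in> T \<Longrightarrow> butlast w \<in> T"
  by (cases w rule: rev_cases) (auto intro: parent_in)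

lemma children_eq: "children v = {w \<in> T. w \<noteq> [] \<and> butlast w = v}"
  by (auto simp: children_def child_def) (metis append_butlast_last_id)

lemma finite_children: "finite (children v)"
proof -
  have "children v = (\<lambda>i. v @ [i]) ` {i. v @ [i] \<in> T}"
    by (auto simp: children_def child_def)
  then show ?thesis using finite_branching by simp
qed

lemma trunc_0: "trunc T 0 = {[]}"
  using root_in by (auto simp: trunc_def)

lemma trunc_Suc: "trunc T (Suc n) = trunc T n \<union> level (Suc n)"
  by (auto simp: trunc_def level_def)

lemma trunc_level_disjoint: "trunc T n \<inter> level (Suc n) = {}"
  by (auto simp: trunc_def level_def)

lemma trunc_subset: "trunc T n \<subseteq> T"
  by (auto simp: trunc_def)

lemma trunc_mono: "m \<le> n \<Longrightarrow> trunc T m \<subseteq> trunc T n"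
  by (auto simp: trunc_def)

lemma level_subset: "level n \<subseteq> T" "n \<le> N \<Longrightarrow> level n \<subseteq> trunc T N"
  by (auto simp: level_def trunc_def)

lemma level_Suc: "level (Suc n) = (\<Union>v\<in>level n. children v)"
  by (auto simp: level_def children_eq butlast_in)

lemma finite_level: "finite (level n)"
proof (induction n)
  case 0
  have "level 0 = {[]}" using root_in by (auto simp: level_def)
  then show ?case by simp
next
  case (Suc n)
  then show ?case by (simp add: level_Suc finite_children)
qed

lemma finite_trunc: "finite (trunc T N)"
  by (induction N) (auto simp: trunc_0 trunc_Suc finite_level)

lemma desc_subset: "desc v k \<subseteq> level (length v + k)" "desc v k \<subseteq> T"
  by (auto simp: desc_def level_def)

lemma finite_desc: "finite (desc v k)"
  using desc_subset(1) finite_level by (rule finite_subset)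

lemma desc_0: "v \<in> T \<Longrightarrow> desc v 0 = {v}"
  by (auto simp: desc_def)

lemma desc_disjoint: "length v = length w \<Longrightarrow> v \<noteq> w \<Longrightarrow> desc v k \<inter> desc w k = {}"
  by (auto simp: desc_def)

lemma length_children: "w \<in> children v \<Longrightarrow> length w = Suc (length v)"
  by (auto simp: children_def child_def)

lemma prefix_in: "v @ u \<in> T \<Longrightarrow> v \<in> T"
proof (induction u rule: rev_induct)
  case (snoc i u)
  then show ?case using parent_in[of "v @ u" i] by simp
qed simp

text \<open>The path is split at its first step below \<open>v\<close>, not at its last, since both
  \<open>up\<close> and the entropy recursion branch over the children of \<open>v\<close>.\<close>

lemma desc_Suc: "desc v (Suc k) = (\<Union>w\<in>children v. desc w k)"
proof (intro equalityI subsetI)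
  fix u assume "u \<in> desc v (Suc k)"
  then have u: "u \<in> T" "length u = Suc (length v + k)" "take (length v) u = v"
    by (auto simp: desc_def)
  let ?w = "take (Suc (length v)) u"
  have "?w \<in> T"
    using prefix_in[of ?w "drop (Suc (length v)) u"] u(1) by simp
  moreover have "?w = v @ [u ! length v]"
    using u(2,3) by (simp add: take_Suc_conv_app_nth)
  ultimately have "?w \<in> children v"
    by (auto simp: children_def child_def)
  moreover have "u \<in> desc ?w k"
    using u by (auto simp: desc_def)
  ultimately show "u \<in> (\<Union>w\<in>children v. desc w k)" by blast
next
  fix u assume "u \<in> (\<Union>w\<in>children v. desc w k)"
  then obtain i where i: "v @ [i] \<in> T" "u \<in> desc (v @ [i]) k"
    by (auto simp: children_def child_def)
  then have "take (Suc (length v)) u = v @ [i]" by (simp add: desc_def)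
  then have "take (length v) (take (Suc (length v)) u) = take (length v) (v @ [i])" by simp
  then have "take (length v) u = v" by simp
  with i show "u \<in> desc v (Suc k)" by (auto simp: desc_def)
qed

lemma children_disjoint: "v \<noteq> v' \<Longrightarrow> children v \<inter> children v' = {}"
  by (auto simp: children_eq)

text \<open>Balls are the convenient volumes: the conditional probability prescribed for
  \<open>trunc T n\<close> sees only the spins of the single generation
  \<open>level (Suc n)\<close>.\<close>

lemma boundary_trunc: "boundary T (trunc T n) = level (Suc n)"
proof (intro equalityI subsetI)
  fix w assume "w \<in> level (Suc n)"
  then have w: "w \<in> T" "length w = Suc n" by (auto simp: level_def)
  then have "child (butlast w) w" "butlast w \<in> trunc T n"
    by (auto simp: child_def trunc_def butlast_in intro!: exI[of _ "last w"])
       (metis append_butlast_last_id length_greater_0_conv zero_less_Suc)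
  with w show "w \<in> boundary T (trunc T n)"
    by (auto simp: boundary_def trunc_def)
qed (auto simp: boundary_def trunc_def level_def child_def)

end

locale markov_tree = rooted_tree T for T +
  fixes M :: "real ^ 'q ^ 'q::finite" and \<alpha> :: "real ^ 'q"
  assumes M_pos: "M $ i $ j > 0"
    and M_stoch: "(\<Sum>j\<in>UNIV. M $ i $ j) = 1"
    and alpha_simplex: "\<alpha> \<in> prob_simplex"
    and alpha_inv: "\<alpha> v* M = \<alpha>"
begin

lemma alpha_sum: "(\<Sum>i\<in>UNIV. \<alpha> $ i) = 1"
  using alpha_simplex by (simp add: prob_simplex_def)

lemma alpha_stationary: "(\<Sum>i\<in>UNIV. \<alpha> $ i * M $ i $ j) = \<alpha> $ j"
  using arg_cong[OF alpha_inv, of "\<lambda>x. x $ j"] by (simp add: vector_matrix_mult_def)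

lemma alpha_pos: "\<alpha> $ j > 0"
proof -
  have nonneg: "\<alpha> $ i \<ge> 0" for i using alpha_simplex by (simp add: prob_simplex_def)
  obtain i where "\<alpha> $ i \<noteq> 0"
    using alpha_sum by (metis sum.neutral zero_neq_one)
  then have "0 < (\<Sum>i\<in>UNIV. \<alpha> $ i * M $ i $ j)"
    using nonneg M_pos by (intro sum_pos2[of _ i]) (auto simp: less_le)
  then show ?thesis by (simp add: alpha_stationary)
qed

lemma alpha_le_1: "\<alpha> $ j \<le> 1"
  using alpha_sum member_le_sum[of j UNIV "\<lambda>i. \<alpha> $ i"] alpha_pos by (auto simp: less_imp_le)

text \<open>An edge is named by its lower end \<open>w\<close>, with \<open>butlast w\<close> as the
  parent. A product over vertices splits more easily by generation than the product over pairs in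
  \<open>finite_law\<close>.\<close>

definition weight :: "nat \<Rightarrow> (vertex \<Rightarrow> 'q) \<Rightarrow> real" where
  "weight N \<sigma> = \<alpha> $ \<sigma> [] * (\<Prod>w\<in>trunc T N - {[]}. M $ \<sigma> (butlast w) $ \<sigma> w)"

lemma weight_pos: "weight N \<sigma> > 0"
  unfolding weight_def by (intro mult_pos_pos alpha_pos prod_pos M_pos)

lemma butlast_trunc: "w \<in> trunc T N \<Longrightarrow> butlast w \<in> trunc T N"
  by (auto simp: trunc_def butlast_in)

lemma depends_on_weight: "depends_on (trunc T N) (weight N)"
  unfolding weight_def using root_in
  by (intro depends_onI arg_cong2[where f = "(*)"] prod.cong refl)
     (auto simp: trunc_def butlast_in)

lemma finite_law_eq:
  "finite_law T \<alpha> M N = point_measure (trunc T N \<rightarrow>\<^sub>E UNIV) (\<lambda>\<sigma>. ennreal (weight N \<sigma>))"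
proof -
  have "(\<Prod>(v, w) \<in> {(v, w). v \<in> trunc T N \<and> w \<in> trunc T N \<and> child v w}. M $ \<sigma> v $ \<sigma> w) =
      (\<Prod>w\<in>trunc T N - {[]}. M $ \<sigma> (butlast w) $ \<sigma> w)" for \<sigma> :: "vertex \<Rightarrow> 'q"
  proof (rule prod.reindex_bij_witness[where i = "\<lambda>w. (butlast w, w)" and j = snd])
    fix w assume w: "w \<in> trunc T N - {[]}"
    then have "child (butlast w) w"
      by (auto simp: child_def intro!: exI[of _ "last w"])
    with w show "(butlast w, w) \<in> {(v, w). v \<in> trunc T N \<and> w \<in> trunc T N \<and> child v w}"
      using butlast_trunc by auto
  qed (auto simp: child_def)
  then show ?thesis by (simp add: finite_law_def weight_def)
qed

text \<open>A sum-product step: if \<open>\<phi> w j\<close> is a weight for spin \<open>j\<close>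
  at \<open>w\<close>, this is the conditional expectation, given spin \<open>i\<close> at
  \<open>v\<close>, of the product of the weights of the children of \<open>v\<close>.\<close>

definition up :: "(vertex \<Rightarrow> 'q \<Rightarrow> real) \<Rightarrow> vertex \<Rightarrow> 'q \<Rightarrow> real" where
  "up \<phi> v i = (\<Prod>w\<in>children v. \<Sum>j\<in>UNIV. M $ i $ j * \<phi> w j)"

lemma up_cong: "(\<And>w. w \<in> children v \<Longrightarrow> \<phi> w = \<phi>' w) \<Longrightarrow> up \<phi> v = up \<phi>' v"
  by (simp add: up_def fun_eq_iff)

text \<open>The rows of \<open>M\<close> sum to 1. This lets subtrees without an observation drop
  out of later products.\<close>

lemma funpow_up_one: "(up ^^ k) (\<lambda>_ _. 1) = (\<lambda>_ _. 1)"
  by (induction k) (auto simp: up_def M_stoch fun_eq_iff)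

lemma funpow_up_cong:
  "v \<in> T \<Longrightarrow> (\<And>w. w \<in> desc v k \<Longrightarrow> \<phi> w = \<phi>' w) \<Longrightarrow> (up ^^ k) \<phi> v = (up ^^ k) \<phi>' v"
proof (induction k arbitrary: v)
  case 0
  then show ?case by (simp add: desc_0)
next
  case (Suc k)
  have "(up ^^ k) \<phi> w = (up ^^ k) \<phi>' w" if w: "w \<in> children v" for w
    using w by (intro Suc) (auto simp: children_def desc_Suc)
  then have "up ((up ^^ k) \<phi>) v = up ((up ^^ k) \<phi>') v" by (rule up_cong)
  then show ?case by simp
qed

end

section \<open>Expectations under the chain, generation by generation\<close>

locale tree_chain_law = markov_tree T M \<alpha>
  for T and M :: "real ^ 'q ^ 'q::finite" and \<alpha> +
  fixes P :: "(vertex \<Rightarrow> 'q) measure"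
  assumes chain: "is_tree_chain T \<alpha> M P"
begin

lemma prob_P: "prob_space P" and sets_P: "sets P = sets (config_space T)"
  using chain by (auto simp: is_tree_chain_def)

sublocale P: prob_space P by (rule prob_P)

lemma integrable_trunc:
  fixes f :: "(vertex \<Rightarrow> 'q) \<Rightarrow> real"
  shows "depends_on (trunc T N) f \<Longrightarrow> integrable P f"
  using integrable_local[OF finite_trunc trunc_subset _ sets_P P.finite_measure_axioms] .

text \<open>The defining marginals of the chain enter here; expectations of local functions become
  finite weighted sums.\<close>

lemma integral_trunc:
  fixes f :: "(vertex \<Rightarrow> 'q) \<Rightarrow> real"
  assumes f: "depends_on (trunc T N) f"
  shows "(\<integral>\<sigma>. f \<sigma> \<partial>P) = (\<Sum>\<eta>\<in>trunc T N \<rightarrow>\<^sub>E UNIV. weight N \<eta> * f \<eta>)"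
proof -
  have "(\<lambda>\<sigma>. restrict \<sigma> (trunc T N)) \<in> measurable (config_space T) (config_space (trunc T N))"
    by (rule measurable_restrict_config[OF trunc_subset])
  then have meas: "(\<lambda>\<sigma>. restrict \<sigma> (trunc T N)) \<in> measurable P (count_space (trunc T N \<rightarrow>\<^sub>E UNIV))"
    by (simp add: config_space_finite[OF finite_trunc] measurable_cong_sets[OF sets_P refl])
  have "(\<integral>\<sigma>. f \<sigma> \<partial>P) = (\<integral>\<sigma>. f (restrict \<sigma> (trunc T N)) \<partial>P)"
    by (simp add: depends_on_restrict[OF f])
  also have "\<dots> = (\<integral>\<sigma>. f \<sigma> \<partial>distr P (count_space (trunc T N \<rightarrow>\<^sub>E UNIV)) (\<lambda>\<sigma>. restrict \<sigma> (trunc T N)))"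
    by (rule integral_distr[OF meas, symmetric]) simp
  also have "\<dots> = (\<integral>\<sigma>. f \<sigma> \<partial>finite_law T \<alpha> M N)"
    using chain by (simp add: is_tree_chain_def)
  also have "\<dots> = (\<Sum>\<eta>\<in>trunc T N \<rightarrow>\<^sub>E UNIV. weight N \<eta> *\<^sub>R f \<eta>)"
    unfolding finite_law_eq using weight_pos
    by (intro lebesgue_integral_point_measure_finite finite_PiE finite_trunc) (auto simp: less_imp_le)
  finally show ?thesis by simp
qed

lemma prob_finite_law:
  assumes Q: "depends_on (trunc T N) Q"
  shows "\<P>(\<sigma> in finite_law T \<alpha> M N. Q \<sigma>) = (\<integral>\<sigma>. of_bool (Q \<sigma>) \<partial>P)"
proof -
  let ?A = "trunc T N \<rightarrow>\<^sub>E (UNIV :: 'q set)"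
  have fin: "finite ?A" by (intro finite_PiE finite_trunc) auto
  have "emeasure (finite_law T \<alpha> M N) {\<sigma> \<in> ?A. Q \<sigma>} = (\<Sum>\<eta>\<in>{\<sigma> \<in> ?A. Q \<sigma>}. ennreal (weight N \<eta>))"
    unfolding finite_law_eq by (intro emeasure_point_measure_finite fin) auto
  also have "\<dots> = ennreal (\<Sum>\<eta>\<in>{\<sigma> \<in> ?A. Q \<sigma>}. weight N \<eta>)"
    using weight_pos by (intro sum_ennreal) (simp add: less_imp_le)
  finally have "\<P>(\<sigma> in finite_law T \<alpha> M N. Q \<sigma>) = (\<Sum>\<eta>\<in>{\<sigma> \<in> ?A. Q \<sigma>}. weight N \<eta>)"
    using weight_pos
    by (simp add: measure_def finite_law_eq space_point_measure sum_nonneg less_imp_le)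
  also have "\<dots> = (\<Sum>\<eta>\<in>?A. weight N \<eta> * of_bool (Q \<eta>))"
    using fin by (intro sum.mono_neutral_cong_left) auto
  also have "\<dots> = (\<integral>\<sigma>. of_bool (Q \<sigma>) \<partial>P)"
    by (rule integral_trunc[symmetric]) (rule depends_on_compose[OF Q])
  finally show ?thesis .
qed

lemma prob_eq_integral:
  "depends_on (trunc T N) Q \<Longrightarrow> \<P>(\<sigma> in P. Q \<sigma>) = (\<integral>\<sigma>. of_bool (Q \<sigma>) \<partial>P)"
  using measure_eq_integral_local[OF finite_trunc trunc_subset _ sets_P] .

text \<open>Given the spins up to level \<open>n\<close>, those of the next level are independent,
  with the rows of \<open>M\<close> as laws. The inner sum therefore factorises over the vertices,
  and grouping the factors by parent gives \<open>up\<close>.\<close>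

lemma integral_level_Suc:
  fixes G :: "(vertex \<Rightarrow> 'q) \<Rightarrow> real"
  assumes G: "depends_on (trunc T n) G"
  shows "(\<integral>\<sigma>. G \<sigma> * (\<Prod>w\<in>level (Suc n). \<phi> w (\<sigma> w)) \<partial>P) =
    (\<integral>\<sigma>. G \<sigma> * (\<Prod>v\<in>level n. up \<phi> v (\<sigma> v)) \<partial>P)"
proof -
  let ?A = "trunc T n" and ?B = "level (Suc n)"
  have level_prod: "(\<Prod>w\<in>?B. f w) = (\<Prod>v\<in>level n. \<Prod>w\<in>children v. f w)" for f :: "vertex \<Rightarrow> real"
    unfolding level_Suc using children_disjoint
    by (intro prod.UNION_disjoint) (auto simp: finite_level finite_children)
  have split: "(\<Sum>h\<in>?B \<rightarrow>\<^sub>E UNIV. weight (Suc n) (merge ?A ?B (g, h)) *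
        (G (merge ?A ?B (g, h)) * (\<Prod>w\<in>?B. \<phi> w (merge ?A ?B (g, h) w)))) =
      weight n g * (G g * (\<Prod>v\<in>level n. up \<phi> v (g v)))" for g :: "vertex \<Rightarrow> 'q"
  proof -
    have merge_A: "merge ?A ?B (g, h) v = g v" if "v \<in> ?A" for h :: "vertex \<Rightarrow> 'q" and v
      using that by (simp add: merge_def)
    have merge_B: "merge ?A ?B (g, h) v = h v" if "v \<in> ?B" for h v
      using that trunc_level_disjoint[of n] by (auto simp: merge_def)
    have "weight (Suc n) (merge ?A ?B (g, h)) *
        (G (merge ?A ?B (g, h)) * (\<Prod>w\<in>?B. \<phi> w (merge ?A ?B (g, h) w))) =
        weight n g * G g * (\<Prod>w\<in>?B. M $ g (butlast w) $ h w * \<phi> w (h w))" for h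
    proof -
      let ?m = "merge ?A ?B (g, h)"
      have "trunc T (Suc n) - {[]} = (?A - {[]}) \<union> ?B"
        by (auto simp: trunc_def level_def)
      then have "weight (Suc n) ?m = weight n ?m * (\<Prod>w\<in>?B. M $ ?m (butlast w) $ ?m w)"
        unfolding weight_def using trunc_level_disjoint
        by (subst \<open>trunc T (Suc n) - {[]} = _\<close>, subst prod.union_disjoint)
           (auto simp: finite_trunc finite_level)
      moreover have "weight n ?m = weight n g"
        by (rule depends_onD[OF depends_on_weight]) (rule merge_A)
      moreover have "G ?m = G g"
        by (rule depends_onD[OF G]) (rule merge_A)
      moreover have "(\<Prod>w\<in>?B. M $ ?m (butlast w) $ ?m w) = (\<Prod>w\<in>?B. M $ g (butlast w) $ h w)"
      proof (rule prod.cong[OF refl])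
        fix w assume w: "w \<in> ?B"
        then have "butlast w \<in> ?A" by (auto simp: level_def trunc_def butlast_in)
        with w show "M $ ?m (butlast w) $ ?m w = M $ g (butlast w) $ h w"
          by (simp only: merge_A merge_B)
      qed
      moreover have "(\<Prod>w\<in>?B. \<phi> w (?m w)) = (\<Prod>w\<in>?B. \<phi> w (h w))"
        by (intro prod.cong refl) (simp add: merge_B)
      ultimately show ?thesis by (simp add: prod.distrib mult_ac)
    qed
    then have "(\<Sum>h\<in>?B \<rightarrow>\<^sub>E UNIV. weight (Suc n) (merge ?A ?B (g, h)) *
        (G (merge ?A ?B (g, h)) * (\<Prod>w\<in>?B. \<phi> w (merge ?A ?B (g, h) w)))) =
        weight n g * G g * (\<Sum>h\<in>?B \<rightarrow>\<^sub>E UNIV. \<Prod>w\<in>?B. M $ g (butlast w) $ h w * \<phi> w (h w))"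
      by (simp add: sum_distrib_left)
    also have "(\<Sum>h\<in>?B \<rightarrow>\<^sub>E UNIV. \<Prod>w\<in>?B. M $ g (butlast w) $ h w * \<phi> w (h w)) =
        (\<Prod>w\<in>?B. \<Sum>j\<in>UNIV. M $ g (butlast w) $ j * \<phi> w j)"
      by (rule prod_sum_PiE[symmetric]) (auto simp: finite_level)
    also have "\<dots> = (\<Prod>v\<in>level n. \<Prod>w\<in>children v. \<Sum>j\<in>UNIV. M $ g (butlast w) $ j * \<phi> w j)"
      by (rule level_prod)
    also have "\<dots> = (\<Prod>v\<in>level n. up \<phi> v (g v))"
      unfolding up_def by (intro prod.cong refl) (simp add: children_eq)
    finally show ?thesis by simp
  qed
  have "depends_on (trunc T (Suc n)) (\<lambda>\<sigma>. G \<sigma> * (\<Prod>w\<in>?B. \<phi> w (\<sigma> w)))"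
    using depends_on_mono[OF G, of "trunc T (Suc n)"] level_subset(2)[of "Suc n" "Suc n"]
    by (intro depends_on_compose2[where h = "(*)"] depends_on_prod depends_on_coord)
       (auto simp: trunc_mono)
  from integral_trunc[OF this]
  have "(\<integral>\<sigma>. G \<sigma> * (\<Prod>w\<in>?B. \<phi> w (\<sigma> w)) \<partial>P) = (\<Sum>\<eta>\<in>?A \<union> ?B \<rightarrow>\<^sub>E UNIV.
      weight (Suc n) \<eta> * (G \<eta> * (\<Prod>w\<in>?B. \<phi> w (\<eta> w))))"
    by (simp only: trunc_Suc)
  also have "\<dots> = (\<Sum>g\<in>?A \<rightarrow>\<^sub>E UNIV. weight n g * (G g * (\<Prod>v\<in>level n. up \<phi> v (g v))))"
    unfolding sum_PiE_Un[OF trunc_level_disjoint] split ..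
  also have "\<dots> = (\<integral>\<sigma>. G \<sigma> * (\<Prod>v\<in>level n. up \<phi> v (\<sigma> v)) \<partial>P)"
    using level_subset(2)[of n n]
    by (intro integral_trunc[symmetric] depends_on_compose2[where h = "(*)"] depends_on_prod
        depends_on_coord G) auto
  finally show ?thesis .
qed

lemma integral_level_add:
  fixes G :: "(vertex \<Rightarrow> 'q) \<Rightarrow> real"
  assumes "depends_on (trunc T n) G"
  shows "(\<integral>\<sigma>. G \<sigma> * (\<Prod>w\<in>level (n + k). \<phi> w (\<sigma> w)) \<partial>P) =
    (\<integral>\<sigma>. G \<sigma> * (\<Prod>v\<in>level n. (up ^^ k) \<phi> v (\<sigma> v)) \<partial>P)"
  using assms
proof (induction k arbitrary: n)
  case (Suc k)
  have "depends_on (trunc T (Suc n)) G"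
    using Suc.prems by (rule depends_on_mono) (simp add: trunc_mono)
  from Suc.IH[OF this] show ?case
    using integral_level_Suc[OF Suc.prems, of "(up ^^ k) \<phi>"] by simp
qed simp

text \<open>Padding with the constant weight 1 turns a product over one subtree into a product over
  a whole generation, which \<open>integral_level_add\<close> can integrate out.\<close>

lemma prod_level_desc:
  fixes v k and f :: "vertex \<Rightarrow> 'q \<Rightarrow> real"
  defines "\<phi> \<equiv> \<lambda>w. if w \<in> desc v k then f w else (\<lambda>_. 1)"
  shows "(\<Prod>w\<in>level (length v + k). \<phi> w (\<sigma> w)) = (\<Prod>w\<in>desc v k. f w (\<sigma> w))"
proof -
  have "(\<Prod>w\<in>desc v k. f w (\<sigma> w)) = (\<Prod>w\<in>desc v k. \<phi> w (\<sigma> w))"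
    by (intro prod.cong) (auto simp: \<phi>_def)
  also have "\<dots> = (\<Prod>w\<in>level (length v + k). \<phi> w (\<sigma> w))"
    by (intro prod.mono_neutral_left finite_level desc_subset) (auto simp: \<phi>_def)
  finally show ?thesis ..
qed

lemma integral_desc_aux:
  assumes v: "v \<in> T"
  shows "(\<integral>\<sigma>. h (\<sigma> v) * (\<Prod>w\<in>desc v k. \<phi> w (\<sigma> w)) \<partial>P) =
    (\<integral>\<sigma>. h (\<sigma> v) * (up ^^ k) \<phi> v (\<sigma> v) \<partial>P)"
proof -
  let ?\<phi> = "\<lambda>w. if w \<in> desc v k then \<phi> w else (\<lambda>_. 1)"
  have "(\<integral>\<sigma>. h (\<sigma> v) * (\<Prod>w\<in>desc v k. \<phi> w (\<sigma> w)) \<partial>P) =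
      (\<integral>\<sigma>. h (\<sigma> v) * (\<Prod>w\<in>level (length v + k). ?\<phi> w (\<sigma> w)) \<partial>P)"
    by (simp only: prod_level_desc)
  also have "\<dots> = (\<integral>\<sigma>. h (\<sigma> v) * (\<Prod>w\<in>level (length v). (up ^^ k) ?\<phi> w (\<sigma> w)) \<partial>P)"
    using v by (intro integral_level_add depends_on_coord) (auto simp: trunc_def)
  also have "(\<lambda>\<sigma>. h (\<sigma> v) * (\<Prod>w\<in>level (length v). (up ^^ k) ?\<phi> w (\<sigma> w))) =
      (\<lambda>\<sigma>. h (\<sigma> v) * (up ^^ k) \<phi> v (\<sigma> v))"
  proof
    fix \<sigma> :: "vertex \<Rightarrow> 'q"
    \<comment> \<open>The subtrees of the other vertices of this generation carry only the padding,
      so they pull up to the factor 1.\<close>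
    have "(up ^^ k) ?\<phi> w = (\<lambda>_. 1)" if w: "w \<in> level (length v) - {v}" for w
    proof -
      have "(up ^^ k) ?\<phi> w = (up ^^ k) (\<lambda>_ _. 1) w"
        using w desc_disjoint[of w v k] by (intro funpow_up_cong) (auto simp: level_def)
      then show ?thesis by (simp add: funpow_up_one)
    qed
    then have "(\<Prod>w\<in>level (length v). (up ^^ k) ?\<phi> w (\<sigma> w)) = (\<Prod>w\<in>{v}. (up ^^ k) ?\<phi> w (\<sigma> w))"
      using v by (intro prod.mono_neutral_right finite_level) (auto simp: level_def)
    moreover have "(up ^^ k) ?\<phi> v = (up ^^ k) \<phi> v"
      using v by (intro funpow_up_cong) auto
    ultimately show "h (\<sigma> v) * (\<Prod>w\<in>level (length v). (up ^^ k) ?\<phi> w (\<sigma> w)) =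
        h (\<sigma> v) * (up ^^ k) \<phi> v (\<sigma> v)" by simp
  qed
  finally show ?thesis .
qed

text \<open>Stationarity carries the law \<open>\<alpha>\<close> down one edge at a time: averaging
  over the last spin of the path replaces \<open>h\<close> by its image under \<open>M\<close>, a
  function of the parent's spin.\<close>

lemma integral_coord: "v \<in> T \<Longrightarrow> (\<integral>\<sigma>. h (\<sigma> v) \<partial>P) = (\<Sum>i\<in>UNIV. \<alpha> $ i * h i)"
proof (induction v arbitrary: h rule: rev_induct)
  case Nil
  have "(\<integral>\<sigma>. h (\<sigma> []) \<partial>P) = (\<Sum>\<eta>\<in>{[]} \<rightarrow>\<^sub>E UNIV. weight 0 \<eta> * h (\<eta> []))"
    using integral_trunc[of 0 "\<lambda>\<sigma>. h (\<sigma> [])"] by (simp add: trunc_0 depends_on_coord)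
  also have "\<dots> = (\<Sum>i\<in>UNIV. \<alpha> $ i * h i)"
    by (rule sum.reindex_bij_witness[where i = "\<lambda>i. \<lambda>v\<in>{[]}. i" and j = "\<lambda>\<eta>. \<eta> []"])
       (auto simp: weight_def trunc_0 PiE_iff extensional_def fun_eq_iff)
  finally show ?case .
next
  case (snoc a v)
  let ?w = "v @ [a]"
  \<comment> \<open>Only the child \<open>v @ [a]\<close> has a nontrivial weight, so one
    \<open>up\<close> step is a single application of \<open>M\<close> to \<open>h\<close>.\<close>
  let ?\<phi> = "\<lambda>w. if w = ?w then h else (\<lambda>_. 1)"
  have v: "v \<in> T" using snoc.prems by (rule parent_in)
  have w: "?w \<in> children v" using snoc.prems by (auto simp: children_def child_def)
  have up_eq: "up ?\<phi> v i = (\<Sum>j\<in>UNIV. M $ i $ j * h j)" for i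
  proof -
    have "up ?\<phi> v i = (\<Prod>w\<in>{?w}. \<Sum>j\<in>UNIV. M $ i $ j * ?\<phi> w j)"
      unfolding up_def using w by (intro prod.mono_neutral_right finite_children) (auto simp: M_stoch)
    then show ?thesis by simp
  qed
  have "?w \<in> desc v 1" using snoc.prems by (auto simp: desc_def)
  then have "(\<Prod>w\<in>desc v 1. ?\<phi> w (\<sigma> w)) = (\<Prod>w\<in>{?w}. ?\<phi> w (\<sigma> w))" for \<sigma>
    by (intro prod.mono_neutral_right finite_desc) auto
  then have "(\<integral>\<sigma>. h (\<sigma> ?w) \<partial>P) = (\<integral>\<sigma>. 1 * (\<Prod>w\<in>desc v 1. ?\<phi> w (\<sigma> w)) \<partial>P)"
    by simp
  also have "\<dots> = (\<integral>\<sigma>. up ?\<phi> v (\<sigma> v) \<partial>P)"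
    using integral_desc_aux[OF v, where h = "\<lambda>_. 1" and k = 1 and \<phi> = ?\<phi>] by simp
  also have "\<dots> = (\<Sum>i\<in>UNIV. \<alpha> $ i * up ?\<phi> v i)"
    by (rule snoc.IH[OF v])
  also have "\<dots> = (\<Sum>i\<in>UNIV. \<alpha> $ i * (\<Sum>j\<in>UNIV. M $ i $ j * h j))"
    by (simp only: up_eq)
  also have "\<dots> =
      (\<Sum>j\<in>UNIV. \<Sum>i\<in>UNIV. \<alpha> $ i * M $ i $ j * h j)"
    unfolding sum_distrib_left by (subst sum.swap) (simp add: mult_ac)
  also have "\<dots> = (\<Sum>j\<in>UNIV. \<alpha> $ j * h j)"
    by (simp add: sum_distrib_right[symmetric] alpha_stationary)
  finally show ?case .
qed

lemma integral_desc:
  "v \<in> T \<Longrightarrow> (\<integral>\<sigma>. h (\<sigma> v) * (\<Prod>w\<in>desc v k. \<phi> w (\<sigma> w)) \<partial>P) =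
    (\<Sum>i\<in>UNIV. \<alpha> $ i * (h i * (up ^^ k) \<phi> v i))"
  using integral_desc_aux integral_coord[of v "\<lambda>i. h i * (up ^^ k) \<phi> v i"] by simp

text \<open>The joint law of a parent's spin and the subtree of one child: the other children
  contribute row sums equal to 1. The entropy recursion needs exactly this pair.\<close>

lemma integral_desc_child:
  assumes w: "w \<in> children v"
  shows "(\<integral>\<sigma>. h (\<sigma> v) * (\<Prod>u\<in>desc w k. \<phi> u (\<sigma> u)) \<partial>P) =
    (\<Sum>i\<in>UNIV. \<alpha> $ i * (h i * (\<Sum>j\<in>UNIV. M $ i $ j * (up ^^ k) \<phi> w j)))"
proof -
  have v: "v \<in> T" and wT: "w \<in> T"
    using w by (auto simp: children_eq butlast_in)
  let ?\<phi> = "\<lambda>u. if u \<in> desc w k then \<phi> u else (\<lambda>_. 1)"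
  have up_eq: "(up ^^ Suc k) ?\<phi> v i = (\<Sum>j\<in>UNIV. M $ i $ j * (up ^^ k) \<phi> w j)" for i
  proof -
    have other: "(up ^^ k) ?\<phi> w' = (\<lambda>_. 1)" if "w' \<in> children v" "w' \<noteq> w" for w'
    proof -
      have "(up ^^ k) ?\<phi> w' = (up ^^ k) (\<lambda>_ _. 1) w'"
        using that w desc_disjoint[of w' w k]
        by (intro funpow_up_cong) (auto simp: length_children children_def)
      then show ?thesis by (simp add: funpow_up_one)
    qed
    have same: "(up ^^ k) ?\<phi> w = (up ^^ k) \<phi> w"
      using wT by (intro funpow_up_cong) auto
    have "(up ^^ Suc k) ?\<phi> v i = (\<Prod>w'\<in>children v. \<Sum>j\<in>UNIV. M $ i $ j * (up ^^ k) ?\<phi> w' j)"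
      by (simp add: up_def[of "(up ^^ k) ?\<phi>"])
    also have "\<dots> = (\<Prod>w'\<in>{w}. \<Sum>j\<in>UNIV. M $ i $ j * (up ^^ k) ?\<phi> w' j)"
      using w by (intro prod.mono_neutral_right finite_children) (auto simp: other M_stoch)
    finally show ?thesis by (simp add: same)
  qed
  have "(\<Prod>u\<in>desc w k. \<phi> u (\<sigma> u)) = (\<Prod>u\<in>desc v (Suc k). ?\<phi> u (\<sigma> u))" for \<sigma>
    using w by (intro prod.mono_neutral_cong_left finite_desc) (auto simp: desc_Suc)
  then have "(\<integral>\<sigma>. h (\<sigma> v) * (\<Prod>u\<in>desc w k. \<phi> u (\<sigma> u)) \<partial>P) =
      (\<Sum>i\<in>UNIV. \<alpha> $ i * (h i * (up ^^ Suc k) ?\<phi> v i))"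
    using integral_desc[OF v, where h = h and k = "Suc k" and \<phi> = ?\<phi>] by simp
  also have "\<dots> = (\<Sum>i\<in>UNIV. \<alpha> $ i * (h i * (\<Sum>j\<in>UNIV. M $ i $ j * (up ^^ k) \<phi> w j)))"
    by (simp only: up_eq)
  finally show ?thesis .
qed

end

section \<open>Decay of the symmetric entropy\<close>

text \<open>The derivative of \<open>ln\<close> is at least 1 on (0,1], so
  \<open>ln p - ln a\<close> has the sign of \<open>p - a\<close> and at least its size. Thus small
  \<open>L\<close> forces a law to be close to \<open>\<alpha>\<close>.\<close>

lemma square_le_diff_times_ln:
  fixes a p :: real
  assumes "0 < a" "a \<le> 1" "0 < p" "p \<le> 1"
  shows "(p - a)\<^sup>2 \<le> (p - a) * ln (p / a)"
proof -
  have *: "(x - y)\<^sup>2 \<le> (x - y) * ln (x / y)" if "0 < y" "y \<le> x" "x \<le> 1" for x y :: real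
  proof -
    have "ln (y / x) \<le> y / x - 1" using that by (intro ln_le_minus_one) simp
    moreover have "ln (y / x) = - ln (x / y)" using that by (simp add: ln_div)
    moreover have "x - y \<le> 1 - y / x" using that mult_right_mono[of x 1 "x - y"] by (simp add: field_simps)
    ultimately have "x - y \<le> ln (x / y)" by linarith
    then have "(x - y) * (x - y) \<le> (x - y) * ln (x / y)" using that by (intro mult_left_mono) auto
    then show ?thesis by (simp add: power2_eq_square)
  qed
  show ?thesis
  proof (cases "a \<le> p")
    case True
    then show ?thesis using *[of a p] assms by simp
  next
    case False
    then have "(a - p)\<^sup>2 \<le> (a - p) * ln (a / p)" using *[of p a] assms by simp
    moreover have "(a - p) * ln (a / p) = (p - a) * ln (p / a)"
      using assms by (simp add: ln_div algebra_simps)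
    ultimately show ?thesis by (simp add: power2_commute)
  qed
qed

lemma sum_weighted_pos:
  fixes f g :: "'a::finite \<Rightarrow> real"
  assumes "\<And>i. f i > 0" "\<And>i. g i \<ge> 0" "g j > 0"
  shows "(\<Sum>i\<in>UNIV. f i * g i) > 0"
proof (rule sum_pos2[of _ j])
  show "f i * g i \<ge> 0" for i
    using assms(1)[of i] assms(2)[of i] by simp
qed (use assms in simp_all)

text \<open>The indicator of a pattern is kept as a product over \<open>D\<close>, the form that the
  sum-product formulas integrate.\<close>

lemma local_expansion:
  fixes f :: "('a \<Rightarrow> 'q::finite) \<Rightarrow> real"
  assumes D: "finite D" and f: "depends_on D f"
  shows "f \<sigma> = (\<Sum>\<xi>\<in>D \<rightarrow>\<^sub>E UNIV. f \<xi> * (\<Prod>w\<in>D. of_bool (\<sigma> w = \<xi> w)))"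
proof -
  have zero: "(\<Prod>w\<in>D. of_bool (\<sigma> w = \<xi> w)) = (0::real)"
    if "\<xi> \<in> (D \<rightarrow>\<^sub>E UNIV) - {restrict \<sigma> D}" for \<xi>
  proof -
    have "\<exists>w\<in>D. \<sigma> w \<noteq> \<xi> w"
    proof (rule ccontr)
      assume "\<not> ?thesis"
      then have "\<xi> = restrict \<sigma> D" using that by (auto simp: fun_eq_iff PiE_iff extensional_def)
      then show False using that by simp
    qed
    then show ?thesis using D by auto
  qed
  have "(\<Sum>\<xi>\<in>D \<rightarrow>\<^sub>E UNIV. f \<xi> * (\<Prod>w\<in>D. of_bool (\<sigma> w = \<xi> w))) =
      (\<Sum>\<xi>\<in>{restrict \<sigma> D}. f \<xi> * (\<Prod>w\<in>D. of_bool (\<sigma> w = \<xi> w)))"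
    using D zero by (intro sum.mono_neutral_right finite_PiE) auto
  also have "\<dots> = f \<sigma>"
    by (simp add: depends_on_restrict[OF f])
  finally show ?thesis ..
qed

section \<open>Likelihoods, posteriors and the entropy functional\<close>

context markov_tree
begin

text \<open>The conditional probability, given spin \<open>i\<close> at \<open>v\<close>, that the
  spins on \<open>desc v k\<close> are those of \<open>\<xi>\<close>. The recursion starts from
  indicators of the observed spins.\<close>

definition lik :: "nat \<Rightarrow> (vertex \<Rightarrow> 'q) \<Rightarrow> vertex \<Rightarrow> 'q \<Rightarrow> real" where
  "lik k \<xi> = (up ^^ k) (\<lambda>w j. of_bool (j = \<xi> w))"

text \<open>The message from \<open>w\<close> to its parent: the likelihood of the observation below
  \<open>w\<close> given spin \<open>i\<close> at the parent of \<open>w\<close>.\<close>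

definition msg :: "nat \<Rightarrow> (vertex \<Rightarrow> 'q) \<Rightarrow> vertex \<Rightarrow> 'q \<Rightarrow> real" where
  "msg k \<xi> w i = (\<Sum>j\<in>UNIV. M $ i $ j * lik k \<xi> w j)"

definition evidence :: "nat \<Rightarrow> (vertex \<Rightarrow> 'q) \<Rightarrow> vertex \<Rightarrow> real" where
  "evidence k \<xi> v = (\<Sum>i\<in>UNIV. \<alpha> $ i * lik k \<xi> v i)"

text \<open>Bayes' rule with prior \<open>\<alpha>\<close>; the evidence is the probability of the
  observation on \<open>desc v k\<close>.\<close>

definition posterior :: "nat \<Rightarrow> (vertex \<Rightarrow> 'q) \<Rightarrow> vertex \<Rightarrow> real ^ 'q" where
  "posterior k \<xi> v = (\<chi> i. \<alpha> $ i * lik k \<xi> v i / evidence k \<xi> v)"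

text \<open>The functional \<open>L\<close> as a real number. Where an entry of \<open>p\<close>
  vanishes, the total function \<open>ln\<close> still returns a real, so the value there is not
  infinity; the estimates below therefore assume positive entries.\<close>

definition sym_ent :: "real ^ 'q \<Rightarrow> real" where
  "sym_ent p = (\<Sum>i\<in>UNIV. (p $ i - \<alpha> $ i) * ln (p $ i / \<alpha> $ i))"

lemma lik_Suc: "lik (Suc k) \<xi> v i = (\<Prod>w\<in>children v. msg k \<xi> w i)"
  by (simp add: lik_def msg_def up_def[of "(up ^^ k) _"])

lemma depends_on_lik: "v \<in> T \<Longrightarrow> depends_on (desc v k) (\<lambda>\<xi>. lik k \<xi> v i)"
proof (rule depends_onI)
  fix \<sigma> \<sigma>' :: "vertex \<Rightarrow> 'q"
  assume "v \<in> T" "\<And>w. w \<in> desc v k \<Longrightarrow> \<sigma> w = \<sigma>' w"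
  then have "lik k \<sigma> v = lik k \<sigma>' v"
    unfolding lik_def by (intro funpow_up_cong) auto
  then show "lik k \<sigma> v i = lik k \<sigma>' v i" by simp
qed

lemma depends_on_msg: "v \<in> T \<Longrightarrow> depends_on (desc v k) (\<lambda>\<xi>. msg k \<xi> v i)"
  unfolding msg_def
  by (rule depends_on_sum) (rule depends_on_compose[where h = "\<lambda>x. M $ i $ _ * x"], rule depends_on_lik)

lemma depends_on_evidence: "v \<in> T \<Longrightarrow> depends_on (desc v k) (\<lambda>\<xi>. evidence k \<xi> v)"
  unfolding evidence_def
  by (rule depends_on_sum) (rule depends_on_compose[where h = "\<lambda>x. \<alpha> $ _ * x"], rule depends_on_lik)

lemma depends_on_posterior:
  assumes "v \<in> T"
  shows "depends_on (desc v k) (\<lambda>\<xi>. posterior k \<xi> v)"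
proof (rule depends_onI)
  fix \<sigma> \<sigma>' :: "vertex \<Rightarrow> 'q"
  assume eq: "\<And>w. w \<in> desc v k \<Longrightarrow> \<sigma> w = \<sigma>' w"
  have "lik k \<sigma> v i = lik k \<sigma>' v i" for i
    using depends_onD[OF depends_on_lik[OF assms] eq] by simp
  moreover have "evidence k \<sigma> v = evidence k \<sigma>' v"
    using depends_onD[OF depends_on_evidence[OF assms] eq] by simp
  ultimately show "posterior k \<sigma> v = posterior k \<sigma>' v"
    by (simp add: posterior_def)
qed

text \<open>At \<open>k = 0\<close> the likelihood is the indicator of one spin. A multiplication by
  the positive matrix \<open>M\<close> makes every message positive, so full positivity starts at
  \<open>Suc k\<close>.\<close>

lemma lik_nonneg_ex_pos: "(\<forall>i. lik k \<xi> v i \<ge> 0) \<and> (\<exists>i. lik k \<xi> v i > 0)"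
proof (induction k arbitrary: v)
  case 0
  then show ?case by (simp add: lik_def)
next
  case (Suc k)
  have "msg k \<xi> w i > 0" for w i
    unfolding msg_def using Suc sum_weighted_pos[of "\<lambda>j. M $ i $ j", OF M_pos] by blast
  then have "lik (Suc k) \<xi> v i > 0" for i by (auto simp: lik_Suc intro!: prod_pos)
  then show ?case by (simp add: less_imp_le)
qed

lemma lik_nonneg: "lik k \<xi> v i \<ge> 0"
  using lik_nonneg_ex_pos by blast

lemma msg_pos: "msg k \<xi> w i > 0"
  unfolding msg_def
  using lik_nonneg_ex_pos[of k \<xi> w] sum_weighted_pos[of "\<lambda>j. M $ i $ j", OF M_pos] by blast

lemma evidence_pos: "evidence k \<xi> v > 0"
  unfolding evidence_def
  using lik_nonneg_ex_pos[of k \<xi> v] sum_weighted_pos[of "\<lambda>i. \<alpha> $ i", OF alpha_pos] by blast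

lemma lik_pos: "lik (Suc k) \<xi> v i > 0"
  by (auto simp: lik_Suc intro!: prod_pos msg_pos)

text \<open>By stationarity the observation below \<open>w\<close> has the same probability whether
  one averages over the spin of \<open>w\<close> or over that of its parent.\<close>

lemma evidence_msg: "(\<Sum>i\<in>UNIV. \<alpha> $ i * msg k \<xi> w i) = evidence k \<xi> w"
proof -
  have "(\<Sum>i\<in>UNIV. \<alpha> $ i * msg k \<xi> w i) =
      (\<Sum>j\<in>UNIV. \<Sum>i\<in>UNIV. \<alpha> $ i * M $ i $ j * lik k \<xi> w j)"
    unfolding msg_def sum_distrib_left by (subst sum.swap) (simp add: mult_ac)
  then show ?thesis
    by (simp add: sum_distrib_right[symmetric] alpha_stationary evidence_def)
qed

lemma posterior_simplex: "posterior k \<xi> v \<in> prob_simplex"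
  using evidence_pos[of k \<xi> v] lik_nonneg less_imp_le[OF alpha_pos]
  by (auto simp: prob_simplex_def posterior_def sum_divide_distrib[symmetric] evidence_def[symmetric]
      intro!: divide_nonneg_pos mult_nonneg_nonneg)

lemma posterior_pos: "posterior (Suc k) \<xi> v $ i > 0"
  using evidence_pos[of "Suc k" \<xi> v] lik_pos alpha_pos by (simp add: posterior_def)

text \<open>The right-hand side is the conditional law of the spin at the parent of
  \<open>w\<close>, given the observation below \<open>w\<close>. Going from child to parent is a
  step of the reversed chain, by Bayes' rule.\<close>

lemma posterior_reversed:
  "(posterior k \<xi> w v* reversed \<alpha> M) $ i = \<alpha> $ i * msg k \<xi> w i / evidence k \<xi> w"
proof -
  have "(posterior k \<xi> w v* reversed \<alpha> M) $ i =
      (\<Sum>j\<in>UNIV. \<alpha> $ i * (M $ i $ j * lik k \<xi> w j) / evidence k \<xi> w)"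
    using alpha_pos
    by (simp add: vector_matrix_mult_def reversed_def posterior_def less_imp_neq[THEN not_sym] mult_ac)
  then show ?thesis by (simp add: msg_def sum_distrib_left sum_divide_distrib)
qed

text \<open>The normalisation \<open>Z\<close> drops out of the logarithm because the coefficients sum to zero.\<close>

lemma sym_ent_scale:
  fixes u :: "'q \<Rightarrow> real"
  assumes u: "\<And>i. u i > 0" and Z: "Z = (\<Sum>i\<in>UNIV. \<alpha> $ i * u i)"
    and p: "\<And>i. p $ i = \<alpha> $ i * u i / Z"
  shows "(\<Sum>i\<in>UNIV. \<alpha> $ i * (u i - Z) * ln (u i)) = Z * sym_ent p"
proof -
  have Zpos: "Z > 0" unfolding Z using u alpha_pos by (intro sum_pos) auto
  have "Z * sym_ent p = (\<Sum>i\<in>UNIV. \<alpha> $ i * (u i - Z) * (ln (u i) - ln Z))"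
    unfolding sym_ent_def sum_distrib_left p
  proof (rule sum.cong[OF refl])
    fix i
    have "\<alpha> $ i * u i / Z / \<alpha> $ i = u i / Z"
      using alpha_pos[of i] by simp
    moreover have "ln (u i / Z) = ln (u i) - ln Z"
      using u[of i] Zpos by (simp add: ln_div)
    moreover have "Z * (\<alpha> $ i * u i / Z - \<alpha> $ i) = \<alpha> $ i * (u i - Z)"
      using Zpos by (simp add: field_simps)
    ultimately show "Z * ((\<alpha> $ i * u i / Z - \<alpha> $ i) * ln (\<alpha> $ i * u i / Z / \<alpha> $ i)) =
        \<alpha> $ i * (u i - Z) * (ln (u i) - ln Z)"
      by (metis mult.assoc)
  qed
  also have "\<dots> = (\<Sum>i\<in>UNIV. \<alpha> $ i * (u i - Z) * ln (u i)) - (\<Sum>i\<in>UNIV. \<alpha> $ i * (u i - Z)) * ln Z"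
    unfolding right_diff_distrib[where c = "ln Z"] sum_subtractf sum_distrib_right ..
  also have "(\<Sum>i\<in>UNIV. \<alpha> $ i * (u i - Z)) = 0"
    by (simp add: right_diff_distrib sum_subtractf sum_distrib_right[symmetric] alpha_sum Z[symmetric])
  finally show ?thesis by simp
qed

text \<open>Averaging the centred indicator of spin \<open>i\<close> against a likelihood
  \<open>u\<close> produces the coefficient of \<open>ln (u i)\<close> in
  \<open>sym_ent_scale\<close>.\<close>

lemma sum_centred_indicator:
  "(\<Sum>j\<in>UNIV. \<alpha> $ j * ((of_bool (j = i) - \<alpha> $ i) * u j)) =
    \<alpha> $ i * (u i - (\<Sum>j\<in>UNIV. \<alpha> $ j * u j))"
proof -
  have "\<alpha> $ j * ((of_bool (j = i) - \<alpha> $ i) * u j) =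
      (if j = i then \<alpha> $ i * u i else 0) - \<alpha> $ i * (\<alpha> $ j * u j)" for j
    by (simp add: algebra_simps)
  then show ?thesis by (simp add: sum_subtractf sum_distrib_left right_diff_distrib)
qed

lemma square_le_sym_ent:
  assumes "p \<in> prob_simplex" "\<And>i. p $ i > 0"
  shows "(p $ i - \<alpha> $ i)\<^sup>2 \<le> sym_ent p"
proof -
  have sq: "(p $ i - \<alpha> $ i)\<^sup>2 \<le> (p $ i - \<alpha> $ i) * ln (p $ i / \<alpha> $ i)" for i
  proof (rule square_le_diff_times_ln)
    show "p $ i \<le> 1"
      using assms member_le_sum[of i UNIV "\<lambda>i. p $ i"] by (auto simp: prob_simplex_def)
  qed (auto simp: alpha_pos alpha_le_1 assms)
  have "(p $ i - \<alpha> $ i)\<^sup>2 \<le> (p $ i - \<alpha> $ i) * ln (p $ i / \<alpha> $ i)" by (rule sq)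
  also have "\<dots> \<le> sym_ent p"
    unfolding sym_ent_def using sq by (intro member_le_sum) (auto intro: order_trans[OF zero_le_power2])
  finally show ?thesis .
qed

lemma sym_ent_nonneg: "p \<in> prob_simplex \<Longrightarrow> (\<And>i. p $ i > 0) \<Longrightarrow> sym_ent p \<ge> 0"
  using square_le_sym_ent zero_le_power2 by (meson order_trans)

end

section \<open>The expected entropy and its recursion over the children\<close>

context tree_chain_law
begin

lemma desc_subset_trunc: "length v + k \<le> N \<Longrightarrow> desc v k \<subseteq> trunc T N"
  by (auto simp: desc_def trunc_def)

lemma integral_local_sum:
  fixes f :: "(vertex \<Rightarrow> 'q) \<Rightarrow> real"
  assumes v: "v \<in> T" and D: "D \<subseteq> trunc T N" "length v \<le> N" and f: "depends_on D f"
  shows "(\<integral>\<sigma>. h (\<sigma> v) * f \<sigma> \<partial>P) =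
    (\<Sum>\<xi>\<in>D \<rightarrow>\<^sub>E UNIV. f \<xi> * (\<integral>\<sigma>. h (\<sigma> v) * (\<Prod>w\<in>D. of_bool (\<sigma> w = \<xi> w)) \<partial>P))"
proof -
  have fin: "finite D" using D(1) finite_trunc by (rule finite_subset)
  have "(\<integral>\<sigma>. h (\<sigma> v) * f \<sigma> \<partial>P) =
      (\<integral>\<sigma>. (\<Sum>\<xi>\<in>D \<rightarrow>\<^sub>E UNIV. f \<xi> * (h (\<sigma> v) * (\<Prod>w\<in>D. of_bool (\<sigma> w = \<xi> w)))) \<partial>P)"
    by (subst local_expansion[OF fin f]) (simp add: sum_distrib_left mult_ac)
  also have "\<dots> = (\<Sum>\<xi>\<in>D \<rightarrow>\<^sub>E UNIV. \<integral>\<sigma>. f \<xi> * (h (\<sigma> v) * (\<Prod>w\<in>D. of_bool (\<sigma> w = \<xi> w))) \<partial>P)"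
    using D v
    by (intro Bochner_Integration.integral_sum integrable_mult_right integrable_trunc[of N]
        depends_on_compose2[where h = "(*)"] depends_on_prod depends_on_coord
        depends_on_coord[where h = "\<lambda>x. of_bool (x = _)"])
       (auto simp: trunc_def)
  finally show ?thesis by simp
qed

text \<open>Spin \<open>i\<close> at \<open>v\<close> together with the pattern \<open>\<xi>\<close>
  on \<open>desc v k\<close> has probability \<open>\<alpha> $ i * lik k \<xi> v i\<close>; summing
  over patterns covers every function of that generation.\<close>

lemma integral_desc_local:
  assumes "v \<in> T" "depends_on (desc v k) f"
  shows "(\<integral>\<sigma>. h (\<sigma> v) * f \<sigma> \<partial>P) =
    (\<Sum>\<xi>\<in>desc v k \<rightarrow>\<^sub>E UNIV. f \<xi> * (\<Sum>i\<in>UNIV. \<alpha> $ i * (h i * lik k \<xi> v i)))"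
  unfolding integral_local_sum[OF assms(1) desc_subset_trunc[OF order_refl] _ assms(2), simplified]
  by (rule sum.cong[OF refl], subst integral_desc[OF assms(1), where \<phi> = "\<lambda>w j. of_bool (j = _ w)"])
     (simp add: lik_def)

lemma integral_desc_child_local:
  assumes w: "w \<in> children v" and f: "depends_on (desc w k) f"
  shows "(\<integral>\<sigma>. h (\<sigma> v) * f \<sigma> \<partial>P) =
    (\<Sum>\<xi>\<in>desc w k \<rightarrow>\<^sub>E UNIV. f \<xi> * (\<Sum>i\<in>UNIV. \<alpha> $ i * (h i * msg k \<xi> w i)))"
proof -
  have v: "v \<in> T" using w by (auto simp: children_eq butlast_in)
  have len: "length v \<le> length w + k" using length_children[OF w] by simp
  show ?thesis
    unfolding integral_local_sum[OF v desc_subset_trunc[OF order_refl] len f]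
    by (rule sum.cong[OF refl], subst integral_desc_child[OF w, where \<phi> = "\<lambda>w j. of_bool (j = _ w)"])
       (simp add: lik_def msg_def)
qed

definition mean_ent :: "nat \<Rightarrow> vertex \<Rightarrow> real" where
  "mean_ent k v = (\<integral>\<sigma>. sym_ent (posterior k \<sigma> v) \<partial>P)"

lemma mean_ent_sum:
  assumes "v \<in> T"
  shows "mean_ent k v = (\<Sum>\<xi>\<in>desc v k \<rightarrow>\<^sub>E UNIV. evidence k \<xi> v * sym_ent (posterior k \<xi> v))"
proof -
  have "depends_on (desc v k) (\<lambda>\<xi>. sym_ent (posterior k \<xi> v))"
    by (rule depends_on_compose[OF depends_on_posterior[OF assms]])
  from integral_desc_local[OF assms this, of "\<lambda>_. 1"] show ?thesis
    by (simp add: mean_ent_def evidence_def mult_ac)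
qed

text \<open>A pattern contributes evidence times entropy, and \<open>sym_ent_scale\<close> with
  \<open>u\<close> the likelihood makes this linear in the log-likelihood. What results is a sum of
  covariances of spin indicators and log-likelihoods, ready to be split over the children.\<close>

lemma mean_ent_correlation:
  assumes v: "v \<in> T"
  shows "mean_ent (Suc k) v = (\<Sum>i\<in>UNIV. \<integral>\<sigma>. (of_bool (\<sigma> v = i) - \<alpha> $ i) * ln (lik (Suc k) \<sigma> v i) \<partial>P)"
proof -
  have "(\<integral>\<sigma>. (of_bool (\<sigma> v = i) - \<alpha> $ i) * ln (lik (Suc k) \<sigma> v i) \<partial>P) =
      (\<Sum>\<xi>\<in>desc v (Suc k) \<rightarrow>\<^sub>E UNIV. \<alpha> $ i * (lik (Suc k) \<xi> v i - evidence (Suc k) \<xi> v) *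
        ln (lik (Suc k) \<xi> v i))" for i
  proof -
    have dep: "depends_on (desc v (Suc k)) (\<lambda>\<xi>. ln (lik (Suc k) \<xi> v i))"
      by (rule depends_on_compose[OF depends_on_lik[OF v]])
    show ?thesis
      using integral_desc_local[OF v dep, of "\<lambda>j. of_bool (j = i) - \<alpha> $ i"]
      by (simp add: sum_centred_indicator evidence_def mult_ac)
  qed
  then have "(\<Sum>i\<in>UNIV. \<integral>\<sigma>. (of_bool (\<sigma> v = i) - \<alpha> $ i) * ln (lik (Suc k) \<sigma> v i) \<partial>P) =
      (\<Sum>\<xi>\<in>desc v (Suc k) \<rightarrow>\<^sub>E UNIV. \<Sum>i\<in>UNIV. \<alpha> $ i *
        (lik (Suc k) \<xi> v i - evidence (Suc k) \<xi> v) * ln (lik (Suc k) \<xi> v i))"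
    by (simp only:) (rule sum.swap)
  also have "\<dots> = (\<Sum>\<xi>\<in>desc v (Suc k) \<rightarrow>\<^sub>E UNIV. evidence (Suc k) \<xi> v * sym_ent (posterior (Suc k) \<xi> v))"
    by (intro sum.cong refl sym_ent_scale lik_pos) (simp_all add: evidence_def posterior_def)
  finally show ?thesis by (simp add: mean_ent_sum[OF v])
qed

text \<open>The argument of \<open>mean_ent_correlation\<close> with the message as
  \<open>u\<close>: its normalisation is the evidence at \<open>w\<close> by
  \<open>evidence_msg\<close>, and the normalised message is the reversed step of
  \<open>posterior_reversed\<close>.\<close>

lemma msg_correlation:
  assumes w: "w \<in> children v"
  shows "(\<Sum>i\<in>UNIV. \<integral>\<sigma>. (of_bool (\<sigma> v = i) - \<alpha> $ i) * ln (msg k \<sigma> w i) \<partial>P) =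
    (\<Sum>\<xi>\<in>desc w k \<rightarrow>\<^sub>E UNIV. evidence k \<xi> w * sym_ent (posterior k \<xi> w v* reversed \<alpha> M))"
proof -
  have wT: "w \<in> T" using w by (auto simp: children_eq)
  have "(\<integral>\<sigma>. (of_bool (\<sigma> v = i) - \<alpha> $ i) * ln (msg k \<sigma> w i) \<partial>P) =
      (\<Sum>\<xi>\<in>desc w k \<rightarrow>\<^sub>E UNIV. \<alpha> $ i * (msg k \<xi> w i - evidence k \<xi> w) * ln (msg k \<xi> w i))" for i
  proof -
    have dep: "depends_on (desc w k) (\<lambda>\<xi>. ln (msg k \<xi> w i))"
      by (rule depends_on_compose[OF depends_on_msg[OF wT]])
    show ?thesis
      using integral_desc_child_local[OF w dep, of "\<lambda>j. of_bool (j = i) - \<alpha> $ i"]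
      by (simp only: sum_centred_indicator evidence_msg) (simp add: mult_ac)
  qed
  then have "(\<Sum>i\<in>UNIV. \<integral>\<sigma>. (of_bool (\<sigma> v = i) - \<alpha> $ i) * ln (msg k \<sigma> w i) \<partial>P) =
      (\<Sum>\<xi>\<in>desc w k \<rightarrow>\<^sub>E UNIV. \<Sum>i\<in>UNIV. \<alpha> $ i * (msg k \<xi> w i - evidence k \<xi> w) * ln (msg k \<xi> w i))"
    by (simp only:) (rule sum.swap)
  also have "\<dots> = (\<Sum>\<xi>\<in>desc w k \<rightarrow>\<^sub>E UNIV. evidence k \<xi> w * sym_ent (posterior k \<xi> w v* reversed \<alpha> M))"
    by (intro sum.cong refl sym_ent_scale msg_pos) (simp_all add: evidence_msg posterior_reversed)
  finally show ?thesis .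
qed

lemma integrable_correlation:
  assumes w: "w \<in> children v"
  shows "integrable P (\<lambda>\<sigma>. (of_bool (\<sigma> v = i) - \<alpha> $ i) * ln (msg k \<sigma> w i))"
proof (rule integrable_trunc[of "length w + k"], rule depends_on_compose2[where h = "(*)"])
  show "depends_on (trunc T (length w + k)) (\<lambda>\<sigma>. of_bool (\<sigma> v = i) - \<alpha> $ i)"
    using w by (intro depends_on_coord[where h = "\<lambda>x. of_bool (x = i) - \<alpha> $ i"])
      (auto simp: trunc_def children_eq butlast_in)
  show "depends_on (trunc T (length w + k)) (\<lambda>\<sigma>. ln (msg k \<sigma> w i))"
    using w by (intro depends_on_compose[where h = ln] depends_on_mono[OF depends_on_msg desc_subset_trunc])
      (auto simp: children_eq)
qed

text \<open>The log-likelihood splits over the children, and each summand only involves the law of one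
  subtree given the spin of its parent.\<close>

lemma mean_ent_Suc:
  assumes v: "v \<in> T"
  shows "mean_ent (Suc k) v =
    (\<Sum>w\<in>children v. \<Sum>i\<in>UNIV. \<integral>\<sigma>. (of_bool (\<sigma> v = i) - \<alpha> $ i) * ln (msg k \<sigma> w i) \<partial>P)"
proof -
  have ln_lik: "ln (lik (Suc k) \<sigma> v i) = (\<Sum>w\<in>children v. ln (msg k \<sigma> w i))" for \<sigma> i
    unfolding lik_Suc by (rule ln_prod) (simp_all add: finite_children less_imp_neq[OF msg_pos, THEN not_sym])
  have "(\<integral>\<sigma>. (of_bool (\<sigma> v = i) - \<alpha> $ i) * ln (lik (Suc k) \<sigma> v i) \<partial>P) =
      (\<Sum>w\<in>children v. \<integral>\<sigma>. (of_bool (\<sigma> v = i) - \<alpha> $ i) * ln (msg k \<sigma> w i) \<partial>P)" for i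
    unfolding ln_lik sum_distrib_left
    by (rule Bochner_Integration.integral_sum) (rule integrable_correlation)
  then show ?thesis
    unfolding mean_ent_correlation[OF v] by (simp only:) (rule sum.swap)
qed

end

section \<open>Geometric decay and almost sure convergence\<close>

locale contracting_chain = tree_chain_law T M \<alpha> P
  for T and M :: "real ^ 'q ^ 'q::finite" and \<alpha> and P +
  fixes c :: real
  assumes c_pos: "c > 0"
    and contracting: "p \<in> prob_simplex \<Longrightarrow> (\<And>i. p $ i > 0) \<Longrightarrow>
      sym_ent (p v* reversed \<alpha> M) \<le> c * sym_ent p"
begin

text \<open>Replaces contraction at the lowest generation, where the law at a child is a point mass
  and the message is a single entry of \<open>M\<close>.\<close>

definition log_bound :: real where
  "log_bound = (\<Sum>i\<in>UNIV. \<Sum>j\<in>UNIV. \<bar>ln (M $ i $ j)\<bar>)"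

text \<open>Each further generation costs a factor \<open>c\<close> and a sum over the children, so
  the bound counts descendants. The exponent is \<open>k\<close>, not \<open>Suc k\<close>, because
  the lowest generation is estimated by \<open>log_bound\<close> without contraction.\<close>

lemma mean_ent_bound:
  "v \<in> T \<Longrightarrow> mean_ent (Suc k) v \<le> log_bound * c ^ k * card (desc v (Suc k))"
proof (induction k arbitrary: v)
  case 0
  have "(\<Sum>i\<in>UNIV. \<integral>\<sigma>. (of_bool (\<sigma> v = i) - \<alpha> $ i) * ln (msg 0 \<sigma> w i) \<partial>P) \<le> log_bound"
    if w: "w \<in> children v" for w
    unfolding log_bound_def
  proof (rule sum_mono)
    fix i
    have "(of_bool (\<sigma> v = i) - \<alpha> $ i) * ln (msg 0 \<sigma> w i) \<le> (\<Sum>j\<in>UNIV. \<bar>ln (M $ i $ j)\<bar>)" for \<sigma>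
    proof -
      have msg: "msg 0 \<sigma> w i = M $ i $ \<sigma> w" by (simp add: msg_def lik_def)
      have "(of_bool (\<sigma> v = i) - \<alpha> $ i) * ln (msg 0 \<sigma> w i) \<le>
          \<bar>of_bool (\<sigma> v = i) - \<alpha> $ i\<bar> * \<bar>ln (M $ i $ \<sigma> w)\<bar>"
        unfolding msg abs_mult[symmetric] by (rule abs_ge_self)
      also have "\<dots> \<le> 1 * \<bar>ln (M $ i $ \<sigma> w)\<bar>"
        using alpha_pos[of i] alpha_le_1[of i] by (intro mult_right_mono) auto
      also have "\<dots> \<le> (\<Sum>j\<in>UNIV. \<bar>ln (M $ i $ j)\<bar>)"
        using member_le_sum[of "\<sigma> w" UNIV "\<lambda>j. \<bar>ln (M $ i $ j)\<bar>"] by simp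
      finally show ?thesis .
    qed
    then have "(\<integral>\<sigma>. (of_bool (\<sigma> v = i) - \<alpha> $ i) * ln (msg 0 \<sigma> w i) \<partial>P) \<le>
        (\<integral>\<sigma>. (\<Sum>j\<in>UNIV. \<bar>ln (M $ i $ j)\<bar>) \<partial>P)"
      by (intro integral_mono integrable_correlation w) auto
    then show "(\<integral>\<sigma>. (of_bool (\<sigma> v = i) - \<alpha> $ i) * ln (msg 0 \<sigma> w i) \<partial>P) \<le> (\<Sum>j\<in>UNIV. \<bar>ln (M $ i $ j)\<bar>)"
      by (simp add: P.prob_space)
  qed
  then have "mean_ent (Suc 0) v \<le> (\<Sum>w\<in>children v. log_bound)"
    unfolding mean_ent_Suc[OF 0] by (rule sum_mono)
  also have "children v = desc v (Suc 0)"
    by (auto simp: desc_Suc desc_0 children_def)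
  finally show ?case by (simp add: mult.commute)
next
  case (Suc k)
  have step: "(\<Sum>i\<in>UNIV. \<integral>\<sigma>. (of_bool (\<sigma> v = i) - \<alpha> $ i) * ln (msg (Suc k) \<sigma> w i) \<partial>P) \<le>
      log_bound * c ^ Suc k * card (desc w (Suc k))" if w: "w \<in> children v" for w
  proof -
    have wT: "w \<in> T" using w by (auto simp: children_eq)
    \<comment> \<open>Contraction is available here because the law at the child looks at least one
      generation down and so has positive entries.\<close>
    have "(\<Sum>i\<in>UNIV. \<integral>\<sigma>. (of_bool (\<sigma> v = i) - \<alpha> $ i) * ln (msg (Suc k) \<sigma> w i) \<partial>P) \<le>
        (\<Sum>\<xi>\<in>desc w (Suc k) \<rightarrow>\<^sub>E UNIV. evidence (Suc k) \<xi> w * (c * sym_ent (posterior (Suc k) \<xi> w)))"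
      unfolding msg_correlation[OF w]
      by (intro sum_mono mult_left_mono contracting posterior_simplex posterior_pos
          less_imp_le[OF evidence_pos])
    also have "\<dots> = c * mean_ent (Suc k) w"
      unfolding mean_ent_sum[OF wT] by (simp add: sum_distrib_left mult_ac)
    also have "\<dots> \<le> c * (log_bound * c ^ k * card (desc w (Suc k)))"
      using c_pos by (intro mult_left_mono Suc.IH[OF wT]) simp
    finally show ?thesis by (simp add: mult_ac)
  qed
  have "mean_ent (Suc (Suc k)) v \<le> (\<Sum>w\<in>children v. log_bound * c ^ Suc k * card (desc w (Suc k)))"
    unfolding mean_ent_Suc[OF Suc.prems] by (intro sum_mono step)
  also have "\<dots> = log_bound * c ^ Suc k * real (\<Sum>w\<in>children v. card (desc w (Suc k)))"
    by (simp add: sum_distrib_left)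
  also have "(\<Sum>w\<in>children v. card (desc w (Suc k))) = card (desc v (Suc (Suc k)))"
    unfolding desc_Suc[of v "Suc k"]
    by (intro card_UN_disjoint[symmetric] finite_children ballI finite_desc impI desc_disjoint)
       (auto simp: length_children)
  finally show ?case .
qed

lemma mean_ent_nonneg: "mean_ent (Suc k) v \<ge> 0"
  unfolding mean_ent_def
  by (intro Bochner_Integration.integral_nonneg sym_ent_nonneg posterior_simplex posterior_pos)

lemma log_bound_nonneg: "log_bound \<ge> 0"
  unfolding log_bound_def by (intro sum_nonneg abs_ge_zero)

lemma integrable_sym_ent: "v \<in> T \<Longrightarrow> integrable P (\<lambda>\<sigma>. sym_ent (posterior k \<sigma> v))"
  by (rule integrable_trunc[of "length v + k"], rule depends_on_compose[where h = sym_ent],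
      rule depends_on_mono[OF depends_on_posterior desc_subset_trunc]) auto

lemma summable_mean_ent:
  assumes v: "v \<in> T" and summable: "summable (\<lambda>n. c ^ n * card (level n))"
  shows "summable (\<lambda>k. mean_ent (Suc k) v)"
proof (rule summable_comparison_test')
  \<comment> \<open>The generation \<open>desc v (Suc k)\<close> lies in level
    \<open>k + ?m\<close>; the shift costs the constant factor \<open>1 / c ^ ?m\<close>.\<close>
  let ?m = "length v + 1"
  have "summable (\<lambda>k. c ^ (k + ?m) * card (level (k + ?m)))"
    using summable by (subst summable_iff_shift)
  then show "summable (\<lambda>k. log_bound / c ^ ?m * (c ^ (k + ?m) * card (level (k + ?m))))"
    by (rule summable_mult)
  fix k :: nat
  have "real (card (desc v (Suc k))) \<le> card (level (k + ?m))"
    using desc_subset(1)[of v "Suc k"] by (simp add: card_mono finite_level add_ac)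
  then have "log_bound * c ^ k * card (desc v (Suc k)) \<le> log_bound * c ^ k * card (level (k + ?m))"
    using log_bound_nonneg c_pos by (intro mult_left_mono) auto
  also have "\<dots> = log_bound / c ^ ?m * (c ^ (k + ?m) * card (level (k + ?m)))"
    using c_pos by (simp add: power_add)
  finally show "norm (mean_ent (Suc k) v) \<le> log_bound / c ^ ?m * (c ^ (k + ?m) * card (level (k + ?m)))"
    using mean_ent_bound[OF v, of k] mean_ent_nonneg[of k v] by simp
qed

text \<open>The expected entropies are summable, so by Tonelli the entropies themselves have an
  almost surely finite sum.\<close>

lemma AE_sym_ent_tendsto_0:
  assumes v: "v \<in> T" and summable: "summable (\<lambda>n. c ^ n * card (level n))"
  shows "AE \<sigma> in P. (\<lambda>k. sym_ent (posterior (Suc k) \<sigma> v)) \<longlonglongrightarrow> 0"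
proof -
  let ?f = "\<lambda>k \<sigma>. sym_ent (posterior (Suc k) \<sigma> v)"
  have nonneg: "?f k \<sigma> \<ge> 0" for k \<sigma>
    by (intro sym_ent_nonneg posterior_simplex posterior_pos)
  have [measurable]: "?f k \<in> borel_measurable P" for k
    using integrable_sym_ent[OF v] by (rule borel_measurable_integrable)
  have "(\<integral>\<^sup>+\<sigma>. (\<Sum>k. ennreal (?f k \<sigma>)) \<partial>P) = (\<Sum>k. \<integral>\<^sup>+\<sigma>. ennreal (?f k \<sigma>) \<partial>P)"
    by (rule nn_integral_suminf) measurable
  also have "\<dots> = (\<Sum>k. ennreal (mean_ent (Suc k) v))"
    unfolding mean_ent_def
    by (intro suminf_cong nn_integral_eq_integral integrable_sym_ent v AE_I2 nonneg)
  also have "\<dots> \<noteq> \<infinity>"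
    using summable_mean_ent[OF v summable] mean_ent_nonneg
    by (simp add: suminf_ennreal2)
  finally have "AE \<sigma> in P. (\<Sum>k. ennreal (?f k \<sigma>)) \<noteq> \<infinity>"
    by (intro nn_integral_noteq_infinite) auto
  then show ?thesis
  proof eventually_elim
    case (elim \<sigma>)
    then have "summable (\<lambda>k. ?f k \<sigma>)"
      by (intro summable_suminf_not_top nonneg) simp
    then show ?case by (rule summable_LIMSEQ_zero)
  qed
qed

lemma AE_likelihood_ratio_tendsto_1:
  assumes v: "v \<in> T" and summable: "summable (\<lambda>n. c ^ n * card (level n))"
  shows "AE \<sigma> in P. \<forall>i. (\<lambda>k. lik (Suc k) \<sigma> v i / evidence (Suc k) \<sigma> v) \<longlonglongrightarrow> 1"
  using AE_sym_ent_tendsto_0[OF assms]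
proof eventually_elim
  case (elim \<sigma>)
  show ?case
  proof
    fix i
    have "(\<lambda>k. (posterior (Suc k) \<sigma> v $ i - \<alpha> $ i)\<^sup>2) \<longlonglongrightarrow> 0"
      using elim
      by (rule tendsto_sandwich[OF _ _ tendsto_const, rotated 2])
         (auto intro!: always_eventually square_le_sym_ent posterior_simplex posterior_pos)
    then have "(\<lambda>k. posterior (Suc k) \<sigma> v $ i - \<alpha> $ i) \<longlonglongrightarrow> 0"
      by simp
    then have "(\<lambda>k. posterior (Suc k) \<sigma> v $ i / \<alpha> $ i) \<longlonglongrightarrow> \<alpha> $ i / \<alpha> $ i"
      using alpha_pos[of i] by (intro tendsto_divide tendsto_const) (auto dest: LIM_zero_cancel)
    then show "(\<lambda>k. lik (Suc k) \<sigma> v i / evidence (Suc k) \<sigma> v) \<longlonglongrightarrow> 1"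
      using alpha_pos[of i] by (simp add: posterior_def less_imp_neq[THEN not_sym])
  qed
qed

end

section \<open>Gibbs measures\<close>

lemma prod_of_bool: "finite V \<Longrightarrow> (\<Prod>v\<in>V. of_bool (Q v)) = (of_bool (\<forall>v\<in>V. Q v) :: real)"
  by (induction V rule: finite_induct) auto

lemma subalgebra_spin_algebra:
  assumes "W \<subseteq> T" "sets \<mu> = sets (config_space T)"
  shows "subalgebra \<mu> (spin_algebra W \<mu>)"
proof -
  have "(\<lambda>\<sigma>. restrict \<sigma> W) \<in> measurable \<mu> (config_space W)"
    using measurable_restrict_config[OF assms(1)] by (simp add: measurable_cong_sets[OF assms(2) refl])
  then show ?thesis
    unfolding subalgebra_def spin_algebra_def by (simp add: sets_image_in_sets)
qed

lemma measurable_spin_algebra_local: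
  fixes f :: "(vertex \<Rightarrow> 'q::finite) \<Rightarrow> real"
  assumes "finite J" "J \<subseteq> W" "W \<subseteq> T" "depends_on J f" and \<mu>: "sets \<mu> = sets (config_space T)"
  shows "f \<in> borel_measurable (spin_algebra W \<mu>)"
proof -
  have sp: "space \<mu> = (T \<rightarrow>\<^sub>E UNIV)"
    using sets_eq_imp_space_eq[OF \<mu>] by (simp add: space_config_space)
  have "(\<lambda>\<sigma>. restrict \<sigma> W) \<in> measurable (spin_algebra W \<mu>) (config_space W)"
    unfolding spin_algebra_def using assms(3)
    by (intro measurable_vimage_algebra1) (auto simp: sp space_config_space)
  moreover have "f \<in> borel_measurable (config_space W)"
    by (rule measurable_local[OF assms(1,2,4)]) auto
  ultimately have "(\<lambda>\<sigma>. f (restrict \<sigma> W)) \<in> borel_measurable (spin_algebra W \<mu>)"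
    by (rule measurable_compose)
  then show ?thesis
    by (simp add: depends_on_restrict[OF depends_on_mono[OF assms(4,2)]])
qed

text \<open>Splits a local event into patterns on \<open>V\<close>, the events for which the Gibbs
  condition is formulated. The event \<open>R\<close> carries an observation that is conditioned
  on.\<close>

lemma integral_expand_local:
  fixes G R :: "(vertex \<Rightarrow> 'q::finite) \<Rightarrow> bool"
  assumes V: "finite V" "V \<subseteq> T" and G: "depends_on V G"
    and R: "finite B" "B \<subseteq> T" "depends_on B R"
    and \<mu>: "sets \<mu> = sets (config_space T)" "finite_measure \<mu>"
  shows "(\<integral>\<sigma>. of_bool (G \<sigma> \<and> R \<sigma>) \<partial>\<mu>) =
    (\<Sum>\<eta>\<in>V \<rightarrow>\<^sub>E UNIV. of_bool (G \<eta>) * (\<integral>\<sigma>. of_bool ((\<forall>v\<in>V. \<sigma> v = \<eta> v) \<and> R \<sigma>) \<partial>\<mu>) :: real)"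
proof -
  have *: "of_bool (G \<sigma> \<and> R \<sigma>) =
      (\<Sum>\<eta>\<in>V \<rightarrow>\<^sub>E UNIV. of_bool (G \<eta>) * of_bool ((\<forall>v\<in>V. \<sigma> v = \<eta> v) \<and> R \<sigma>) :: real)" for \<sigma>
    using local_expansion[OF V(1) depends_on_compose[OF G, of "of_bool :: bool \<Rightarrow> real"], of \<sigma>]
    by (simp add: of_bool_conj prod_of_bool[OF V(1)] sum_distrib_right mult.assoc)
  have "depends_on (V \<union> B) (\<lambda>\<sigma>. of_bool ((\<forall>v\<in>V. \<sigma> v = \<eta> v) \<and> R \<sigma>) :: real)" for \<eta>
    by (rule depends_on_compose2[where h = "\<lambda>a b. of_bool (a \<and> b)"])
       (rule depends_on_Ball, simp, rule depends_on_mono[OF R(3)], simp)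
  then have "integrable \<mu> (\<lambda>\<sigma>. of_bool ((\<forall>v\<in>V. \<sigma> v = \<eta> v) \<and> R \<sigma>) :: real)" for \<eta>
    using V R by (intro integrable_local[where W = "V \<union> B", OF _ _ _ \<mu>]) auto
  then show ?thesis
    unfolding * by (subst Bochner_Integration.integral_sum) auto
qed

context rooted_tree
begin

lemma finite_subset_trunc:
  assumes "finite J" "J \<subseteq> T"
  shows "\<exists>N0. \<forall>N\<ge>N0. J \<subseteq> trunc T N"
proof (intro exI allI impI subsetI)
  fix N v assume "Max (length ` J) \<le> N" "v \<in> J"
  moreover have "length v \<le> Max (length ` J)" using assms \<open>v \<in> J\<close> by (intro Max_ge) auto
  ultimately show "v \<in> trunc T N" using assms unfolding trunc_def by (blast intro: le_trans)
qed

lemma finite_boundary: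
  assumes "finite V"
  shows "finite (boundary T V)"
proof (rule finite_subset)
  show "boundary T V \<subseteq> butlast ` V \<union> (\<Union>v\<in>V. children v)"
    by (auto simp: boundary_def children_def child_def image_iff) force
  show "finite (butlast ` V \<union> (\<Union>v\<in>V. children v))"
    using assms finite_children by auto
qed

lemma boundary_subset: "boundary T V \<subseteq> T - V"
  by (auto simp: boundary_def)

end

section \<open>The conditional law given the exterior in explicit form\<close>

context markov_tree
begin

text \<open>Lower ends of the edges with at least one end in \<open>V\<close>: exactly the edges
  whose factors involve a spin in \<open>V\<close>.\<close>

definition touching :: "vertex set \<Rightarrow> vertex set" where
  "touching V = {w \<in> T - {[]}. w \<in> V \<or> butlast w \<in> V}"

definition inner_weight :: "vertex set \<Rightarrow> (vertex \<Rightarrow> 'q) \<Rightarrow> real" where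
  "inner_weight V \<sigma> = (if [] \<in> V then \<alpha> $ \<sigma> [] else 1) *
     (\<Prod>w\<in>touching V. M $ \<sigma> (butlast w) $ \<sigma> w)"

definition outer_weight :: "vertex set \<Rightarrow> nat \<Rightarrow> (vertex \<Rightarrow> 'q) \<Rightarrow> real" where
  "outer_weight V N \<sigma> = (if [] \<in> V then 1 else \<alpha> $ \<sigma> []) *
     (\<Prod>w\<in>trunc T N - {[]} - touching V. M $ \<sigma> (butlast w) $ \<sigma> w)"

text \<open>The conditional probability of the pattern \<open>\<eta>\<close> on \<open>V\<close>
  given \<open>\<xi>\<close> outside: \<open>override_on\<close> inserts a pattern into
  \<open>V\<close> and keeps \<open>\<xi>\<close> elsewhere. No ball radius occurs in it.\<close>

definition gibbs_kernel :: "vertex set \<Rightarrow> (vertex \<Rightarrow> 'q) \<Rightarrow> (vertex \<Rightarrow> 'q) \<Rightarrow> real" where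
  "gibbs_kernel V \<eta> \<xi> = inner_weight V (override_on \<xi> \<eta> V) /
     (\<Sum>\<eta>'\<in>V \<rightarrow>\<^sub>E UNIV. inner_weight V (override_on \<xi> \<eta>' V))"

lemma butlast_child: "w \<noteq> [] \<Longrightarrow> child (butlast w) w"
  by (auto simp: child_def intro!: exI[of _ "last w"])

lemma touching_closed:
  assumes "V \<subseteq> T" "w \<in> touching V"
  shows "w \<in> V \<union> boundary T V" "butlast w \<in> V \<union> boundary T V"
  using assms butlast_child[of w] butlast_in[of w] by (auto simp: touching_def boundary_def)

lemma inner_weight_pos: "inner_weight V \<sigma> > 0"
  unfolding inner_weight_def by (auto intro!: mult_pos_pos prod_pos simp: alpha_pos M_pos)

lemma depends_on_inner_weight:
  assumes "V \<subseteq> T"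
  shows "depends_on (V \<union> boundary T V) (inner_weight V)"
proof (rule depends_onI)
  fix \<sigma> \<sigma>' :: "vertex \<Rightarrow> 'q"
  assume eq: "\<And>v. v \<in> V \<union> boundary T V \<Longrightarrow> \<sigma> v = \<sigma>' v"
  have "M $ \<sigma> (butlast w) $ \<sigma> w = M $ \<sigma>' (butlast w) $ \<sigma>' w" if "w \<in> touching V" for w
    using eq[OF touching_closed(1)[OF assms that]] eq[OF touching_closed(2)[OF assms that]] by simp
  then show "inner_weight V \<sigma> = inner_weight V \<sigma>'"
    using eq[of "[]"] by (auto simp: inner_weight_def intro!: prod.cong)
qed

lemma depends_on_outer_weight:
  "depends_on (trunc T N - V) (outer_weight V N)"
proof (rule depends_onI)
  fix \<sigma> \<sigma>' :: "vertex \<Rightarrow> 'q"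
  assume eq: "\<And>v. v \<in> trunc T N - V \<Longrightarrow> \<sigma> v = \<sigma>' v"
  have "M $ \<sigma> (butlast w) $ \<sigma> w = M $ \<sigma>' (butlast w) $ \<sigma>' w"
    if w: "w \<in> trunc T N - {[]} - touching V" for w
  proof -
    have "w \<in> trunc T N - V" "butlast w \<in> trunc T N - V"
      using w butlast_trunc[of w N] trunc_subset by (auto simp: touching_def)
    then show ?thesis using eq by simp
  qed
  then show "outer_weight V N \<sigma> = outer_weight V N \<sigma>'"
    using eq[of "[]"] root_in by (auto simp: outer_weight_def trunc_def intro!: prod.cong)
qed

text \<open>The spatial Markov property: the first factor sees only \<open>V\<close> and its
  boundary, the second only the part of the ball outside \<open>V\<close>.\<close>

lemma weight_split:
  assumes "V \<subseteq> T" "V \<union> boundary T V \<subseteq> trunc T N"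
  shows "weight N \<sigma> = inner_weight V \<sigma> * outer_weight V N \<sigma>"
proof -
  have sub: "touching V \<subseteq> trunc T N - {[]}"
    using touching_closed(1)[OF assms(1)] assms(2) by (auto simp: touching_def)
  have "(\<Prod>w\<in>trunc T N - {[]}. M $ \<sigma> (butlast w) $ \<sigma> w) =
      (\<Prod>w\<in>trunc T N - {[]} - touching V. M $ \<sigma> (butlast w) $ \<sigma> w) *
      (\<Prod>w\<in>touching V. M $ \<sigma> (butlast w) $ \<sigma> w)"
    by (rule prod.subset_diff[OF sub]) (simp add: finite_trunc)
  then show ?thesis
    by (auto simp: weight_def inner_weight_def outer_weight_def)
qed

lemma gibbs_kernel_pos:
  assumes "finite V"
  shows "(\<Sum>\<eta>'\<in>V \<rightarrow>\<^sub>E UNIV. inner_weight V (override_on \<xi> \<eta>' V)) > 0" "gibbs_kernel V \<eta> \<xi> > 0"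
proof -
  have "V \<rightarrow>\<^sub>E (UNIV :: 'q set) \<noteq> {}" by (simp add: PiE_eq_empty_iff)
  then show *: "(\<Sum>\<eta>'\<in>V \<rightarrow>\<^sub>E UNIV. inner_weight V (override_on \<xi> \<eta>' V)) > 0" for \<xi>
    using assms by (intro sum_pos inner_weight_pos finite_PiE) auto
  then show "gibbs_kernel V \<eta> \<xi> > 0" by (simp add: gibbs_kernel_def inner_weight_pos)
qed

lemma depends_on_gibbs_kernel:
  assumes "V \<subseteq> T"
  shows "depends_on (boundary T V) (gibbs_kernel V \<eta>)"
proof (rule depends_onI)
  fix \<sigma> \<sigma>' :: "vertex \<Rightarrow> 'q"
  assume eq: "\<And>v. v \<in> boundary T V \<Longrightarrow> \<sigma> v = \<sigma>' v"
  have "inner_weight V (override_on \<sigma> \<eta> V) = inner_weight V (override_on \<sigma>' \<eta> V)" for \<eta>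
    by (rule depends_onD[OF depends_on_inner_weight[OF assms]]) (auto simp: override_on_def eq)
  then show "gibbs_kernel V \<eta> \<sigma> = gibbs_kernel V \<eta> \<sigma>'"
    by (simp add: gibbs_kernel_def)
qed

end

context tree_chain_law
begin

text \<open>With the exterior fixed, the outer weight and \<open>F\<close> are constants. Of the sum
  over patterns in \<open>V\<close>, the indicator keeps one inner weight; the kernel is constant in
  these patterns and multiplies their total inner weight, which gives the same value.\<close>

lemma integral_gibbs_kernel:
  fixes F :: "(vertex \<Rightarrow> 'q) \<Rightarrow> real"
  assumes V: "V \<subseteq> T" "V \<union> boundary T V \<subseteq> trunc T N" and F: "depends_on (trunc T N - V) F"
  shows "(\<integral>\<sigma>. of_bool (\<forall>v\<in>V. \<sigma> v = \<eta> v) * F \<sigma> \<partial>P) = (\<integral>\<sigma>. gibbs_kernel V \<eta> \<sigma> * F \<sigma> \<partial>P)"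
proof -
  let ?R = "trunc T N - V"
  let ?S = "\<lambda>h. \<Sum>g\<in>V \<rightarrow>\<^sub>E UNIV. inner_weight V (override_on h g V)"
  have finV: "finite V" using V(2) finite_trunc by (auto intro: finite_subset)
  have un: "V \<union> ?R = trunc T N" using V(2) by auto
  have sum: "(\<integral>\<sigma>. f \<sigma> * F \<sigma> \<partial>P) = (\<Sum>h\<in>?R \<rightarrow>\<^sub>E UNIV. outer_weight V N h * F h *
      (\<Sum>g\<in>V \<rightarrow>\<^sub>E UNIV. inner_weight V (override_on h g V) * f (override_on h g V)))"
    if f: "depends_on (trunc T N) f" for f
  proof -
    have summand: "weight N (merge V ?R (g, h)) * (f (merge V ?R (g, h)) * F (merge V ?R (g, h))) =
        outer_weight V N h * F h * (inner_weight V (override_on h g V) * f (override_on h g V))" for g h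
    proof -
      have on_N: "merge V ?R (g, h) v = override_on h g V v" if "v \<in> trunc T N" for v
        using that V by (auto simp: merge_def override_on_def)
      have on_R: "merge V ?R (g, h) v = h v" if "v \<in> ?R" for v
        using that by (auto simp: merge_def)
      have "f (merge V ?R (g, h)) = f (override_on h g V)"
        by (rule depends_onD[OF f]) (rule on_N)
      moreover have "F (merge V ?R (g, h)) = F h"
        by (rule depends_onD[OF F]) (rule on_R)
      moreover have "outer_weight V N (merge V ?R (g, h)) = outer_weight V N h"
        by (rule depends_onD[OF depends_on_outer_weight]) (rule on_R)
      moreover have "inner_weight V (merge V ?R (g, h)) = inner_weight V (override_on h g V)"
        by (rule depends_onD[OF depends_on_mono[OF depends_on_inner_weight[OF V(1)] V(2)]]) (rule on_N)
      ultimately show ?thesis by (simp add: weight_split[OF V] mult_ac)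
    qed
    have "depends_on (trunc T N) (\<lambda>\<sigma>. f \<sigma> * F \<sigma>)"
      by (rule depends_on_compose2[where h = "(*)", OF f depends_on_mono[OF F]]) auto
    from integral_trunc[OF this]
    have "(\<integral>\<sigma>. f \<sigma> * F \<sigma> \<partial>P) = (\<Sum>\<eta>\<in>V \<union> ?R \<rightarrow>\<^sub>E UNIV. weight N \<eta> * (f \<eta> * F \<eta>))"
      by (simp only: un)
    also have "\<dots> = (\<Sum>g\<in>V \<rightarrow>\<^sub>E UNIV. \<Sum>h\<in>?R \<rightarrow>\<^sub>E UNIV.
        outer_weight V N h * F h * (inner_weight V (override_on h g V) * f (override_on h g V)))"
      by (subst sum_PiE_Un) (auto simp only: summand)
    also have "\<dots> = (\<Sum>h\<in>?R \<rightarrow>\<^sub>E UNIV. \<Sum>g\<in>V \<rightarrow>\<^sub>E UNIV.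
        outer_weight V N h * F h * (inner_weight V (override_on h g V) * f (override_on h g V)))"
      by (rule sum.swap)
    finally show ?thesis by (simp add: sum_distrib_left)
  qed
  have "(\<integral>\<sigma>. of_bool (\<forall>v\<in>V. \<sigma> v = \<eta> v) * F \<sigma> \<partial>P) = (\<Sum>h\<in>?R \<rightarrow>\<^sub>E UNIV. outer_weight V N h * F h *
      (\<Sum>g\<in>V \<rightarrow>\<^sub>E UNIV. inner_weight V (override_on h g V) * of_bool (\<forall>v\<in>V. override_on h g V v = \<eta> v)))"
    using V(2) by (intro sum depends_on_compose[where h = of_bool] depends_on_Ball) auto
  also have "\<dots> = (\<Sum>h\<in>?R \<rightarrow>\<^sub>E UNIV. outer_weight V N h * F h *
      (\<Sum>g\<in>V \<rightarrow>\<^sub>E UNIV. inner_weight V (override_on h g V) * gibbs_kernel V \<eta> (override_on h g V)))"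
  proof (rule sum.cong[OF refl], rule arg_cong2[where f = "(*)", OF refl])
    fix h :: "vertex \<Rightarrow> 'q"
    have "(\<Sum>g\<in>V \<rightarrow>\<^sub>E UNIV. inner_weight V (override_on h g V) * of_bool (\<forall>v\<in>V. override_on h g V v = \<eta> v)) =
        (\<Sum>g\<in>{restrict \<eta> V}. inner_weight V (override_on h g V) * of_bool (\<forall>v\<in>V. override_on h g V v = \<eta> v))"
      using finV
      by (intro sum.mono_neutral_right finite_PiE)
         (auto simp: override_on_def PiE_iff extensional_def fun_eq_iff)
    also have "\<dots> = inner_weight V (override_on h \<eta> V)"
      by (simp add: override_on_def cong: if_cong)
    also have "\<dots> = ?S h * gibbs_kernel V \<eta> h"
      using gibbs_kernel_pos(1)[OF finV, of h] by (simp add: gibbs_kernel_def)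
    also have "\<dots> = (\<Sum>g\<in>V \<rightarrow>\<^sub>E UNIV. inner_weight V (override_on h g V) * gibbs_kernel V \<eta> h)"
      by (rule sum_distrib_right)
    also have "\<dots> = (\<Sum>g\<in>V \<rightarrow>\<^sub>E UNIV. inner_weight V (override_on h g V) * gibbs_kernel V \<eta> (override_on h g V))"
      by (intro sum.cong refl arg_cong2[where f = "(*)"] depends_onD[OF depends_on_gibbs_kernel[OF V(1)]])
         (use boundary_subset in \<open>auto simp: override_on_def\<close>)
    finally show "(\<Sum>g\<in>V \<rightarrow>\<^sub>E UNIV. inner_weight V (override_on h g V) *
        of_bool (\<forall>v\<in>V. override_on h g V v = \<eta> v)) =
        (\<Sum>g\<in>V \<rightarrow>\<^sub>E UNIV. inner_weight V (override_on h g V) * gibbs_kernel V \<eta> (override_on h g V))" .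
  qed
  also have "\<dots> = (\<integral>\<sigma>. gibbs_kernel V \<eta> \<sigma> * F \<sigma> \<partial>P)"
    using V(2) by (intro sum[symmetric] depends_on_mono[OF depends_on_gibbs_kernel[OF V(1)]]) auto
  finally show ?thesis .
qed

lemma integral_of_bool_pos:
  assumes "depends_on (trunc T N) Q" "Q \<xi>"
  shows "(\<integral>\<sigma>. of_bool (Q \<sigma>) \<partial>P) > (0 :: real)"
proof -
  have "(\<Sum>\<eta>\<in>trunc T N \<rightarrow>\<^sub>E UNIV. weight N \<eta> * of_bool (Q \<eta>)) > 0"
    using assms weight_pos finite_trunc
    by (intro sum_pos2[of _ "restrict \<xi> (trunc T N)"] finite_PiE)
       (auto simp: depends_on_restrict[OF assms(1)] less_imp_le)
  then show ?thesis
    using integral_trunc[OF depends_on_compose[OF assms(1), of "of_bool :: bool \<Rightarrow> real"]] by simp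
qed

lemma cond_prob_finite_law:
  assumes "depends_on (trunc T N) G" "depends_on (trunc T N) R"
  shows "\<P>(\<sigma> in finite_law T \<alpha> M N. G \<sigma> \<bar> R \<sigma>) =
    (\<integral>\<sigma>. of_bool (G \<sigma> \<and> R \<sigma>) \<partial>P) / (\<integral>\<sigma>. of_bool (R \<sigma>) \<partial>P)"
  using prob_finite_law[OF depends_on_compose2[where h = "(\<and>)", OF assms]] prob_finite_law[OF assms(2)]
  by (simp add: cond_prob_def)

text \<open>The kernel is constant on the event that the boundary spins agree with
  \<open>\<xi>\<close>, so it equals the quotient. In particular the quotient is the same for all
  \<open>N\<close> whose ball contains \<open>V\<close> and its boundary.\<close>

lemma cond_prob_eq_kernel:
  assumes V: "V \<subseteq> T" "V \<union> boundary T V \<subseteq> trunc T N"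
  shows "\<P>(\<sigma> in finite_law T \<alpha> M N. (\<forall>v\<in>V. \<sigma> v = \<eta> v) \<bar> (\<forall>w\<in>boundary T V. \<sigma> w = \<xi> w)) = gibbs_kernel V \<eta> \<xi>"
proof -
  let ?R = "\<lambda>\<sigma>. \<forall>w\<in>boundary T V. \<sigma> w = \<xi> w"
  have R: "depends_on (trunc T N - V) ?R"
    using V boundary_subset by (intro depends_on_Ball) auto
  have "(\<integral>\<sigma>. (of_bool ((\<forall>v\<in>V. \<sigma> v = \<eta> v) \<and> ?R \<sigma>) :: real) \<partial>P) =
      (\<integral>\<sigma>. of_bool (\<forall>v\<in>V. \<sigma> v = \<eta> v) * of_bool (?R \<sigma>) \<partial>P)"
    by (simp only: of_bool_conj)
  also have "\<dots> = (\<integral>\<sigma>. gibbs_kernel V \<eta> \<sigma> * of_bool (?R \<sigma>) \<partial>P)"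
    by (rule integral_gibbs_kernel[OF V]) (rule depends_on_compose[OF R])
  also have "(\<lambda>\<sigma>. gibbs_kernel V \<eta> \<sigma> * of_bool (?R \<sigma>)) = (\<lambda>\<sigma>. gibbs_kernel V \<eta> \<xi> * of_bool (?R \<sigma>))"
  proof
    fix \<sigma> :: "vertex \<Rightarrow> 'q"
    have "gibbs_kernel V \<eta> \<sigma> = gibbs_kernel V \<eta> \<xi>" if "?R \<sigma>"
      using that by (intro depends_onD[OF depends_on_gibbs_kernel[OF V(1)]]) simp
    then show "gibbs_kernel V \<eta> \<sigma> * of_bool (?R \<sigma>) = gibbs_kernel V \<eta> \<xi> * of_bool (?R \<sigma>)"
      by (cases "?R \<sigma>") simp_all
  qed
  finally have "(\<integral>\<sigma>. of_bool ((\<forall>v\<in>V. \<sigma> v = \<eta> v) \<and> ?R \<sigma>) \<partial>P) =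
      gibbs_kernel V \<eta> \<xi> * (\<integral>\<sigma>. of_bool (?R \<sigma>) \<partial>P)" by simp
  moreover have "(\<integral>\<sigma>. of_bool (?R \<sigma>) \<partial>P) > (0::real)"
    by (rule integral_of_bool_pos[OF depends_on_mono[OF R]]) auto
  moreover have "depends_on (trunc T N) (\<lambda>\<sigma>. \<forall>v\<in>V. \<sigma> v = \<eta> v)"
    using V by (intro depends_on_Ball) auto
  ultimately show ?thesis
    by (subst cond_prob_finite_law[OF _ depends_on_mono[OF R]]) auto
qed

text \<open>Here \<open>A\<close> may depend on infinitely many spins. Weighting the chain by the
  indicator of the pattern or by the kernel gives two finite measures on the exterior
  configurations; they agree on cylinders by \<open>integral_gibbs_kernel\<close>, hence
  everywhere.\<close>

lemma set_integral_gibbs_kernel: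
  assumes V: "finite V" "V \<subseteq> T" and A: "A \<in> sets (spin_algebra (T - V) P)"
  shows "(\<integral>\<sigma>\<in>A. of_bool (\<forall>v\<in>V. \<sigma> v = \<eta> v) \<partial>P) = (\<integral>\<sigma>\<in>A. gibbs_kernel V \<eta> \<sigma> \<partial>P)"
proof -
  let ?r = "\<lambda>\<sigma>. restrict \<sigma> (T - V)" and ?C = "config_space (T - V) :: (vertex \<Rightarrow> 'q) measure"
  have [measurable]: "?r \<in> measurable P ?C"
    using measurable_restrict_config[of "T - V" T] by (simp add: measurable_cong_sets[OF sets_P refl])
  have finb: "finite (V \<union> boundary T V)" using V finite_boundary by simp
  have sub: "V \<union> boundary T V \<subseteq> T" using V boundary_subset by auto
  obtain N0 where N0: "\<And>N. N \<ge> N0 \<Longrightarrow> V \<union> boundary T V \<subseteq> trunc T N"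
    using finite_subset_trunc[OF finb sub] by blast
  define f1 :: "(vertex \<Rightarrow> 'q) \<Rightarrow> real" where "f1 = (\<lambda>\<sigma>. of_bool (\<forall>v\<in>V. \<sigma> v = \<eta> v))"
  define f2 where "f2 = gibbs_kernel V \<eta>"
  have dep: "depends_on (trunc T N0) f1" "depends_on (trunc T N0) f2"
    using N0[OF order_refl] unfolding f1_def f2_def
    by (auto intro!: depends_on_compose[where h = of_bool] depends_on_Ball
        depends_on_mono[OF depends_on_gibbs_kernel[OF V(2)]])
  have nonneg: "f1 \<sigma> \<ge> 0" "f2 \<sigma> \<ge> 0" for \<sigma>
    using gibbs_kernel_pos(2)[OF V(1)] by (auto simp: f1_def f2_def less_imp_le)
  have int: "integrable P f1" "integrable P f2"
    using dep by (auto intro: integrable_trunc)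
  note [measurable] = int[THEN borel_measurable_integrable]
  define \<nu> where "\<nu> f = distr (density P (\<lambda>\<sigma>. ennreal (f \<sigma>))) ?C ?r" for f
  have em: "emeasure (\<nu> f) B = ennreal (\<integral>\<sigma>. indicator (?r -` B \<inter> space P) \<sigma> * f \<sigma> \<partial>P)"
    if [measurable]: "B \<in> sets ?C" "f \<in> borel_measurable P" and f: "integrable P f" "\<And>\<sigma>. f \<sigma> \<ge> 0" for f B
  proof -
    have pre[measurable]: "?r -` B \<inter> space P \<in> sets P" by measurable
    have "emeasure (\<nu> f) B = (\<integral>\<^sup>+\<sigma>. ennreal (f \<sigma>) * indicator (?r -` B \<inter> space P) \<sigma> \<partial>P)"
      unfolding \<nu>_def by (simp add: emeasure_distr emeasure_density)
    also have "\<dots> = (\<integral>\<^sup>+\<sigma>. ennreal (indicator (?r -` B \<inter> space P) \<sigma> * f \<sigma>) \<partial>P)"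
      by (intro nn_integral_cong) (auto simp: indicator_def)
    also have "\<dots> = ennreal (\<integral>\<sigma>. indicator (?r -` B \<inter> space P) \<sigma> * f \<sigma> \<partial>P)"
      using integrable_mult_indicator[OF pre f(1)] f(2)
      by (intro nn_integral_eq_integral) auto
    finally show ?thesis .
  qed
  have cyl: "emeasure (\<nu> f) {\<sigma> \<in> space (\<nu> f). \<forall>v\<in>J. \<sigma> v = \<zeta> v} =
      ennreal (\<integral>\<sigma>. f \<sigma> * of_bool (\<forall>v\<in>J. \<sigma> v = \<zeta> v) \<partial>P)"
    if J: "finite J" "J \<subseteq> T - V" and f: "f \<in> borel_measurable P" "integrable P f" "\<And>\<sigma>. f \<sigma> \<ge> 0" for J \<zeta> f
  proof -
    have "{\<sigma> \<in> space ?C. \<forall>v\<in>J. \<sigma> v = \<zeta> v} \<in> sets ?C"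
      by (rule sets_local[OF J depends_on_Ball]) auto
    moreover have "space (\<nu> f) = space ?C" by (simp add: \<nu>_def)
    moreover have "(\<integral>\<sigma>. indicator (?r -` {\<sigma> \<in> space ?C. \<forall>v\<in>J. \<sigma> v = \<zeta> v} \<inter> space P) \<sigma> * f \<sigma> \<partial>P) =
        (\<integral>\<sigma>. f \<sigma> * of_bool (\<forall>v\<in>J. \<sigma> v = \<zeta> v) \<partial>P)"
      using J by (intro Bochner_Integration.integral_cong)
        (auto simp: indicator_def space_config_space subset_eq)
    ultimately show ?thesis using em f by simp
  qed
  have eq: "\<nu> f1 = \<nu> f2"
  proof (rule config_measure_eqI[where W = "T - V"])
    show "sets (\<nu> f1) = sets ?C" "sets (\<nu> f2) = sets ?C" by (simp_all add: \<nu>_def)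
    show "finite_measure (\<nu> f1)"
      using em[of "space ?C" f1] int nonneg by (intro finite_measureI) (simp add: \<nu>_def)
    fix J and \<zeta> :: "vertex \<Rightarrow> 'q" assume J: "finite J" "J \<subseteq> T - V"
    then obtain N1 where N1: "\<And>N. N \<ge> N1 \<Longrightarrow> J \<subseteq> trunc T N"
      using finite_subset_trunc[of J] by auto
    let ?N = "max N0 N1"
    have "(\<integral>\<sigma>. f1 \<sigma> * of_bool (\<forall>v\<in>J. \<sigma> v = \<zeta> v) \<partial>P) =
        (\<integral>\<sigma>. f2 \<sigma> * of_bool (\<forall>v\<in>J. \<sigma> v = \<zeta> v) \<partial>P)"
      unfolding f1_def f2_def using J N0[of ?N] N1[of ?N]
      by (intro integral_gibbs_kernel[of V ?N] V depends_on_compose[where h = of_bool] depends_on_Ball) auto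
    then show "emeasure (\<nu> f1) {\<sigma> \<in> space (\<nu> f1). \<forall>v\<in>J. \<sigma> v = \<zeta> v} =
        emeasure (\<nu> f2) {\<sigma> \<in> space (\<nu> f2). \<forall>v\<in>J. \<sigma> v = \<zeta> v}"
      using cyl[OF J] int nonneg by simp
  qed
  obtain B where B: "B \<in> sets ?C" "A = ?r -` B \<inter> space P"
  proof -
    have "?r \<in> space P \<rightarrow> space ?C" by (auto simp: space_config_space)
    then show ?thesis using A that unfolding spin_algebra_def by (auto simp: sets_vimage_algebra2)
  qed
  have "ennreal (\<integral>\<sigma>. indicator A \<sigma> * f1 \<sigma> \<partial>P) = emeasure (\<nu> f1) B"
    unfolding B(2) by (rule em[symmetric]) (use B(1) int nonneg in auto)
  also have "\<dots> = ennreal (\<integral>\<sigma>. indicator A \<sigma> * f2 \<sigma> \<partial>P)"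
    unfolding B(2) eq by (rule em) (use B(1) int nonneg in auto)
  finally have "ennreal (\<integral>\<sigma>. indicator A \<sigma> * f1 \<sigma> \<partial>P) = ennreal (\<integral>\<sigma>. indicator A \<sigma> * f2 \<sigma> \<partial>P)" .
  then have "(\<integral>\<sigma>. indicator A \<sigma> * f1 \<sigma> \<partial>P) = (\<integral>\<sigma>. indicator A \<sigma> * f2 \<sigma> \<partial>P)"
    using nonneg by (subst (asm) ennreal_inj) (auto intro!: Bochner_Integration.integral_nonneg)
  then show ?thesis by (simp add: set_lebesgue_integral_def f1_def f2_def)
qed

lemma gibbs_chain: "gibbs T \<alpha> M P"
  unfolding gibbs_def
proof (intro conjI allI impI prob_P sets_P)
  fix V assume V: "finite V \<and> V \<subseteq> T"
  have finb: "finite (V \<union> boundary T V)" using V finite_boundary by simp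
  have sub: "V \<union> boundary T V \<subseteq> T" using V boundary_subset by auto
  obtain N0 where N0: "\<And>N. N \<ge> N0 \<Longrightarrow> V \<union> boundary T V \<subseteq> trunc T N"
    using finite_subset_trunc[OF finb sub] by blast
  have sa: "subalgebra P (spin_algebra (T - V) P)"
    by (rule subalgebra_spin_algebra[OF _ sets_P]) auto
  interpret F: finite_measure_subalgebra P "spin_algebra (T - V) P"
    by standard (rule sa)
  show "\<forall>\<^sub>F N in sequentially. \<forall>\<eta>. AE \<xi> in P.
      real_cond_exp P (spin_algebra (T - V) P) (indicator {\<sigma> \<in> space P. \<forall>v\<in>V. \<sigma> v = \<eta> v}) \<xi> =
      \<P>(\<sigma> in finite_law T \<alpha> M N. (\<forall>v\<in>V. \<sigma> v = \<eta> v) \<bar> (\<forall>w\<in>boundary T V. \<sigma> w = \<xi> w))"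
    unfolding eventually_sequentially
  proof (intro exI allI impI)
    fix N and \<eta> :: "vertex \<Rightarrow> 'q" assume "N0 \<le> N"
    note N = N0[OF this]
    have VT: "V \<subseteq> T" using V by simp
    show "AE \<xi> in P. real_cond_exp P (spin_algebra (T - V) P)
        (indicator {\<sigma> \<in> space P. \<forall>v\<in>V. \<sigma> v = \<eta> v}) \<xi> =
        \<P>(\<sigma> in finite_law T \<alpha> M N. (\<forall>v\<in>V. \<sigma> v = \<eta> v) \<bar> (\<forall>w\<in>boundary T V. \<sigma> w = \<xi> w))"
      unfolding cond_prob_eq_kernel[OF VT N]
    proof (rule F.real_cond_exp_charact)
      fix A assume A: "A \<in> sets (spin_algebra (T - V) P)"
      have "(\<integral>\<sigma>\<in>A. indicat_real {\<sigma> \<in> space P. \<forall>v\<in>V. \<sigma> v = \<eta> v} \<sigma> \<partial>P) =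
          (\<integral>\<sigma>\<in>A. of_bool (\<forall>v\<in>V. \<sigma> v = \<eta> v) \<partial>P)"
        unfolding set_lebesgue_integral_def
        by (intro Bochner_Integration.integral_cong) (auto simp: indicator_def)
      then show "(\<integral>\<sigma>\<in>A. indicat_real {\<sigma> \<in> space P. \<forall>v\<in>V. \<sigma> v = \<eta> v} \<sigma> \<partial>P) =
          (\<integral>\<sigma>\<in>A. gibbs_kernel V \<eta> \<sigma> \<partial>P)"
        using set_integral_gibbs_kernel[OF _ VT A] V by simp
    next
      have "{\<sigma> \<in> space P. \<forall>v\<in>V. \<sigma> v = \<eta> v} \<in> sets P"
        using V by (intro sets_local[OF _ VT depends_on_Ball sets_P]) auto
      then show "integrable P (indicat_real {\<sigma> \<in> space P. \<forall>v\<in>V. \<sigma> v = \<eta> v})"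
        by (intro integrable_real_indicator) (auto simp: P.emeasure_eq_measure)
      show "integrable P (gibbs_kernel V \<eta>)"
        using N by (intro integrable_trunc[of N] depends_on_mono[OF depends_on_gibbs_kernel[OF VT]]) auto
      show "gibbs_kernel V \<eta> \<in> borel_measurable (spin_algebra (T - V) P)"
        using V finite_boundary
        by (intro measurable_spin_algebra_local[OF _ boundary_subset _ depends_on_gibbs_kernel[OF VT] sets_P]) auto
    qed
  qed
qed

end

section \<open>Extremality and non-reconstruction\<close>

context tree_chain_law
begin

text \<open>The conditional probability of \<open>G\<close> under the chain given the spins of
  generation \<open>N\<close>. The denominator is positive for every \<open>\<xi>\<close>, so this
  is one fixed local function that other measures can integrate.\<close>

definition cond_level :: "nat \<Rightarrow> ((vertex \<Rightarrow> 'q) \<Rightarrow> bool) \<Rightarrow> (vertex \<Rightarrow> 'q) \<Rightarrow> real" where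
  "cond_level N G \<xi> = (\<integral>\<sigma>. of_bool (G \<sigma> \<and> (\<forall>w\<in>level N. \<sigma> w = \<xi> w)) \<partial>P) /
     (\<integral>\<sigma>. of_bool (\<forall>w\<in>level N. \<sigma> w = \<xi> w) \<partial>P)"

lemma depends_on_cond_level: "depends_on (level N) (cond_level N G)"
proof (rule depends_onI)
  fix \<sigma> \<sigma>' :: "vertex \<Rightarrow> 'q" assume "\<And>v. v \<in> level N \<Longrightarrow> \<sigma> v = \<sigma>' v"
  then show "cond_level N G \<sigma> = cond_level N G \<sigma>'"
    by (simp add: cond_level_def)
qed

lemma depends_on_level: "depends_on (trunc T N) (\<lambda>\<sigma>. \<forall>w\<in>level N. \<sigma> w = \<xi> w)"
  by (rule depends_on_Ball) (rule level_subset(2)[OF order_refl])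

lemma cond_level_bounds:
  assumes G: "depends_on (trunc T N) G"
  shows "0 \<le> cond_level N G \<xi>" "cond_level N G \<xi> \<le> 1"
proof -
  let ?R = "\<lambda>\<sigma>. \<forall>w\<in>level N. \<sigma> w = \<xi> w"
  have pos: "(\<integral>\<sigma>. of_bool (?R \<sigma>) \<partial>P) > (0::real)"
    by (rule integral_of_bool_pos[OF depends_on_level[of N \<xi>], of \<xi>]) simp
  have "(\<integral>\<sigma>. of_bool (G \<sigma> \<and> ?R \<sigma>) \<partial>P) \<le> (\<integral>\<sigma>. of_bool (?R \<sigma>) \<partial>P :: real)"
    by (intro integral_mono integrable_trunc[of N] depends_on_compose[where h = of_bool] depends_on_level
        depends_on_compose2[where h = "\<lambda>a b. of_bool (a \<and> b)"] G) auto
  with pos show "cond_level N G \<xi> \<le> 1" by (simp add: cond_level_def)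
  show "0 \<le> cond_level N G \<xi>"
    unfolding cond_level_def by (intro divide_nonneg_pos pos Bochner_Integration.integral_nonneg) auto
qed

text \<open>Given the spins up to level \<open>n\<close>, the subtrees hanging below that level are
  independent, so the likelihood of an observation at level \<open>n + k\<close> is a
  product.\<close>

lemma integral_level_lik:
  fixes G :: "(vertex \<Rightarrow> 'q) \<Rightarrow> bool"
  assumes G: "depends_on (trunc T n) G"
  shows "(\<integral>\<sigma>. of_bool (G \<sigma> \<and> (\<forall>w\<in>level (n + k). \<sigma> w = \<xi> w)) \<partial>P) =
    (\<integral>\<sigma>. of_bool (G \<sigma>) * (\<Prod>v\<in>level n. lik k \<xi> v (\<sigma> v)) \<partial>P)"
  using integral_level_add[OF depends_on_compose[OF G, of of_bool],
      where k = k and \<phi> = "\<lambda>w j. of_bool (j = \<xi> w)"]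
  by (simp add: lik_def of_bool_conj prod_of_bool[OF finite_level])

text \<open>Conditioning on a deep generation reweights the spins up to level \<open>n\<close> by
  the product of the likelihoods at level \<open>n\<close>. Dividing each by its evidence changes
  numerator and denominator by the same factor \<open>K k\<close>, and the normalised weights tend
  to 1 inside a finite sum.\<close>

lemma cond_level_tendsto:
  assumes G: "depends_on (trunc T n) G"
    and lim: "\<And>v i. v \<in> level n \<Longrightarrow> (\<lambda>k. lik (Suc k) \<xi> v i / evidence (Suc k) \<xi> v) \<longlonglongrightarrow> 1"
  shows "(\<lambda>k. cond_level (n + Suc k) G \<xi>) \<longlonglongrightarrow> (\<integral>\<sigma>. of_bool (G \<sigma>) \<partial>P)"
proof -
  define r where "r k v i = lik (Suc k) \<xi> v i / evidence (Suc k) \<xi> v" for k v i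
  define I where "I Q k = (\<integral>\<sigma>. of_bool (Q \<sigma>) * (\<Prod>v\<in>level n. r k v (\<sigma> v)) \<partial>P)"
    for Q :: "(vertex \<Rightarrow> 'q) \<Rightarrow> bool" and k
  define K where "K k = (\<Prod>v\<in>level n. evidence (Suc k) \<xi> v)" for k
  have K: "K k > 0" for k unfolding K_def by (intro prod_pos) (simp add: evidence_pos)
  have scale: "(\<integral>\<sigma>. of_bool (Q \<sigma> \<and> (\<forall>w\<in>level (n + Suc k). \<sigma> w = \<xi> w)) \<partial>P) = K k * I Q k"
    if Q: "depends_on (trunc T n) Q" for Q k
  proof -
    have "(\<Prod>v\<in>level n. lik (Suc k) \<xi> v (\<sigma> v)) = K k * (\<Prod>v\<in>level n. r k v (\<sigma> v))" for \<sigma>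
      unfolding K_def r_def prod.distrib[symmetric]
      by (intro prod.cong refl) (simp add: less_imp_neq[OF evidence_pos, THEN not_sym])
    then have "(\<integral>\<sigma>. of_bool (Q \<sigma>) * (\<Prod>v\<in>level n. lik (Suc k) \<xi> v (\<sigma> v)) \<partial>P) =
        (\<integral>\<sigma>. K k * (of_bool (Q \<sigma>) * (\<Prod>v\<in>level n. r k v (\<sigma> v))) \<partial>P)"
      by (simp add: mult_ac)
    then show ?thesis unfolding integral_level_lik[OF Q] I_def by simp
  qed
  have conv: "I Q \<longlonglongrightarrow> (\<integral>\<sigma>. of_bool (Q \<sigma>) \<partial>P)" if Q: "depends_on (trunc T n) Q" for Q
  proof -
    have "depends_on (trunc T n) (\<lambda>\<sigma>. of_bool (Q \<sigma>) * (\<Prod>v\<in>level n. r k v (\<sigma> v)))" for k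
      using level_subset(2)[of n n]
      by (intro depends_on_compose2[where h = "(*)"] depends_on_prod depends_on_coord
          depends_on_compose[where h = of_bool] Q) auto
    from integral_trunc[OF this] have I: "I Q k = (\<Sum>\<eta>\<in>trunc T n \<rightarrow>\<^sub>E UNIV. weight n \<eta> *
        (of_bool (Q \<eta>) * (\<Prod>v\<in>level n. r k v (\<eta> v))))" for k
      unfolding I_def .
    have "I Q \<longlonglongrightarrow> (\<Sum>\<eta>\<in>trunc T n \<rightarrow>\<^sub>E UNIV. weight n \<eta> * (of_bool (Q \<eta>) * (\<Prod>v\<in>level n. 1)))"
      unfolding I r_def by (intro tendsto_intros lim)
    then show ?thesis
      using integral_trunc[OF depends_on_compose[OF Q, of "of_bool :: bool \<Rightarrow> real"]] by simp
  qed
  have "cond_level (n + Suc k) G \<xi> = I G k / I (\<lambda>_. True) k" for k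
    using scale[OF G, of k] scale[OF depends_on_const, of True k] K[of k]
    by (simp add: cond_level_def)
  moreover have "(\<lambda>k. I G k / I (\<lambda>_. True) k) \<longlonglongrightarrow> (\<integral>\<sigma>. of_bool (G \<sigma>) \<partial>P) / (\<integral>\<sigma>. of_bool True \<partial>P)"
    by (intro tendsto_divide conv G depends_on_const) (simp add: P.prob_space)
  ultimately show ?thesis by (simp add: P.prob_space)
qed

text \<open>The Gibbs condition for the ball gives each pattern the conditional probability that the
  chain gives it, and taking expectations removes the conditioning. Summing over the patterns in
  \<open>G\<close> yields the claim.\<close>

lemma gibbs_cond_level:
  assumes \<mu>: "gibbs T \<alpha> M \<mu>" and G: "depends_on (trunc T n) G"
  shows "\<P>(\<sigma> in \<mu>. G \<sigma>) = (\<integral>\<xi>. cond_level (Suc n) G \<xi> \<partial>\<mu>)"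
proof -
  let ?V = "trunc T n"
  have sets: "sets \<mu> = sets (config_space T)" and "prob_space \<mu>"
    using \<mu> by (auto simp: gibbs_def)
  then interpret \<mu>: prob_space \<mu> by simp
  have sa: "subalgebra \<mu> (spin_algebra (T - ?V) \<mu>)"
    by (rule subalgebra_spin_algebra[OF _ sets]) auto
  interpret F: finite_measure_subalgebra \<mu> "spin_algebra (T - ?V) \<mu>"
    by standard (rule sa)
  have "\<forall>\<^sub>F N in sequentially. \<forall>\<eta>. AE \<xi> in \<mu>.
      real_cond_exp \<mu> (spin_algebra (T - ?V) \<mu>) (indicator {\<sigma> \<in> space \<mu>. \<forall>v\<in>?V. \<sigma> v = \<eta> v}) \<xi> =
      \<P>(\<sigma> in finite_law T \<alpha> M N. (\<forall>v\<in>?V. \<sigma> v = \<eta> v) \<bar> (\<forall>w\<in>level (Suc n). \<sigma> w = \<xi> w))"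
    using \<mu> finite_trunc trunc_subset[of n] unfolding gibbs_def by (simp add: boundary_trunc[symmetric])
  then obtain N0 where N0: "\<And>N \<eta>. N \<ge> N0 \<Longrightarrow> AE \<xi> in \<mu>.
      real_cond_exp \<mu> (spin_algebra (T - ?V) \<mu>) (indicator {\<sigma> \<in> space \<mu>. \<forall>v\<in>?V. \<sigma> v = \<eta> v}) \<xi> =
      \<P>(\<sigma> in finite_law T \<alpha> M N. (\<forall>v\<in>?V. \<sigma> v = \<eta> v) \<bar> (\<forall>w\<in>level (Suc n). \<sigma> w = \<xi> w))"
    unfolding eventually_sequentially by blast
  let ?C = "\<lambda>\<eta>. cond_level (Suc n) (\<lambda>\<sigma>. \<forall>v\<in>?V. \<sigma> v = \<eta> v)"
  have level_T: "level (Suc n) \<subseteq> T" by (rule level_subset)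
  have int: "integrable \<mu> (cond_level (Suc n) Q)" for Q
    by (rule integrable_local[OF finite_level level_T depends_on_cond_level sets \<mu>.finite_measure_axioms])
  have cyl: "(\<integral>\<sigma>. of_bool (\<forall>v\<in>?V. \<sigma> v = \<eta> v) \<partial>\<mu>) = (\<integral>\<xi>. ?C \<eta> \<xi> \<partial>\<mu>)" for \<eta>
  proof -
    \<comment> \<open>The radius has to exceed the threshold of the Gibbs condition and the ball
      must contain the boundary generation \<open>Suc n\<close>.\<close>
    let ?N = "max N0 (Suc n)"
    have "\<P>(\<sigma> in finite_law T \<alpha> M ?N. (\<forall>v\<in>?V. \<sigma> v = \<eta> v) \<bar> (\<forall>w\<in>level (Suc n). \<sigma> w = \<xi> w)) = ?C \<eta> \<xi>" for \<xi>
      unfolding cond_level_def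
      using level_subset(2)[of "Suc n" ?N] trunc_mono[of n ?N]
      by (intro cond_prob_finite_law depends_on_Ball) auto
    then have AE: "AE \<xi> in \<mu>. real_cond_exp \<mu> (spin_algebra (T - ?V) \<mu>)
        (indicator {\<sigma> \<in> space \<mu>. \<forall>v\<in>?V. \<sigma> v = \<eta> v}) \<xi> = ?C \<eta> \<xi>"
      using N0[of ?N \<eta>] by simp
    have A: "{\<sigma> \<in> space \<mu>. \<forall>v\<in>?V. \<sigma> v = \<eta> v} \<in> sets \<mu>"
      by (rule sets_local[OF finite_trunc trunc_subset depends_on_Ball[OF order_refl] sets])
    then have intA: "integrable \<mu> (indicat_real {\<sigma> \<in> space \<mu>. \<forall>v\<in>?V. \<sigma> v = \<eta> v})"
      by (intro integrable_real_indicator) (auto simp: \<mu>.emeasure_eq_measure)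
    have "(\<integral>\<sigma>. of_bool (\<forall>v\<in>?V. \<sigma> v = \<eta> v) \<partial>\<mu>) =
        (\<integral>\<sigma>. indicat_real {\<sigma> \<in> space \<mu>. \<forall>v\<in>?V. \<sigma> v = \<eta> v} \<sigma> \<partial>\<mu>)"
      by (intro Bochner_Integration.integral_cong) (auto simp: indicator_def)
    also have "\<dots> = (\<integral>\<xi>. real_cond_exp \<mu> (spin_algebra (T - ?V) \<mu>)
        (indicator {\<sigma> \<in> space \<mu>. \<forall>v\<in>?V. \<sigma> v = \<eta> v}) \<xi> \<partial>\<mu>)"
      by (rule F.real_cond_exp_int(2)[OF intA, symmetric])
    also have "\<dots> = (\<integral>\<xi>. ?C \<eta> \<xi> \<partial>\<mu>)"
      by (rule integral_cong_AE[OF _ _ AE]) (use int in auto)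
    finally show ?thesis .
  qed
  have expand: "cond_level (Suc n) G \<xi> = (\<Sum>\<eta>\<in>?V \<rightarrow>\<^sub>E UNIV. of_bool (G \<eta>) * ?C \<eta> \<xi>)" for \<xi>
    unfolding cond_level_def
    by (subst integral_expand_local[OF finite_trunc trunc_subset G finite_level level_T depends_on_Ball
          sets_P P.finite_measure_axioms]) (simp_all add: sum_divide_distrib)
  have "\<P>(\<sigma> in \<mu>. G \<sigma>) = (\<integral>\<sigma>. of_bool (G \<sigma> \<and> True) \<partial>\<mu>)"
    using measure_eq_integral_local[OF finite_trunc trunc_subset G sets] by simp
  also have "\<dots> = (\<Sum>\<eta>\<in>?V \<rightarrow>\<^sub>E UNIV. of_bool (G \<eta>) * (\<integral>\<sigma>. of_bool (\<forall>v\<in>?V. \<sigma> v = \<eta> v) \<partial>\<mu>))"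
    using integral_expand_local[OF finite_trunc trunc_subset G finite.emptyI empty_subsetI depends_on_const
        sets \<mu>.finite_measure_axioms, of True] by simp
  also have "\<dots> = (\<integral>\<xi>. (\<Sum>\<eta>\<in>?V \<rightarrow>\<^sub>E UNIV. of_bool (G \<eta>) * ?C \<eta> \<xi>) \<partial>\<mu>)"
    unfolding cyl by (subst Bochner_Integration.integral_sum) (use int in auto)
  finally show ?thesis by (simp only: expand)
qed

end

section \<open>Extremality and non-reconstruction from decay\<close>

context contracting_chain
begin

lemma gibbs_eq_chain:
  assumes summable: "summable (\<lambda>n. c ^ n * card (level n))"
    and \<mu>: "gibbs T \<alpha> M \<mu>" and ac: "absolutely_continuous P \<mu>"
  shows "\<mu> = P"
proof (rule config_measure_eqI)
  show sets: "sets \<mu> = sets (config_space T)" and "sets P = sets (config_space T)"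
    using \<mu> sets_P by (auto simp: gibbs_def)
  interpret \<mu>: prob_space \<mu> using \<mu> by (simp add: gibbs_def)
  show "finite_measure \<mu>" by (rule \<mu>.finite_measure_axioms)
  fix J and \<eta> :: "vertex \<Rightarrow> 'q" assume J: "finite J" "J \<subseteq> T"
  obtain n where "J \<subseteq> trunc T n" using finite_subset_trunc[OF J] by auto
  let ?G = "\<lambda>\<sigma>. \<forall>v\<in>J. \<sigma> v = \<eta> v"
  have G: "depends_on (trunc T n) ?G" by (rule depends_on_Ball) fact
  have "AE \<xi> in P. \<forall>v\<in>level n. \<forall>i. (\<lambda>k. lik (Suc k) \<xi> v i / evidence (Suc k) \<xi> v) \<longlonglongrightarrow> 1"
    using level_subset(1)
    by (intro AE_finite_allI finite_level AE_likelihood_ratio_tendsto_1 summable) auto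
  then have "AE \<xi> in P. (\<lambda>k. cond_level (n + Suc k) ?G \<xi>) \<longlonglongrightarrow> (\<integral>\<sigma>. of_bool (?G \<sigma>) \<partial>P)"
    by eventually_elim (rule cond_level_tendsto[OF G], blast)
  \<comment> \<open>The exceptional set of the convergence is null for the chain; absolute
    continuity makes it null for \<open>\<mu>\<close>.\<close>
  then have AE: "AE \<xi> in \<mu>. (\<lambda>k. cond_level (n + Suc k) ?G \<xi>) \<longlonglongrightarrow> (\<integral>\<sigma>. of_bool (?G \<sigma>) \<partial>P)"
    by (rule absolutely_continuous_AE[OF _ ac, rotated]) (simp add: sets sets_P)
  have G': "depends_on (trunc T N) ?G" if "n \<le> N" for N
    using G trunc_mono[OF that] by (rule depends_on_mono)
  have "(\<lambda>k. \<integral>\<xi>. cond_level (n + Suc k) ?G \<xi> \<partial>\<mu>) \<longlonglongrightarrow> (\<integral>\<xi>. (\<integral>\<sigma>. of_bool (?G \<sigma>) \<partial>P) \<partial>\<mu>)"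
  proof (rule integral_dominated_convergence[where w = "\<lambda>_. 1"])
    show "cond_level (n + Suc k) ?G \<in> borel_measurable \<mu>" for k
      by (rule measurable_local[OF finite_level level_subset(1) depends_on_cond_level _ sets]) simp
    show "AE \<xi> in \<mu>. norm (cond_level (n + Suc k) ?G \<xi>) \<le> 1" for k
      using cond_level_bounds[OF G'[of "n + Suc k"]] by simp
  qed (use AE in auto)
  \<comment> \<open>These integrals do not depend on \<open>k\<close>, so their limit is their
    common value.\<close>
  moreover have "(\<integral>\<xi>. cond_level (n + Suc k) ?G \<xi> \<partial>\<mu>) = \<P>(\<sigma> in \<mu>. ?G \<sigma>)" for k
    using gibbs_cond_level[OF \<mu> G'[of "n + k"]] by simp
  ultimately have "\<P>(\<sigma> in \<mu>. ?G \<sigma>) = (\<integral>\<sigma>. of_bool (?G \<sigma>) \<partial>P)"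
    by (simp add: LIMSEQ_const_iff \<mu>.prob_space)
  then show "emeasure \<mu> {\<sigma> \<in> space \<mu>. ?G \<sigma>} = emeasure P {\<sigma> \<in> space P. ?G \<sigma>}"
    using prob_eq_integral[OF G] by (simp add: \<mu>.emeasure_eq_measure P.emeasure_eq_measure)
qed

text \<open>As \<open>0 < t < 1\<close>, both components of a decomposition vanish on null sets of
  the chain, so \<open>gibbs_eq_chain\<close> identifies each of them with it.\<close>

lemma extremal_chain:
  assumes summable: "summable (\<lambda>n. c ^ n * card (level n))"
  shows "extremal_gibbs T \<alpha> M P"
  unfolding extremal_gibbs_def
proof (intro conjI gibbs_chain allI impI)
  fix \<mu>1 \<mu>2 :: "(vertex \<Rightarrow> 'q) measure" and t :: real
  assume *: "gibbs T \<alpha> M \<mu>1 \<and> gibbs T \<alpha> M \<mu>2 \<and> 0 < t \<and> t < 1 \<and>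
    (\<forall>A\<in>sets (config_space T). measure P A = (1 - t) * measure \<mu>1 A + t * measure \<mu>2 A)"
  then have sets: "sets \<mu>1 = sets (config_space T)" "sets \<mu>2 = sets (config_space T)"
    and "prob_space \<mu>1" "prob_space \<mu>2"
    by (auto simp: gibbs_def)
  interpret \<mu>1: prob_space \<mu>1 by fact
  interpret \<mu>2: prob_space \<mu>2 by fact
  have "A \<in> null_sets \<mu>1 \<and> A \<in> null_sets \<mu>2" if A: "A \<in> null_sets P" for A
  proof -
    have AT: "A \<in> sets (config_space T)" using A sets_P by auto
    have "measure P A = 0" using A by (simp add: null_sets_def measure_def)
    moreover have "(1 - t) * measure \<mu>1 A \<ge> 0" "t * measure \<mu>2 A \<ge> 0" using * by auto
    moreover have "measure P A = (1 - t) * measure \<mu>1 A + t * measure \<mu>2 A" using * AT by blast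
    ultimately have "(1 - t) * measure \<mu>1 A = 0 \<and> t * measure \<mu>2 A = 0" by linarith
    then have "measure \<mu>1 A = 0" "measure \<mu>2 A = 0" using * by auto
    then show ?thesis
      using AT sets by (auto simp: null_sets_def \<mu>1.emeasure_eq_measure \<mu>2.emeasure_eq_measure)
  qed
  then have "absolutely_continuous P \<mu>1" "absolutely_continuous P \<mu>2"
    by (auto simp: absolutely_continuous_def)
  then show "\<mu>1 = \<mu>2"
    using gibbs_eq_chain[OF summable] * by metis
qed

text \<open>The conditional law in question is the posterior at the root, and Chebyshev's inequality
  bounds the probability of a deviation by \<open>mean_ent\<close> over
  \<open>\<epsilon>\<^sup>2\<close>. The bound holds from generation 1 on, which suffices for the
  limit.\<close>

lemma no_reconstruction_chain:
  assumes summable: "summable (\<lambda>n. c ^ n * card (level n))"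
  shows "no_reconstruction T \<alpha> P"
  unfolding no_reconstruction_def
proof (intro allI impI)
  fix s :: 'q and \<epsilon> :: real assume \<epsilon>: "\<epsilon> > 0"
  have desc_root: "desc [] N = level N" for N
    by (auto simp: desc_def level_def)
  have cond: "\<P>(\<sigma> in P. \<sigma> [] = s \<bar> (\<forall>w\<in>T. length w = N \<longrightarrow> \<sigma> w = \<xi> w)) = posterior N \<xi> [] $ s" for N \<xi>
  proof -
    let ?R = "\<lambda>\<sigma>. \<forall>w\<in>level N. \<sigma> w = \<xi> w"
    have R: "(\<forall>w\<in>T. length w = N \<longrightarrow> \<sigma> w = \<xi> w) = ?R \<sigma>" for \<sigma>
      by (auto simp: level_def)
    have root: "depends_on (trunc T N) (\<lambda>\<sigma>. \<sigma> [] = s)"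
      using root_in by (intro depends_on_coord) (auto simp: trunc_def)
    have int: "(\<integral>\<sigma>. h (\<sigma> []) * of_bool (?R \<sigma>) \<partial>P) = (\<Sum>i\<in>UNIV. \<alpha> $ i * (h i * lik N \<xi> [] i))" for h
      using integral_desc[OF root_in, where h = h and k = N and \<phi> = "\<lambda>w j. of_bool (j = \<xi> w)"]
      by (simp add: desc_root lik_def prod_of_bool[OF finite_level])
    have "\<P>(\<sigma> in P. \<sigma> [] = s \<and> ?R \<sigma>) = (\<Sum>i\<in>UNIV. \<alpha> $ i * (of_bool (i = s) * lik N \<xi> [] i))"
      using prob_eq_integral[OF depends_on_compose2[where h = "(\<and>)", OF root depends_on_level[of N \<xi>]]]
        int[of "\<lambda>i. of_bool (i = s)"]
      by (simp only: of_bool_conj)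
    also have "\<dots> = (\<Sum>i\<in>{s}. \<alpha> $ i * (of_bool (i = s) * lik N \<xi> [] i))"
      by (rule sum.mono_neutral_right) auto
    also have "\<dots> = \<alpha> $ s * lik N \<xi> [] s" by simp
    finally have "\<P>(\<sigma> in P. \<sigma> [] = s \<and> ?R \<sigma>) = \<alpha> $ s * lik N \<xi> [] s" .
    moreover have "\<P>(\<sigma> in P. ?R \<sigma>) = evidence N \<xi> []"
      using prob_eq_integral[OF depends_on_level[of N \<xi>]] int[of "\<lambda>_. 1"] by (simp add: evidence_def)
    ultimately show ?thesis
      by (simp add: cond_prob_def R posterior_def)
  qed
  have dep: "depends_on (trunc T N) (\<lambda>\<xi>. posterior N \<xi> [])" for N
    by (rule depends_on_mono[OF depends_on_posterior[OF root_in] desc_subset_trunc]) simp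
  have bound: "\<P>(\<xi> in P. \<epsilon> \<le> \<bar>posterior (Suc k) \<xi> [] $ s - \<alpha> $ s\<bar>) \<le> mean_ent (Suc k) [] / \<epsilon>\<^sup>2" for k
  proof -
    have "\<P>(\<xi> in P. \<epsilon> \<le> \<bar>posterior (Suc k) \<xi> [] $ s - \<alpha> $ s\<bar>) =
        (\<integral>\<xi>. of_bool (\<epsilon> \<le> \<bar>posterior (Suc k) \<xi> [] $ s - \<alpha> $ s\<bar>) \<partial>P)"
      by (rule prob_eq_integral[OF depends_on_compose[OF dep, where h = "\<lambda>p. \<epsilon> \<le> \<bar>p $ s - \<alpha> $ s\<bar>"]])
    also have "\<dots> \<le> (\<integral>\<xi>. sym_ent (posterior (Suc k) \<xi> []) / \<epsilon>\<^sup>2 \<partial>P)"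
    proof (rule integral_mono)
      show "integrable P (\<lambda>\<xi>. of_bool (\<epsilon> \<le> \<bar>posterior (Suc k) \<xi> [] $ s - \<alpha> $ s\<bar>) :: real)"
        by (rule integrable_trunc[OF depends_on_compose[OF dep, where h = "\<lambda>p. of_bool (\<epsilon> \<le> \<bar>p $ s - \<alpha> $ s\<bar>)"]])
      show "integrable P (\<lambda>\<xi>. sym_ent (posterior (Suc k) \<xi> []) / \<epsilon>\<^sup>2)"
        by (intro integrable_divide integrable_sym_ent root_in)
      fix \<xi>
      let ?d = "posterior (Suc k) \<xi> [] $ s - \<alpha> $ s"
      \<comment> \<open>Chebyshev's inequality pointwise: the indicator is at most the squared
        deviation over \<open>\<epsilon>\<^sup>2\<close>.\<close>
      have "of_bool (\<epsilon> \<le> \<bar>?d\<bar>) \<le> ?d\<^sup>2 / \<epsilon>\<^sup>2"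
        using \<epsilon> power_mono[of \<epsilon> "\<bar>?d\<bar>" 2] by auto
      also have "\<dots> \<le> sym_ent (posterior (Suc k) \<xi> []) / \<epsilon>\<^sup>2"
        by (intro divide_right_mono square_le_sym_ent posterior_simplex posterior_pos) simp
      finally show "of_bool (\<epsilon> \<le> \<bar>?d\<bar>) \<le> sym_ent (posterior (Suc k) \<xi> []) / \<epsilon>\<^sup>2" .
    qed
    finally show ?thesis by (simp add: mean_ent_def)
  qed
  have "(\<lambda>k. mean_ent (Suc k) [] / \<epsilon>\<^sup>2) \<longlonglongrightarrow> 0 / \<epsilon>\<^sup>2"
    using \<epsilon> by (intro tendsto_divide tendsto_const summable_LIMSEQ_zero summable_mean_ent root_in summable) auto
  then have lim: "(\<lambda>k. mean_ent (Suc k) [] / \<epsilon>\<^sup>2) \<longlonglongrightarrow> 0" by simp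
  have "(\<lambda>k. \<P>(\<xi> in P. \<epsilon> \<le> \<bar>posterior (Suc k) \<xi> [] $ s - \<alpha> $ s\<bar>)) \<longlonglongrightarrow> 0"
  proof (rule tendsto_sandwich[OF _ _ tendsto_const lim])
    show "\<forall>\<^sub>F k in sequentially. 0 \<le> \<P>(\<xi> in P. \<epsilon> \<le> \<bar>posterior (Suc k) \<xi> [] $ s - \<alpha> $ s\<bar>)"
      by simp
    show "\<forall>\<^sub>F k in sequentially.
        \<P>(\<xi> in P. \<epsilon> \<le> \<bar>posterior (Suc k) \<xi> [] $ s - \<alpha> $ s\<bar>) \<le> mean_ent (Suc k) [] / \<epsilon>\<^sup>2"
      by (rule always_eventually) (rule allI, rule bound)
  qed
  then show "(\<lambda>N. \<P>(\<xi> in P. \<epsilon> \<le> \<bar>\<P>(\<sigma> in P. \<sigma> [] = s \<bar> (\<forall>w\<in>T. length w = N \<longrightarrow> \<sigma> w = \<xi> w)) - \<alpha> $ s\<bar>))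
      \<longlonglongrightarrow> 0"
    unfolding cond by (rule LIMSEQ_imp_Suc)
qed

end

section \<open>Existence and uniqueness of the chain\<close>

text \<open>The chain is realised by independent random maps at the vertices: the map at \<open>w\<close> sends the
  spin of the parent of \<open>w\<close> to the spin of \<open>w\<close>; the map at the root is constant.\<close>

fun rev_spin :: "(vertex \<Rightarrow> 'q \<Rightarrow> 'q) \<Rightarrow> nat list \<Rightarrow> 'q" where
  "rev_spin F [] = F [] undefined"
| "rev_spin F (i # u) = F (rev (i # u)) (rev_spin F u)"

text \<open>Vertices grow at the end of the list, so the recursion runs on the reversed path. The
  root map is applied to \<open>undefined\<close> as a dummy parent spin; its law
  \<open>map_law []\<close> charges only constant maps.\<close>

definition spin :: "(vertex \<Rightarrow> 'q \<Rightarrow> 'q) \<Rightarrow> vertex \<Rightarrow> 'q" where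
  "spin F v = rev_spin F (rev v)"

lemma spin_Nil: "spin F [] = F [] undefined"
  by (simp add: spin_def)

lemma spin_snoc: "spin F (v @ [i]) = F (v @ [i]) (spin F v)"
  by (simp add: spin_def)

lemma spin_butlast: "w \<noteq> [] \<Longrightarrow> spin F w = F w (spin F (butlast w))"
  by (cases w rule: rev_cases) (simp_all add: spin_snoc)

context markov_tree
begin

text \<open>Below the root the values of the map at different parent spins are drawn independently,
  each from its row of \<open>M\<close>. A single value is read off along any path, so only these
  one-argument laws matter for the chain.\<close>

definition map_law :: "vertex \<Rightarrow> ('q \<Rightarrow> 'q) pmf" where
  "map_law v = (if v = [] then map_pmf (\<lambda>j _. j) (embed_pmf (\<lambda>j. \<alpha> $ j))
     else Pi_pmf UNIV undefined (\<lambda>i. embed_pmf (\<lambda>j. M $ i $ j)))"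

lemma pmf_root: "pmf (embed_pmf (\<lambda>j. \<alpha> $ j)) j = \<alpha> $ j"
  by (rule pmf_embed_pmf)
     (auto simp: nn_integral_count_space_finite sum_ennreal alpha_sum less_imp_le[OF alpha_pos])

lemma pmf_transition: "pmf (embed_pmf (\<lambda>j. M $ i $ j)) j = M $ i $ j"
  by (rule pmf_embed_pmf)
     (auto simp: nn_integral_count_space_finite sum_ennreal M_stoch less_imp_le[OF M_pos])

lemma emeasure_map_law_root: "emeasure (map_law []) {f. f i = j} = \<alpha> $ j"
proof -
  have "(\<lambda>j _. j) -` {f :: 'q \<Rightarrow> 'q. f i = j} = {j}" by auto
  then show ?thesis
    by (simp add: map_law_def emeasure_pmf_single pmf_root)
qed

lemma emeasure_map_law: "w \<noteq> [] \<Longrightarrow> emeasure (map_law w) {f. f i = j} = M $ i $ j"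
proof -
  assume w: "w \<noteq> []"
  have "emeasure (map_law w) {f. f i = j} = emeasure (map_pmf (\<lambda>f. f i) (map_law w)) {j}"
    by (simp add: vimage_def)
  also have "map_pmf (\<lambda>f. f i) (map_law w) = embed_pmf (\<lambda>j. M $ i $ j)"
    using w by (simp add: map_law_def Pi_pmf_component)
  finally show ?thesis by (simp add: emeasure_pmf_single pmf_transition)
qed

definition map_space :: "(vertex \<Rightarrow> 'q \<Rightarrow> 'q) measure" where
  "map_space = (\<Pi>\<^sub>M v\<in>UNIV. measure_pmf (map_law v))"

lemma measurable_component_map_space:
  "(\<lambda>F. F w i) \<in> measurable map_space (count_space UNIV)"
proof -
  have "(\<lambda>F. F w) \<in> measurable map_space (measure_pmf (map_law w))"
    unfolding map_space_def by (rule measurable_component_singleton) simp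
  then show ?thesis by (rule measurable_compose) simp
qed

lemma measurable_spin: "(\<lambda>F. spin F v) \<in> measurable map_space (count_space UNIV)"
proof (induction v rule: rev_induct)
  case Nil
  then show ?case by (simp add: spin_Nil measurable_component_map_space)
next
  case (snoc i v)
  have "countable (UNIV :: 'q set)" by (rule countable_finite) simp
  with measurable_compose_countable'[of UNIV "\<lambda>j F. F (v @ [i]) j", OF measurable_component_map_space snoc]
  show ?case by (simp add: spin_snoc)
qed

definition spin_law :: "(vertex \<Rightarrow> 'q) measure" where
  "spin_law = distr map_space (config_space T) (\<lambda>F. restrict (spin F) T)"

lemma measurable_restrict_spin: "(\<lambda>F. restrict (spin F) T) \<in> measurable map_space (config_space T)"
  unfolding config_space_def by (rule measurable_restrict) (rule measurable_spin)

lemma is_tree_chain_spin_law: "is_tree_chain T \<alpha> M spin_law"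
  unfolding is_tree_chain_def
proof (intro conjI allI)
  interpret B: product_prob_space "\<lambda>v. measure_pmf (map_law v)" UNIV
    by (rule product_prob_spaceI) (rule prob_space_measure_pmf)
  have "prob_space map_space" unfolding map_space_def by (rule B.P.prob_space_axioms)
  then show "prob_space spin_law"
    unfolding spin_law_def by (rule prob_space.prob_space_distr) (rule measurable_restrict_spin)
  show sets: "sets spin_law = sets (config_space T)" by (simp add: spin_law_def)
  fix N
  let ?A = "trunc T N \<rightarrow>\<^sub>E (UNIV :: 'q set)"
  have fin: "finite ?A" by (intro finite_PiE finite_trunc) auto
  have meas: "(\<lambda>\<sigma>. restrict \<sigma> (trunc T N)) \<in> measurable spin_law (count_space ?A)"
    using measurable_restrict_config[OF trunc_subset[of N]]
    by (simp add: config_space_finite[OF finite_trunc] measurable_cong_sets[OF sets refl])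
  show "distr spin_law (count_space ?A) (\<lambda>\<sigma>. restrict \<sigma> (trunc T N)) = finite_law T \<alpha> M N"
  proof (rule measure_eqI_finite[of _ ?A])
    fix \<eta> assume \<eta>: "\<eta> \<in> ?A"
    \<comment> \<open>The maps that send the prescribed spin of the parent to the prescribed spin at
      \<open>v\<close>. They turn the recursive event \<open>spin F = \<eta>\<close> on the ball
      into a box, whose probability is a product.\<close>
    define X where "X v = (if v = [] then {f. f undefined = \<eta> []} else {f. f (\<eta> (butlast v)) = \<eta> v})" for v
    have spin_iff: "(\<forall>v\<in>trunc T N. spin F v = \<eta> v) \<longleftrightarrow> (\<forall>v\<in>trunc T N. F v \<in> X v)" for F
    proof
      assume *: "\<forall>v\<in>trunc T N. spin F v = \<eta> v"
      show "\<forall>v\<in>trunc T N. F v \<in> X v"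
      proof
        fix v assume v: "v \<in> trunc T N"
        then show "F v \<in> X v"
          using * butlast_trunc[OF v] spin_butlast[of v F] by (auto simp: X_def spin_Nil)
      qed
    next
      assume *: "\<forall>v\<in>trunc T N. F v \<in> X v"
      have "v \<in> trunc T N \<Longrightarrow> spin F v = \<eta> v" for v
      proof (induction v rule: rev_induct)
        case Nil
        then show ?case using * by (auto simp: X_def spin_Nil)
      next
        case (snoc i v)
        then have "v \<in> trunc T N" using butlast_trunc[of "v @ [i]" N] by simp
        then show ?case using snoc * by (force simp: X_def spin_snoc)
      qed
      then show "\<forall>v\<in>trunc T N. spin F v = \<eta> v" by blast
    qed
    have pre: "(\<lambda>\<sigma>. restrict \<sigma> (trunc T N)) -` {\<eta>} \<inter> space spin_law =
        {\<sigma> \<in> space spin_law. \<forall>v\<in>trunc T N. \<sigma> v = \<eta> v}"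
      using \<eta> by (auto simp: fun_eq_iff PiE_iff extensional_def)
    have "emeasure (distr spin_law (count_space ?A) (\<lambda>\<sigma>. restrict \<sigma> (trunc T N))) {\<eta>} =
        emeasure spin_law {\<sigma> \<in> space spin_law. \<forall>v\<in>trunc T N. \<sigma> v = \<eta> v}"
      using \<eta> by (simp add: emeasure_distr[OF meas] pre)
    also have "\<dots> = emeasure map_space ((\<lambda>F. restrict (spin F) T) -`
        {\<sigma> \<in> space spin_law. \<forall>v\<in>trunc T N. \<sigma> v = \<eta> v} \<inter> space map_space)"
      using sets_local[OF finite_trunc trunc_subset depends_on_Ball[OF order_refl] sets, of N \<eta>]
      unfolding spin_law_def by (intro emeasure_distr measurable_restrict_spin) simp
    also have "(\<lambda>F. restrict (spin F) T) -` {\<sigma> \<in> space spin_law. \<forall>v\<in>trunc T N. \<sigma> v = \<eta> v} \<inter> space map_space =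
        {F \<in> space map_space. \<forall>v\<in>trunc T N. F v \<in> X v}"
      unfolding spin_iff[symmetric] using trunc_subset[of N]
      by (auto simp: spin_law_def space_config_space subset_eq)
    also have "emeasure map_space \<dots> = (\<Prod>v\<in>trunc T N. emeasure (map_law v) (X v))"
      unfolding map_space_def by (rule B.emeasure_PiM_Collect) (auto simp: finite_trunc)
    also have "\<dots> = emeasure (map_law []) (X []) * (\<Prod>v\<in>trunc T N - {[]}. emeasure (map_law v) (X v))"
      using root_in by (intro prod.remove finite_trunc) (simp add: trunc_def)
    also have "(\<Prod>v\<in>trunc T N - {[]}. emeasure (map_law v) (X v)) =
        (\<Prod>v\<in>trunc T N - {[]}. ennreal (M $ \<eta> (butlast v) $ \<eta> v))"
      by (intro prod.cong refl) (simp add: X_def emeasure_map_law)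
    also have "\<dots> = ennreal (\<Prod>v\<in>trunc T N - {[]}. M $ \<eta> (butlast v) $ \<eta> v)"
      by (intro prod_ennreal) (simp add: M_pos less_imp_le)
    also have "emeasure (map_law []) (X []) = ennreal (\<alpha> $ \<eta> [])"
      by (simp add: X_def emeasure_map_law_root)
    also have "ennreal (\<alpha> $ \<eta> []) * ennreal (\<Prod>v\<in>trunc T N - {[]}. M $ \<eta> (butlast v) $ \<eta> v) =
        ennreal (weight N \<eta>)"
      unfolding weight_def
      by (rule ennreal_mult[symmetric]) (auto intro!: prod_nonneg simp: less_imp_le[OF alpha_pos] less_imp_le[OF M_pos])
    also have "\<dots> = emeasure (finite_law T \<alpha> M N) {\<eta>}"
      unfolding finite_law_eq using \<eta> fin by (subst emeasure_point_measure_finite) auto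
    finally show "emeasure (distr spin_law (count_space ?A) (\<lambda>\<sigma>. restrict \<sigma> (trunc T N))) {\<eta>} =
        emeasure (finite_law T \<alpha> M N) {\<eta>}" .
  qed (auto simp: fin finite_law_eq sets_point_measure)
qed

lemma is_tree_chain_unique:
  assumes "is_tree_chain T \<alpha> M P" "is_tree_chain T \<alpha> M P'"
  shows "P = P'"
proof -
  interpret P: tree_chain_law T M \<alpha> P by standard fact
  interpret P': tree_chain_law T M \<alpha> P' by standard fact
  show ?thesis
  proof (rule config_measure_eqI[OF P.P.finite_measure_axioms P.sets_P P'.sets_P])
    fix J and \<eta> :: "vertex \<Rightarrow> 'q" assume J: "finite J" "J \<subseteq> T"
    obtain N where "J \<subseteq> trunc T N" using finite_subset_trunc[OF J] by auto
    then have Q: "depends_on (trunc T N) (\<lambda>\<sigma>. \<forall>v\<in>J. \<sigma> v = \<eta> v)" by (rule depends_on_Ball)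
    note Q' = depends_on_compose[OF Q, of "of_bool :: bool \<Rightarrow> real"]
    have "\<P>(\<sigma> in P. \<forall>v\<in>J. \<sigma> v = \<eta> v) = \<P>(\<sigma> in P'. \<forall>v\<in>J. \<sigma> v = \<eta> v)"
      unfolding P.prob_eq_integral[OF Q] P'.prob_eq_integral[OF Q]
        P.integral_trunc[OF Q'] P'.integral_trunc[OF Q'] ..
    then show "emeasure P {\<sigma> \<in> space P. \<forall>v\<in>J. \<sigma> v = \<eta> v} = emeasure P' {\<sigma> \<in> space P'. \<forall>v\<in>J. \<sigma> v = \<eta> v}"
      by (simp add: P.P.emeasure_eq_measure P'.P.emeasure_eq_measure)
  qed
qed

lemma is_tree_chain_tree_chain: "is_tree_chain T \<alpha> M (tree_chain T \<alpha> M)"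
  unfolding tree_chain_def
  by (rule theI[where a = spin_law])
     (rule is_tree_chain_spin_law, rule is_tree_chain_unique[OF _ is_tree_chain_spin_law])

end

section \<open>The contraction constant\<close>

context markov_tree
begin

lemma sym_entropy_eq:
  assumes p: "\<And>i. p $ i > 0"
  shows "sym_entropy \<alpha> p = ereal (sym_ent p)"
proof -
  have nz: "\<alpha> $ i \<noteq> 0" "p $ i \<noteq> 0" for i
    using alpha_pos[of i] p[of i] by auto
  have "(p $ i - \<alpha> $ i) * ln (p $ i / \<alpha> $ i) =
      p $ i * ln (p $ i / \<alpha> $ i) + \<alpha> $ i * ln (\<alpha> $ i / p $ i)" for i
    using p[of i] alpha_pos[of i] by (simp add: ln_div algebra_simps)
  then show ?thesis
    by (simp add: sym_entropy_def rel_entropy_def nz sym_ent_def sum.distrib)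
qed

lemma reversed_pos:
  assumes p: "\<And>i. p $ i > 0"
  shows "(p v* reversed \<alpha> M) $ j > 0"
  unfolding vector_matrix_mult_def reversed_def using p alpha_pos M_pos
  by (auto intro!: sum_pos)

lemma alpha_reversed: "\<alpha> v* reversed \<alpha> M = \<alpha>"
  unfolding vector_matrix_mult_def reversed_def vec_eq_iff
  by (simp add: less_imp_neq[OF alpha_pos, THEN not_sym] sum_distrib_left[symmetric] M_stoch)

text \<open>For positive \<open>p\<close> other than \<open>\<alpha>\<close>, \<open>L\<close> is
  finite and strictly positive, so the quotient in the supremum is a real number and can be
  multiplied out.\<close>

lemma contraction_le_imp_contracting:
  assumes c: "contraction \<alpha> M \<le> ereal c" and p: "p \<in> prob_simplex" "\<And>i. p $ i > 0"
  shows "sym_ent (p v* reversed \<alpha> M) \<le> c * sym_ent p"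
proof (cases "p = \<alpha>")
  \<comment> \<open>The supremum excludes \<open>\<alpha>\<close>; both sides vanish there because
    \<open>\<alpha>\<close> is invariant under the reversed chain.\<close>
  case True
  then show ?thesis
    by (simp add: alpha_reversed) (simp add: sym_ent_def)
next
  case False
  then obtain i where "p $ i \<noteq> \<alpha> $ i" by (auto simp: vec_eq_iff)
  then have "0 < (p $ i - \<alpha> $ i)\<^sup>2" by simp
  then have pos: "sym_ent p > 0" using square_le_sym_ent[OF p, of i] by linarith
  have "ereal (sym_ent (p v* reversed \<alpha> M) / sym_ent p) =
      (if sym_entropy \<alpha> p = \<infinity> then 0 else sym_entropy \<alpha> (p v* reversed \<alpha> M) / sym_entropy \<alpha> p)"
    using pos by (simp add: sym_entropy_eq p reversed_pos)
  also have "\<dots> \<le> contraction \<alpha> M"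
    unfolding contraction_def using False p(1) by (intro SUP_upper) auto
  also note c
  finally have "sym_ent (p v* reversed \<alpha> M) / sym_ent p \<le> c" by simp
  then show ?thesis using pos by (simp add: field_simps)
qed

end

section \<open>Galton-Watson trees\<close>

text \<open>Applied with \<open>b v\<close> equal to \<open>c ^ length v\<close> times the
  probability that \<open>v\<close> is in the tree, and \<open>g i\<close> equal to \<open>c\<close>
  times the probability of more than \<open>i\<close> children. It then says that expected
  generation sizes are powers of the mean.\<close>

lemma nn_integral_tree_recursion:
  fixes b :: "nat list \<Rightarrow> ennreal"
  assumes Nil: "b [] = 1" and snoc: "\<And>v i. b (v @ [i]) = b v * g i"
  shows "(\<integral>\<^sup>+v. b v * indicator {v. length v = k} v \<partial>count_space UNIV) =
    (\<integral>\<^sup>+i. g i \<partial>count_space UNIV) ^ k"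
proof (induction k)
  case 0
  have "(\<integral>\<^sup>+v. b v * indicator {v. length v = 0} v \<partial>count_space UNIV) =
      (\<Sum>v\<in>{[]}. b v * indicator {v. length v = 0} v)"
    by (rule nn_integral_count_space') auto
  then show ?case by (simp add: Nil)
next
  case (Suc k)
  let ?f = "\<lambda>v. b v * indicator {v. length v = Suc k} v"
  let ?s = "\<lambda>(v, i). v @ [i]"
  have "(\<integral>\<^sup>+v. ?f v \<partial>count_space UNIV) = (\<integral>\<^sup>+v. ?f v \<partial>count_space (range ?s))"
  proof (rule nn_integral_count_space_eq)
    fix v :: "nat list" assume v: "v \<in> UNIV - range ?s"
    have "v = []"
    proof (rule ccontr)
      assume "v \<noteq> []"
      then have "v = ?s (butlast v, last v)" by simp
      with v show False by blast
    qed
    then show "?f v = 0" by simp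
  qed simp
  also have "\<dots> = (\<integral>\<^sup>+p. ?f (?s p) \<partial>count_space UNIV)"
    by (rule nn_integral_bij_count_space[symmetric], rule inj_on_imp_bij_betw) (auto simp: inj_on_def)
  also have "\<dots> = (\<integral>\<^sup>+v. \<integral>\<^sup>+i. ?f (?s (v, i)) \<partial>count_space UNIV \<partial>count_space UNIV)"
    by (rule nn_integral_fst_count_space[symmetric])
  also have "\<dots> = (\<integral>\<^sup>+v. \<integral>\<^sup>+i. (b v * indicator {v. length v = k} v) * g i \<partial>count_space UNIV \<partial>count_space UNIV)"
    by (intro nn_integral_cong) (auto simp: snoc indicator_def)
  also have "\<dots> = (\<integral>\<^sup>+v. (b v * indicator {v. length v = k} v) * (\<integral>\<^sup>+i. g i \<partial>count_space UNIV) \<partial>count_space UNIV)"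
    by (intro nn_integral_cong nn_integral_cmult) auto
  also have "\<dots> = (\<integral>\<^sup>+v. b v * indicator {v. length v = k} v \<partial>count_space UNIV) * (\<integral>\<^sup>+i. g i \<partial>count_space UNIV)"
    by (intro nn_integral_multc) auto
  finally show ?case by (simp add: Suc mult.commute)
qed

lemma nn_integral_tree_recursion_sum:
  fixes b :: "nat list \<Rightarrow> ennreal"
  assumes "b [] = 1" "\<And>v i. b (v @ [i]) = b v * g i"
  shows "(\<integral>\<^sup>+v. b v \<partial>count_space UNIV) = (\<Sum>k. (\<integral>\<^sup>+i. g i \<partial>count_space UNIV) ^ k)"
proof -
  have "b v = (\<Sum>k. b v * indicator {v. length v = k} v)" for v
  proof -
    have "(\<Sum>k. b v * indicator {v. length v = k} v) = (\<Sum>k\<in>{length v}. b v * indicator {v. length v = k} v)"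
      by (rule suminf_finite) auto
    then show ?thesis by simp
  qed
  then have "(\<integral>\<^sup>+v. b v \<partial>count_space UNIV) =
      (\<integral>\<^sup>+v. (\<Sum>k. b v * indicator {v. length v = k} v) \<partial>count_space UNIV)"
    by simp
  also have "\<dots> = (\<Sum>k. \<integral>\<^sup>+v. b v * indicator {v. length v = k} v \<partial>count_space UNIV)"
    by (rule nn_integral_suminf) auto
  finally show ?thesis by (simp only: nn_integral_tree_recursion[OF assms])
qed

text \<open>The tail formula for the mean: a number \<open>n\<close> is the count of all
  \<open>i < n\<close>. In this coding a vertex present in the tree has the child with index
  \<open>i\<close> exactly if its offspring number exceeds \<open>i\<close>.\<close>

lemma nn_integral_tail_probabilities:
  "(\<integral>\<^sup>+i. emeasure (measure_pmf D) {i<..} \<partial>count_space UNIV) = (\<integral>\<^sup>+n. ennreal (real n) \<partial>measure_pmf D)"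
proof -
  have "(\<integral>\<^sup>+n. ennreal (real n) \<partial>measure_pmf D) = (\<integral>\<^sup>+n. \<integral>\<^sup>+i. indicator {i<..} n \<partial>count_space UNIV \<partial>measure_pmf D)"
  proof (rule nn_integral_cong)
    fix n :: nat
    have "(\<integral>\<^sup>+i. indicator {i<..} n \<partial>count_space UNIV) = (\<Sum>i\<in>{..<n}. indicator {i<..} n :: ennreal)"
      by (rule nn_integral_count_space') auto
    also have "\<dots> = of_nat n" by simp
    finally show "ennreal (real n) = (\<integral>\<^sup>+i. indicator {i<..} n \<partial>count_space UNIV)"
      by (simp add: ennreal_of_nat_eq_real_of_nat)
  qed
  also have "\<dots> = (\<integral>\<^sup>+i. \<integral>\<^sup>+n. indicator {i<..} n \<partial>measure_pmf D \<partial>count_space UNIV)"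
    by (rule nn_integral_count_space_nn_integral) auto
  finally show ?thesis by simp
qed

text \<open>Membership as a box condition on the offspring numbers at the proper prefixes of
  \<open>v\<close>, which are distinct coordinates. Its probability is therefore a product.\<close>

lemma in_tree_of_iff:
  "v \<in> tree_of X \<longleftrightarrow> (\<forall>u\<in>(\<lambda>j. take j v) ` {..<length v}. X u \<in> {v ! length u<..})"
proof (induction v rule: rev_induct)
  case Nil
  then show ?case by (simp add: tree_of.root)
next
  case (snoc i v)
  have "(\<forall>u\<in>(\<lambda>j. take j (v @ [i])) ` {..<length (v @ [i])}. X u \<in> {(v @ [i]) ! length u<..}) \<longleftrightarrow>
      (\<forall>j<Suc (length v). (v @ [i]) ! j < X (take j (v @ [i])))"
    by auto
  also have "\<dots> \<longleftrightarrow> (\<forall>j<length v. v ! j < X (take j v)) \<and> i < X v"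
    by (auto simp: less_Suc_eq nth_append)
  also have "(\<forall>j<length v. v ! j < X (take j v)) \<longleftrightarrow> v \<in> tree_of X"
    by (auto simp: snoc)
  finally show ?case by (simp add: snoc_in_tree_of_iff)
qed

lemma emeasure_in_tree_of:
  fixes D :: "nat pmf"
  defines "B \<equiv> \<Pi>\<^sub>M v\<in>(UNIV :: vertex set). measure_pmf D"
  shows "emeasure B {X \<in> space B. [] \<in> tree_of X} = 1"
    and "emeasure B {X \<in> space B. v @ [i] \<in> tree_of X} =
      emeasure B {X \<in> space B. v \<in> tree_of X} * emeasure (measure_pmf D) {i<..}"
proof -
  interpret B: product_prob_space "\<lambda>_. measure_pmf D" "UNIV :: vertex set"
    by (rule product_prob_spaceI) (rule prob_space_measure_pmf)
  have box: "emeasure B {X \<in> space B. v \<in> tree_of X} =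
      (\<Prod>u\<in>(\<lambda>j. take j v) ` {..<length v}. emeasure (measure_pmf D) {v ! length u<..})" for v
    unfolding in_tree_of_iff B_def by (rule B.emeasure_PiM_Collect) auto
  show "emeasure B {X \<in> space B. [] \<in> tree_of X} = 1"
    unfolding box by simp
  \<comment> \<open>The offspring number at \<open>v\<close> is not among those deciding whether
    \<open>v\<close> is in the tree, whence the product.\<close>
  have fresh: "v \<notin> (\<lambda>j. take j v) ` {..<length v}"
  proof
    assume "v \<in> (\<lambda>j. take j v) ` {..<length v}"
    then obtain j where j: "j < length v" "v = take j v" by auto
    have "length v = length (take j v)" by (rule arg_cong[OF j(2)])
    then show False using j(1) by simp
  qed
  have prefixes: "(\<lambda>j. take j (v @ [i])) ` {..<length (v @ [i])} = insert v ((\<lambda>j. take j v) ` {..<length v})"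
    by (auto simp: lessThan_Suc)
  have "emeasure B {X \<in> space B. v @ [i] \<in> tree_of X} =
      emeasure (measure_pmf D) {(v @ [i]) ! length v<..} *
      (\<Prod>u\<in>(\<lambda>j. take j v) ` {..<length v}. emeasure (measure_pmf D) {(v @ [i]) ! length u<..})"
    unfolding box prefixes
    by (rule prod.insert[OF _ fresh]) simp
  also have "(\<Prod>u\<in>(\<lambda>j. take j v) ` {..<length v}. emeasure (measure_pmf D) {(v @ [i]) ! length u<..}) =
      emeasure B {X \<in> space B. v \<in> tree_of X}"
    unfolding box by (rule prod.cong) (auto simp: nth_append)
  finally show "emeasure B {X \<in> space B. v @ [i] \<in> tree_of X} =
      emeasure B {X \<in> space B. v \<in> tree_of X} * emeasure (measure_pmf D) {i<..}"
    by (simp add: mult.commute)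
qed

section \<open>Weighted total size of a Galton-Watson tree\<close>

lemma sets_in_tree_space: "{T. v \<in> T} \<in> sets tree_space"
  unfolding tree_space_def by auto

lemma space_tree_space: "space tree_space = UNIV"
  by (simp add: tree_space_def)

lemma pred_in_tree: "Measurable.pred tree_space (\<lambda>T. v \<in> T)"
  by (simp add: pred_def space_tree_space sets_in_tree_space)

text \<open>The sum of \<open>c ^ length v\<close> over the vertices \<open>v\<close> of the tree.
  Enumerating all lists by \<open>list_decode\<close> makes it a series of measurable terms, defined
  for arbitrary vertex sets.\<close>

definition weighted_size :: "real \<Rightarrow> vertex set \<Rightarrow> ennreal" where
  "weighted_size c T = (\<Sum>n. ennreal (c ^ length (list_decode n)) * indicator T (list_decode n))"

lemma measurable_indicator_tree: "(\<lambda>T. indicator T v :: ennreal) \<in> borel_measurable tree_space"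
proof -
  have "(\<lambda>T. indicator T v :: ennreal) = indicator {T. v \<in> T}"
    by (auto simp: indicator_def fun_eq_iff)
  then show ?thesis using sets_in_tree_space by simp
qed

text \<open>The expected number of vertices in generation \<open>k\<close> is the
  \<open>k\<close>-th power of the mean offspring number, so the expectation is a geometric
  series.\<close>

lemma nn_integral_weighted_size:
  assumes c: "c \<ge> 0"
  shows "(\<integral>\<^sup>+T. weighted_size c T \<partial>galton_watson D) =
    (\<Sum>k. (ennreal c * (\<integral>\<^sup>+n. ennreal (real n) \<partial>measure_pmf D)) ^ k)"
proof -
  let ?B = "\<Pi>\<^sub>M v\<in>(UNIV :: vertex set). measure_pmf D"
  define b where "b v = ennreal (c ^ length v) * emeasure ?B {X \<in> space ?B. v \<in> tree_of X}" for v
  have sets: "sets (galton_watson D) = sets tree_space" by (simp add: galton_watson_def)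
  have [measurable]: "(\<lambda>T. indicator T v :: ennreal) \<in> borel_measurable (galton_watson D)" for v
    using measurable_indicator_tree by (simp add: measurable_cong_sets[OF sets refl])
  have prob: "(\<integral>\<^sup>+T. indicator T v \<partial>galton_watson D) = emeasure ?B {X \<in> space ?B. v \<in> tree_of X}" for v
  proof -
    have "(\<integral>\<^sup>+T. indicator T v \<partial>galton_watson D) = (\<integral>\<^sup>+T. indicator {T. v \<in> T} T \<partial>galton_watson D)"
      by (intro nn_integral_cong) (auto simp: indicator_def)
    also have "\<dots> = emeasure (galton_watson D) {T. v \<in> T}"
      using sets_in_tree_space sets by simp
    also have "\<dots> = emeasure ?B (tree_of -` {T. v \<in> T} \<inter> space ?B)"
      unfolding galton_watson_def by (rule emeasure_distr[OF tree_of_measurable sets_in_tree_space])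
    also have "tree_of -` {T. v \<in> T} \<inter> space ?B = {X \<in> space ?B. v \<in> tree_of X}" by auto
    finally show ?thesis .
  qed
  have "(\<integral>\<^sup>+T. weighted_size c T \<partial>galton_watson D) = (\<Sum>n. \<integral>\<^sup>+T. ennreal (c ^ length (list_decode n)) *
      indicator T (list_decode n) \<partial>galton_watson D)"
    unfolding weighted_size_def by (rule nn_integral_suminf) measurable
  also have "\<dots> = (\<Sum>n. b (list_decode n))"
    by (subst nn_integral_cmult) (simp_all add: b_def prob)
  also have "\<dots> = (\<integral>\<^sup>+n. b (list_decode n) \<partial>count_space UNIV)"
    by (rule nn_integral_count_space_nat[symmetric])
  also have "\<dots> = (\<integral>\<^sup>+v. b v \<partial>count_space UNIV)"
    by (rule nn_integral_bij_count_space[OF bij_list_decode])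
  also have "\<dots> = (\<Sum>k. (\<integral>\<^sup>+i. ennreal c * emeasure (measure_pmf D) {i<..} \<partial>count_space UNIV) ^ k)"
  proof (rule nn_integral_tree_recursion_sum)
    show "b [] = 1" by (simp add: b_def emeasure_in_tree_of(1))
    show "b (v @ [i]) = b v * (ennreal c * emeasure (measure_pmf D) {i<..})" for v i
      unfolding b_def emeasure_in_tree_of(2) using c by (simp add: ennreal_mult mult_ac)
  qed
  also have "(\<integral>\<^sup>+i. ennreal c * emeasure (measure_pmf D) {i<..} \<partial>count_space UNIV) =
      ennreal c * (\<integral>\<^sup>+n. ennreal (real n) \<partial>measure_pmf D)"
    by (subst nn_integral_cmult) (auto simp: nn_integral_tail_probabilities)
  finally show ?thesis .
qed

lemma AE_weighted_size_finite:
  assumes c: "c \<ge> 0" and D: "integrable (measure_pmf D) real" and less: "c * measure_pmf.expectation D real < 1"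
  shows "AE T in galton_watson D. weighted_size c T \<noteq> \<infinity>"
proof (rule nn_integral_noteq_infinite)
  let ?m = "measure_pmf.expectation D real"
  have m: "?m \<ge> 0" by (intro Bochner_Integration.integral_nonneg) simp
  have "(\<integral>\<^sup>+T. weighted_size c T \<partial>galton_watson D) = (\<Sum>k. (ennreal c * ennreal ?m) ^ k)"
    unfolding nn_integral_weighted_size[OF c] using nn_integral_eq_integral[OF D] by simp
  also have "\<dots> = (\<Sum>k. ennreal ((c * ?m) ^ k))"
    by (simp only: ennreal_mult[OF c m, symmetric] ennreal_power[OF mult_nonneg_nonneg[OF c m]])
  also have "\<dots> = ennreal (\<Sum>k. (c * ?m) ^ k)"
    using c m less by (intro suminf_ennreal2 summable_geometric) auto
  finally show "(\<integral>\<^sup>+T. weighted_size c T \<partial>galton_watson D) \<noteq> \<infinity>" by simp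
  have "weighted_size c \<in> borel_measurable tree_space"
    using measurable_indicator_tree unfolding weighted_size_def by measurable
  then show "weighted_size c \<in> borel_measurable (galton_watson D)"
    by (simp add: galton_watson_def)
qed

lemma sum_le_weighted_size:
  assumes F: "finite F" "F \<subseteq> T"
  shows "(\<Sum>v\<in>F. ennreal (c ^ length v)) \<le> weighted_size c T"
proof -
  have "(\<Sum>v\<in>F. ennreal (c ^ length v)) =
      (\<Sum>n\<in>list_encode ` F. ennreal (c ^ length (list_decode n)) * indicator T (list_decode n))"
    using F by (subst sum.reindex) (auto simp: inj_on_def list_encode_eq subset_eq intro!: sum.cong)
  also have "\<dots> \<le> weighted_size c T"
    unfolding weighted_size_def using F by (intro sum_le_suminf) auto
  finally show ?thesis .
qed

text \<open>Every vertex of generation \<open>k\<close> contributes the same positive amount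
  \<open>c ^ k\<close>. Hence finite total weight gives finite generations, from which local
  finiteness of the random tree is later read off, besides summability.\<close>

lemma weighted_size_finite_imp:
  assumes c: "c > 0" and fin: "weighted_size c T \<noteq> \<infinity>"
  shows "finite {v \<in> T. length v = k}"
    and "summable (\<lambda>n. c ^ n * card {v \<in> T. length v = n})"
proof -
  obtain B where B: "weighted_size c T = ennreal B" "B \<ge> 0"
    using fin by (cases "weighted_size c T") auto
  have bound: "(\<Sum>v\<in>F. c ^ length v) \<le> B" if "finite F" "F \<subseteq> T" for F
    using sum_le_weighted_size[OF that, of c] c B by (simp add: sum_ennreal)
  show level: "finite {v \<in> T. length v = k}" for k
  proof -
    \<comment> \<open>A finite set of vertices of generation \<open>k\<close> has total weight
      \<open>c ^ k * card G\<close>, which is at most \<open>B\<close>.\<close>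
    have "card G \<le> nat \<lceil>B / c ^ k\<rceil>" if G: "G \<subseteq> {v \<in> T. length v = k}" "finite G" for G
    proof -
      have "c ^ k * card G = (\<Sum>v\<in>G. c ^ length v)"
        using G by (simp add: subset_eq)
      also have "\<dots> \<le> B" using G by (intro bound) auto
      finally have "real (card G) \<le> B / c ^ k" using c by (simp add: field_simps)
      then show ?thesis by linarith
    qed
    then show ?thesis using finite_if_finite_subsets_card_bdd by blast
  qed
  show "summable (\<lambda>n. c ^ n * card {v \<in> T. length v = n})"
  proof (rule summableI_nonneg_bounded)
    fix n
    have "(\<Sum>k<n. c ^ k * card {v \<in> T. length v = k}) = (\<Sum>k<n. \<Sum>v\<in>{v \<in> T. length v = k}. c ^ length v)"
      by (simp add: mult.commute)
    also have "\<dots> = (\<Sum>v\<in>(\<Union>k<n. {v \<in> T. length v = k}). c ^ length v)"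
      by (rule sum.UNION_disjoint[symmetric]) (auto simp: level)
    also have "\<dots> \<le> B" by (rule bound) (auto simp: level)
    finally show "(\<Sum>k<n. c ^ k * card {v \<in> T. length v = k}) \<le> B" .
  qed (use c in simp)
qed

text \<open>The space of the law contains all vertex sets, so being a tree is an almost sure
  statement. It is a countable combination of membership events, hence measurable, and holds for
  every value of \<open>tree_of\<close>.\<close>

lemma AE_galton_watson_closed:
  "AE T in galton_watson D. [] \<in> T \<and> (\<forall>v i. v @ [i] \<in> T \<longrightarrow> v \<in> T)"
proof -
  note [measurable] = pred_in_tree
  have "{T \<in> space tree_space. [] \<in> T \<and> (\<forall>v i. v @ [i] \<in> T \<longrightarrow> v \<in> T)} \<in> sets tree_space"
    by measurable
  then show ?thesis
    unfolding galton_watson_def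
    by (subst AE_distr_iff[OF tree_of_measurable]) (auto simp: tree_of.root snoc_in_tree_of_iff)
qed

text \<open>The strict inequality leaves room above \<open>x\<close>. A positive \<open>c\<close> is
  wanted even if \<open>x = 0\<close>, since powers of \<open>c\<close> are divided by.\<close>

lemma ex_contraction_bound:
  assumes m: "(m::real) > 0" and less: "ereal m * x < 1"
  shows "\<exists>c>0. x \<le> ereal c \<and> c * m < 1"
proof (cases x)
  case (real r)
  then have "m * r < 1" using less by (simp add: one_ereal_def)
  then have "r < 1 / m" using m by (simp add: field_simps)
  then obtain c where "max r 0 < c" "c < 1 / m"
    using dense[of "max r 0" "1 / m"] m by auto
  then show ?thesis using m real by (intro exI[of _ c]) (auto simp: field_simps)
next
  case PInf
  then show ?thesis using less m by simp
next
  case MInf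
  \<comment> \<open>Any positive number below \<open>1 / m\<close> would do.\<close>
  then show ?thesis using m by (intro exI[of _ "1 / (2 * m)"]) (auto simp: field_simps)
qed

theorem theorem2p1:
  fixes M :: "real ^ 'q ^ 'q::finite" and \<alpha> :: "real ^ 'q" and D :: "nat pmf"
  assumes "CARD('q) \<ge> 2"
    and "\<forall>i j. M $ i $ j > 0"
    and "\<forall>i. (\<Sum>j\<in>UNIV. M $ i $ j) = 1"
    and "\<alpha> \<in> prob_simplex" and "\<alpha> v* M = \<alpha>"
    and "set_pmf D \<subseteq> {1..}"
    and "integrable (measure_pmf D) real"
    and "ereal (measure_pmf.expectation D real) * contraction \<alpha> M < 1"
  shows "AE T in galton_watson D.
           extremal_gibbs T \<alpha> M (tree_chain T \<alpha> M) \<and> no_reconstruction T \<alpha> (tree_chain T \<alpha> M)"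
proof -
  let ?m = "measure_pmf.expectation D real"
  \<comment> \<open>All offspring numbers are at least 1, so the mean is positive, as the choice of
    \<open>c\<close> requires.\<close>
  have "(\<integral>n. 1 \<partial>measure_pmf D) \<le> ?m"
    using assms(6,7) by (intro integral_mono_AE) (auto simp: AE_measure_pmf_iff)
  then have "?m > 0" by simp
  then obtain c where c: "c > 0" "contraction \<alpha> M \<le> ereal c" "c * ?m < 1"
    using ex_contraction_bound[OF _ assms(8)] by blast
  have "AE T in galton_watson D. weighted_size c T \<noteq> \<infinity>"
    using c assms(7) by (intro AE_weighted_size_finite) auto
  with AE_galton_watson_closed[of D] show ?thesis
  proof eventually_elim
    case (elim T)
    \<comment> \<open>The children of \<open>v\<close> lie in generation
      \<open>Suc (length v)\<close>, which is finite because the weighted size is.\<close>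
    have fin: "finite {i. v @ [i] \<in> T}" for v
    proof -
      have "finite ((\<lambda>i. v @ [i]) ` {i. v @ [i] \<in> T})"
        by (rule finite_subset[OF _ weighted_size_finite_imp(1)[OF c(1) elim(2), of "Suc (length v)"]]) auto
      then show ?thesis by (rule finite_imageD) (simp add: inj_on_def)
    qed
    interpret markov_tree T M \<alpha>
      by unfold_locales (use elim(1) fin assms(2-5) in auto)
    interpret contracting_chain T M \<alpha> "tree_chain T \<alpha> M" c
      by unfold_locales
         (use is_tree_chain_tree_chain c contraction_le_imp_contracting in auto)
    have "summable (\<lambda>n. c ^ n * card (level n))"
      using weighted_size_finite_imp(2)[OF c(1) elim(2)] by (simp add: level_def)
    then show ?case
      using extremal_chain no_reconstruction_chain by blast
  qed
qed

end
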